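(* The limiting optimal control problem has a unique solution $(\mathbf{y}_\infty^*,\mathbf{u}_\infty^* )\in\mathbf{V}_\infty\times\mathbf{U}_\infty^{ad}$. Let $\{(\mathbf{y}_k^*,\mathbf{u}_k^* )\}_{k\ge0}$ be the discrete optimal states and controls generated by the adaptive algorithm. Then, as $k\to\infty$, $\mathbf{u}_k^*\rightharpoonup\mathbf{u}_\infty^*$ weakly in $L^2(\Omega)^3$ and $\mathbf{y}_k^*\rightharpoonup\mathbf{y}_\infty^*$ weakly in $\mathbf{H}_0(\mathbf{curl},\Omega)$.
   Context: Standing setting. Let $\Omega\subset\mathbb{R}^3$ be a bounded Lipschitz domain, partitioned into disjoint polyhedral Lipschitz subdomains $\Omega_1,\dots,\Omega_m$ with $\overline\Omega=\bigcup_i\overline{\Omega_i}$; let $\Gamma=\bigcup_i\partial\Omega_i\setminus\partial\Omega$. Vector fields are $\mathbb{R}^3$-valued; $(\cdot,\cdot)_{0,G}$, $\|\cdot\|_{0,G}$ denote the $L^2(G)$ inner product and norm; $\mathbf{H}(\mathbf{curl},G)=\{\mathbf{v}\in L^2(G)^3:\mathbf{curl}\,\mathbf{v}\in L^2(G)^3\}$ with $\|\mathbf{v}\|_{\mathbf{curl},G}^2=\|\mathbf{v}\|_{0,G}^2+\|\mathbf{curl}\,\mathbf{v}\|_{0,G}^2$; $\mathbf{H}(\mathrm{div},G)=\{\mathbf{v}\in L^2(G)^3:\mathrm{div}\,\mathbf{v}\in L^2(G)\}$ with $\|\mathbf{v}\|_{\mathrm{div},G}^2=\|\mathbf{v}\|_{0,G}^2+\|\mathrm{div}\,\mathbf{v}\|_{0,G}^2$;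 $\mathbf{V}:=\mathbf{H}_0(\mathbf{curl},\Omega)$ is the subspace of $\mathbf{H}(\mathbf{curl},\Omega)$ with vanishing tangential trace $\mathbf{n}\times\mathbf{v}=0$ on $\partial\Omega$. The coefficients $\mu,\sigma$ are polynomials on each $\Omega_i$ with $\mu\ge\mu_0>0$, $\sigma\ge\sigma_0>0$, and $\alpha>0$ is a constant. The data satisfy: $\mathbf{f}\in L^2(\Omega)^3$ with $\mathbf{f}|_{\Omega_i}\in\mathbf{H}(\mathrm{div},\Omega_i)$ and $\mathbf{f}\cdot\mathbf{n}\in L^2(\partial\Omega_i)$ for each $i$ ($\mathrm{div}\,\mathbf{f}$ is understood subdomainwise); $\mathbf{y}^d\in\mathbf{H}_0(\mathbf{curl},\Omega)$; $\mathbf{u}^d\in L^2(\Omega)^3$. Let $B(\mathbf{u},\mathbf{v})=(\mu^{-1}\mathbf{curl}\,\mathbf{u},\mathbf{curl}\,\mathbf{v})_{0,\Omega}+(\sigma\mathbf{u},\mathbf{v})_{0,\Omega}$ and $\mathbf{U}^{ad}=\{\mathbf{u}\in L^2(\Omega)^3:\mathbf{u}\ge\mathbf{0}\text{ componentwise a.e.}\}$. For $\mathbf{u}\in L^2(\Omega)^3$, $\mathbf{y}(\mathbf{u})\in\mathbf{V}$ solves $B(\mathbf{y}(\mathbf{u}),\boldsymbol\phi)=(\mathbf{f}+\mathbf{u},\boldsymbol\phi)_{0,\Omega}$ for all $\boldsymbol\phi\in\mathbf{V}$, and $\mathbf{p}(\mathbf{u})\in\mathbf{V}$ solves $B(\mathbf{p}(\mathbf{u}),\boldsymbol\phi)=(\mathbf{curl}\,\mathbf{y}(\mathbf{u})-\mathbf{y}^d,\mathbf{curl}\,\boldsymbol\phi)_{0,\Omega}$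 for all $\boldsymbol\phi\in\mathbf{V}$. The control problem is to minimize $J(\mathbf{u})=\frac12\|\mathbf{curl}\,\mathbf{y}(\mathbf{u})-\mathbf{y}^d\|_{0,\Omega}^2+\frac\alpha2\|\mathbf{u}-\mathbf{u}^d\|_{0,\Omega}^2$ over $\mathbf{U}^{ad}$; it has a unique minimizer $\mathbf{u}^*$, and with $\mathbf{y}^*=\mathbf{y}(\mathbf{u}^* )$, $\mathbf{p}^*=\mathbf{p}(\mathbf{u}^* )$ the triple $(\mathbf{y}^*,\mathbf{p}^*,\mathbf{u}^* )\in\mathbf{V}\times\mathbf{V}\times\mathbf{U}^{ad}$ is the unique solution of the continuous optimality system: $B(\mathbf{y}^*,\boldsymbol\phi)=(\mathbf{f}+\mathbf{u}^*,\boldsymbol\phi)_{0,\Omega}$ and $B(\mathbf{p}^*,\boldsymbol\phi)=(\mathbf{curl}\,\mathbf{y}^*-\mathbf{y}^d,\mathbf{curl}\,\boldsymbol\phi)_{0,\Omega}$ for all $\boldsymbol\phi\in\mathbf{V}$, and $(\mathbf{p}^*+\alpha(\mathbf{u}^*-\mathbf{u}^d),\mathbf{u}-\mathbf{u}^* )_{0,\Omega}\ge0$ for all $\mathbf{u}\in\mathbf{U}^{ad}$. Set $\boldsymbol\lambda^*=\mathbf{p}^*+\alpha(\mathbf{u}^*-\mathbf{u}^d)$. Discrete setting. $\Omega$ is polyhedral. A triangulation $\mathcal{T}_h$ is a conforming tetrahedral mesh of $\Omega$ such that each $\Omega_i$ is a union of elements; $h_T$ is the diameter of $T\in\mathcal{T}_h$,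 $\mathcal{F}_h$ the set of interior faces, $h_F$ the diameter of a face $F$. Let $\mathbf{V}_h=\{\mathbf{v}\in\mathbf{V}:\mathbf{v}|_T=\mathbf{a}_T\times\mathbf{x}+\mathbf{b}_T,\ \mathbf{a}_T,\mathbf{b}_T\in\mathbb{R}^3,\ T\in\mathcal{T}_h\}$ (lowest-order Nédélec edge elements of the first family), $\mathbf{U}_h$ the space of elementwise constant vector fields, $\mathbf{U}_h^{ad}=\mathbf{U}_h\cap\mathbf{U}^{ad}$, $\mathbb{P}_h$ the $L^2$-orthogonal projection onto $\mathbf{U}_h$ (elementwise mean values), and $\mathbf{u}_h^d=\mathbb{P}_h\mathbf{u}^d$. The discrete optimality system has a unique solution $(\mathbf{y}_h^*,\mathbf{p}_h^*,\mathbf{u}_h^* )\in\mathbf{V}_h\times\mathbf{V}_h\times\mathbf{U}_h^{ad}$: $B(\mathbf{y}_h^*,\boldsymbol\phi_h)=(\mathbf{f}+\mathbf{u}_h^*,\boldsymbol\phi_h)_{0,\Omega}$ and $B(\mathbf{p}_h^*,\boldsymbol\phi_h)=(\mathbf{curl}\,\mathbf{y}_h^*-\mathbf{y}^d,\mathbf{curl}\,\boldsymbol\phi_h)_{0,\Omega}$ for all $\boldsymbol\phi_h\in\mathbf{V}_h$, and $(\mathbb{P}_h\mathbf{p}_h^*+\alpha(\mathbf{u}_h^*-\mathbf{u}_h^d),\mathbf{u}_h-\mathbf{u}_h^* )_{0,\Omega}\ge0$ for all $\mathbf{u}_h\in\mathbf{U}_h^{ad}$ (it is the minimizer of $J$ with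 the state equation restricted to $\mathbf{V}_h$, over $\mathbf{U}_h^{ad}$). Set $\boldsymbol\lambda_h^*=\mathbb{P}_h\mathbf{p}_h^*+\alpha(\mathbf{u}_h^*-\mathbf{u}_h^d)$. For a family of triangulations, $A\lesssim B$ means $A\le CB$ with $C$ independent of the mesh sizes, depending only on $\Omega$, the coefficients and data, $\alpha$, and the shape-regularity constant of the family. Error estimator. For an interior face $F$, $[\cdot]_F$ denotes the jump across $F$, $\gamma_t(\mathbf{v})=\mathbf{n}\times\mathbf{v}$ and $\gamma_n(\mathbf{v})=\mathbf{v}\cdot\mathbf{n}$ (differential operators below are applied elementwise). For $T\in\mathcal{T}_h$ let $\eta_{y,T}^{(1)}=h_T\|\mathbf{f}+\mathbf{u}_h^*-\mathbf{curl}\,\mu^{-1}\mathbf{curl}\,\mathbf{y}_h^*-\sigma\mathbf{y}_h^*\|_{0,T}$, $\eta_{y,T}^{(2)}=h_T\|\mathrm{div}(\mathbf{f}-\sigma\mathbf{y}_h^* )\|_{0,T}$, $\eta_{p,T}^{(1)}=h_T\|\mathbf{curl}\,\mathbf{y}^d+\mathbf{curl}\,\mu^{-1}\mathbf{curl}\,\mathbf{p}_h^*+\sigma\mathbf{p}_h^*\|_{0,T}$, $\eta_{p,T}^{(2)}=h_T\|\mathrm{div}(\sigma\mathbf{p}_h^* )\|_{0,T}$, $\eta_{p,T}^{(3)}=\|\mathbf{p}_h^*-\mathbb{P}_h\mathbf{p}_h^*\|_{0,T}$, and for $F\in\mathcal{F}_h$ let $\eta_{y,F}^{(1)}=h_F^{1/2}\|[\gamma_t(\mu^{-1}\mathbf{curl}\,\mathbf{y}_h^*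 )]_F\|_{0,F}$, $\eta_{y,F}^{(2)}=h_F^{1/2}\|[\gamma_n(\mathbf{f}+\mathbf{u}_h^*-\sigma\mathbf{y}_h^* )]_F\|_{0,F}$, $\eta_{p,F}^{(1)}=h_F^{1/2}\|[\gamma_t(-\mu^{-1}\mathbf{curl}\,\mathbf{p}_h^*+\mathbf{curl}\,\mathbf{y}_h^* )]_F\|_{0,F}$, $\eta_{p,F}^{(2)}=h_F^{1/2}\|[\gamma_n(\sigma\mathbf{p}_h^* )]_F\|_{0,F}$. Put $\eta_T^2=\sum_{i=1,2}(\eta_{y,T}^{(i)})^2+\sum_{i=1,2,3}(\eta_{p,T}^{(i)})^2$, $\eta_F^2=\sum_{i=1,2}\big((\eta_{y,F}^{(i)})^2+(\eta_{p,F}^{(i)})^2\big)$, $\eta_h^2(T)=\eta_T^2+\frac12\sum_{F\in\mathcal{F}_h,F\subset\partial T}\eta_F^2$, $\mathrm{osc}_T(\mathbf{u}^d)=\|\mathbf{u}^d-\mathbb{P}_h\mathbf{u}^d\|_{0,T}$, $\hat\eta_h^2(T)=\eta_h^2(T)+\mathrm{osc}_T^2(\mathbf{u}^d)$ and $\hat\eta_h^2=\sum_{T\in\mathcal{T}_h}\hat\eta_h^2(T)$. Adaptive algorithm. Start from a conforming, shape-regular initial triangulation $\mathcal{T}_0$ (compatible with the subdomains and admissible for newest-vertex bisection). For $k=0,1,2,\dots$: (SOLVE) compute the discrete solution $(\mathbf{y}_k^*,\mathbf{p}_k^*,\mathbf{u}_k^* )$ on $\mathcal{T}_k$; (ESTIMATE)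 compute $\hat\eta_k(T)$ for all $T\in\mathcal{T}_k$; (MARK) choose $\mathcal{M}_k\subset\mathcal{T}_k$ containing at least one element $\widetilde T_k$ with $\hat\eta_k(\widetilde T_k)=\max_{T\in\mathcal{T}_k}\hat\eta_k(T)$; (REFINE) bisect every element of $\mathcal{M}_k$ at least once, together with further elements as needed, to obtain the smallest conforming refinement $\mathcal{T}_{k+1}$ with $\mathcal{T}_{k+1}\cap\mathcal{M}_k=\varnothing$. The resulting meshes are nested, conforming and uniformly shape regular; the index $k$ replaces $h$ in all notation ($\mathbf{V}_k,\mathbf{U}_k,\mathbf{U}_k^{ad},\mathbb{P}_k,\hat\eta_k$, etc.). Limiting problem. With the adaptive meshes $\{\mathcal{T}_k\}$, set $\mathbf{V}_\infty=\overline{\bigcup_{k\ge0}\mathbf{V}_k}^{\mathbf{H}(\mathbf{curl})}$, $\mathbf{U}_\infty=\overline{\bigcup_{k\ge0}\mathbf{U}_k}^{L^2}$, $\mathbf{U}_\infty^{ad}=\overline{\bigcup_{k\ge0}\mathbf{U}_k^{ad}}^{L^2}$ $(=\mathbf{U}_\infty\cap\mathbf{U}^{ad})$. The limiting problem is: minimize $\frac12\|\mathbf{curl}\,\mathbf{y}_\infty-\mathbf{y}^d\|_{0,\Omega}^2+\frac\alpha2\|\mathbf{u}_\infty-\mathbf{u}^d\|_{0,\Omega}^2$ over $(\mathbf{y}_\infty,\mathbf{u}_\infty)\in\mathbf{V}_\infty\times\mathbf{U}_\infty^{ad}$ subject to $B(\mathbf{y}_\infty,\boldsymbol\phi)=(\mathbf{f}+\mathbf{u}_\infty,\boldsymbol\phi)_{0,\Omega}$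 for all $\boldsymbol\phi\in\mathbf{V}_\infty$. Its solution is denoted $(\mathbf{y}_\infty^*,\mathbf{u}_\infty^* )$, and $\mathbf{p}_\infty^*\in\mathbf{V}_\infty$ is defined by $B(\mathbf{p}_\infty^*,\boldsymbol\phi)=(\mathbf{curl}\,\mathbf{y}_\infty^*-\mathbf{y}^d,\mathbf{curl}\,\boldsymbol\phi)_{0,\Omega}$ for all $\boldsymbol\phi\in\mathbf{V}_\infty$; then $(\mathbf{p}_\infty^*+\alpha(\mathbf{u}_\infty^*-\mathbf{u}^d),\mathbf{u}-\mathbf{u}_\infty^* )_{0,\Omega}\ge0$ for all $\mathbf{u}\in\mathbf{U}_\infty^{ad}$. *)

theory Defs
  imports "HOL-Analysis.Analysis"
begin

type_synonym pt = "real^3"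
type_synonym vfield = "real^3 \<Rightarrow> real^3"

definition pd :: "3 \<Rightarrow> (real^3 \<Rightarrow> 'b::real_normed_vector) \<Rightarrow> real^3 \<Rightarrow> 'b" where
  "pd j F x = frechet_derivative F (at x) (axis j 1)"

fun dit :: "3 list \<Rightarrow> (real^3 \<Rightarrow> 'b::real_normed_vector) \<Rightarrow> real^3 \<Rightarrow> 'b" where
  "dit [] F = F"
| "dit (j # js) F = pd j (dit js F)"

definition smooth3 :: "(real^3 \<Rightarrow> 'b::real_normed_vector) \<Rightarrow> bool" where
  "smooth3 F \<longleftrightarrow> (\<forall>js x. dit js F differentiable (at x))"

definition test_fun :: "(real^3) set \<Rightarrow> (real^3 \<Rightarrow> 'b::real_normed_vector) \<Rightarrow> bool" where
  "test_fun G F \<longleftrightarrow> smooth3 F \<and> (\<exists>K. compact K \<and> K \<subseteq> G \<and> (\<forall>x. x \<notin> K \<longrightarrow> F x = 0))"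

definition ccurl :: "vfield \<Rightarrow> vfield" where
  "ccurl F x = vector [pd 2 F x $ 3 - pd 3 F x $ 2, pd 3 F x $ 1 - pd 1 F x $ 3,
                       pd 1 F x $ 2 - pd 2 F x $ 1]"

definition cgrad :: "(real^3 \<Rightarrow> real) \<Rightarrow> vfield" where
  "cgrad g x = vector [pd 1 g x, pd 2 g x, pd 3 g x]"

definition L2 :: "(real^3) set \<Rightarrow> (real^3 \<Rightarrow> 'b::euclidean_space) \<Rightarrow> bool" where
  "L2 G F \<longleftrightarrow> F \<in> borel_measurable (lebesgue_on G) \<and> integrable (lebesgue_on G) (\<lambda>x. (norm (F x))\<^sup>2)"

definition ip :: "(real^3) set \<Rightarrow> vfield \<Rightarrow> vfield \<Rightarrow> real" where
  "ip G F H = integral\<^sup>L (lebesgue_on G) (\<lambda>x. F x \<bullet> H x)"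

definition ips :: "(real^3) set \<Rightarrow> (real^3 \<Rightarrow> real) \<Rightarrow> (real^3 \<Rightarrow> real) \<Rightarrow> real" where
  "ips G F H = integral\<^sup>L (lebesgue_on G) (\<lambda>x. F x * H x)"

definition nrm :: "(real^3) set \<Rightarrow> vfield \<Rightarrow> real" where
  "nrm G F = sqrt (ip G F F)"

definition is_wcurl :: "(real^3) set \<Rightarrow> vfield \<Rightarrow> vfield \<Rightarrow> bool" where
  "is_wcurl G F C \<longleftrightarrow> (\<forall>\<phi>. test_fun G \<phi> \<longrightarrow> ip G F (ccurl \<phi>) = ip G C \<phi>)"

definition Hcurl :: "(real^3) set \<Rightarrow> vfield set" where
  "Hcurl G = {F. L2 G F \<and> (\<exists>C. L2 G C \<and> is_wcurl G F C)}"

definition wcurl :: "(real^3) set \<Rightarrow> vfield \<Rightarrow> vfield" where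
  "wcurl G F = (SOME C. L2 G C \<and> is_wcurl G F C)"

definition nrm_curl :: "(real^3) set \<Rightarrow> vfield \<Rightarrow> real" where
  "nrm_curl G F = sqrt ((nrm G F)\<^sup>2 + (nrm G (wcurl G F))\<^sup>2)"

text \<open>Vanishing tangential trace n x v = 0, expressed through the Green formula defining the
  tangential trace: (curl v, w) - (v, curl w) = 0 for all w in H(curl).\<close>
definition Hcurl0 :: "(real^3) set \<Rightarrow> vfield set" where
  "Hcurl0 G = {F \<in> Hcurl G. \<forall>W \<in> Hcurl G. ip G (wcurl G F) W = ip G F (wcurl G W)}"

definition is_wdiv :: "(real^3) set \<Rightarrow> vfield \<Rightarrow> (real^3 \<Rightarrow> real) \<Rightarrow> bool" where
  "is_wdiv G F d \<longleftrightarrow> (\<forall>\<psi>::real^3 \<Rightarrow> real. test_fun G \<psi> \<longrightarrow> ip G F (cgrad \<psi>) = - ips G d \<psi>)"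

definition Hdiv :: "(real^3) set \<Rightarrow> vfield set" where
  "Hdiv G = {F. L2 G F \<and> (\<exists>d. L2 G d \<and> is_wdiv G F d)}"

definition lipschitz_domain :: "(real^3) set \<Rightarrow> bool" where
  "lipschitz_domain G \<longleftrightarrow> open G \<and> bounded G \<and> connected G \<and> G \<noteq> {} \<and>
    (\<forall>x \<in> frontier G. \<exists>r>0. \<exists>(Q :: real^3 \<Rightarrow> real^3) (L :: real). \<exists>g :: real \<times> real \<Rightarrow> real.
        orthogonal_transformation Q \<and> L-lipschitz_on UNIV g \<and>
        G \<inter> ball x r = {z \<in> ball x r. Q (z - x) $ 3 < g (Q (z - x) $ 1, Q (z - x) $ 2)})"

definition poly3 :: "(real^3 \<Rightarrow> real) \<Rightarrow> bool" where
  "poly3 p \<longleftrightarrow> (\<exists>(c :: nat \<Rightarrow> nat \<Rightarrow> nat \<Rightarrow> real) N. \<forall>x.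
      p x = (\<Sum>a\<le>N. \<Sum>b\<le>N. \<Sum>d\<le>N. c a b d * (x $ 1) ^ a * (x $ 2) ^ b * (x $ 3) ^ d))"

definition piecewise_poly :: "nat \<Rightarrow> (nat \<Rightarrow> (real^3) set) \<Rightarrow> (real^3 \<Rightarrow> real) \<Rightarrow> bool" where
  "piecewise_poly m Om c \<longleftrightarrow> (\<forall>i<m. \<exists>p. poly3 p \<and> (\<forall>x \<in> Om i. c x = p x))"

definition Bf :: "(real^3) set \<Rightarrow> (real^3 \<Rightarrow> real) \<Rightarrow> (real^3 \<Rightarrow> real) \<Rightarrow> vfield \<Rightarrow> vfield \<Rightarrow> real" where
  "Bf G \<mu> \<sigma> U W = ip G (\<lambda>x. (1 / \<mu> x) *\<^sub>R wcurl G U x) (wcurl G W) + ip G (\<lambda>x. \<sigma> x *\<^sub>R U x) W"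

definition Jcost :: "(real^3) set \<Rightarrow> real \<Rightarrow> vfield \<Rightarrow> vfield \<Rightarrow> vfield \<Rightarrow> vfield \<Rightarrow> real" where
  "Jcost G \<alpha> yd ud Y U = (1/2) * (nrm G (\<lambda>x. wcurl G Y x - yd x))\<^sup>2 + (\<alpha>/2) * (nrm G (\<lambda>x. U x - ud x))\<^sup>2"

definition Uad :: "(real^3) set \<Rightarrow> vfield set" where
  "Uad G = {U. L2 G U \<and> (AE x in lebesgue_on G. \<forall>i. 0 \<le> U x $ i)}"

text \<open>An element is given by its vertex set (4 affinely independent points); the closed
  tetrahedron is its convex hull.\<close>
definition conforming_mesh :: "(real^3) set \<Rightarrow> (real^3) set set \<Rightarrow> bool" where
  "conforming_mesh G \<T> \<longleftrightarrow> finite \<T> \<and>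
     (\<forall>T \<in> \<T>. card T = 4 \<and> \<not> affine_dependent T) \<and>
     \<Union>{convex hull T | T. T \<in> \<T>} = closure G \<and>
     (\<forall>T \<in> \<T>. \<forall>T' \<in> \<T>. convex hull T \<inter> convex hull T' = convex hull (T \<inter> T'))"

definition subdomain_compatible :: "nat \<Rightarrow> (nat \<Rightarrow> (real^3) set) \<Rightarrow> (real^3) set set \<Rightarrow> bool" where
  "subdomain_compatible m Om \<T> \<longleftrightarrow> (\<forall>T \<in> \<T>. \<exists>i<m. interior (convex hull T) \<subseteq> Om i)"

definition refines :: "(real^3) set set \<Rightarrow> (real^3) set set \<Rightarrow> bool" where
  "refines \<T>' \<T> \<longleftrightarrow> (\<forall>T' \<in> \<T>'. \<exists>T \<in> \<T>. convex hull T' \<subseteq> convex hull T)"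

text \<open>Lowest-order Nedelec edge elements of the first kind.\<close>
definition Vh :: "(real^3) set \<Rightarrow> (real^3) set set \<Rightarrow> vfield set" where
  "Vh G \<T> = {v \<in> Hcurl0 G. \<forall>T \<in> \<T>. \<exists>a b. \<forall>x \<in> interior (convex hull T). v x = cross3 a x + b}"

definition Uh :: "(real^3) set \<Rightarrow> (real^3) set set \<Rightarrow> vfield set" where
  "Uh G \<T> = {u. L2 G u \<and> (\<forall>T \<in> \<T>. \<exists>c. \<forall>x \<in> interior (convex hull T). u x = c)}"

definition Uhad :: "(real^3) set \<Rightarrow> (real^3) set set \<Rightarrow> vfield set" where
  "Uhad G \<T> = Uh G \<T> \<inter> Uad G"

text \<open>L2 projection onto elementwise constants: elementwise mean values.\<close>
definition Ph :: "(real^3) set set \<Rightarrow> vfield \<Rightarrow> vfield" where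
  "Ph \<T> F x = (if \<exists>T \<in> \<T>. x \<in> interior (convex hull T) then
       (let T = (SOME T. T \<in> \<T> \<and> x \<in> interior (convex hull T)) in
         (1 / measure lebesgue (convex hull T)) *\<^sub>R integral\<^sup>L (lebesgue_on (convex hull T)) F)
     else 0)"

definition discrete_opt :: "(real^3) set \<Rightarrow> (real^3 \<Rightarrow> real) \<Rightarrow> (real^3 \<Rightarrow> real) \<Rightarrow> real \<Rightarrow>
    vfield \<Rightarrow> vfield \<Rightarrow> vfield \<Rightarrow> (real^3) set set \<Rightarrow> vfield \<Rightarrow> vfield \<Rightarrow> vfield \<Rightarrow> bool" where
  "discrete_opt G \<mu> \<sigma> \<alpha> f yd ud \<T> Y P U \<longleftrightarrow>
     Y \<in> Vh G \<T> \<and> P \<in> Vh G \<T> \<and> U \<in> Uhad G \<T> \<and>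
     (\<forall>\<phi> \<in> Vh G \<T>. Bf G \<mu> \<sigma> Y \<phi> = ip G (\<lambda>x. f x + U x) \<phi>) \<and>
     (\<forall>\<phi> \<in> Vh G \<T>. Bf G \<mu> \<sigma> P \<phi> = ip G (\<lambda>x. wcurl G Y x - yd x) (wcurl G \<phi>)) \<and>
     (\<forall>W \<in> Uhad G \<T>. ip G (\<lambda>x. Ph \<T> P x + \<alpha> *\<^sub>R (U x - Ph \<T> ud x)) (\<lambda>x. W x - U x) \<ge> 0)"

definition Vinf :: "(real^3) set \<Rightarrow> (nat \<Rightarrow> (real^3) set set) \<Rightarrow> vfield set" where
  "Vinf G \<T> = {v \<in> Hcurl G. \<forall>e>0. \<exists>k. \<exists>w \<in> Vh G (\<T> k). nrm_curl G (\<lambda>x. v x - w x) < e}"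

definition Uinfad :: "(real^3) set \<Rightarrow> (nat \<Rightarrow> (real^3) set set) \<Rightarrow> vfield set" where
  "Uinfad G \<T> = {u. L2 G u \<and> (\<forall>e>0. \<exists>k. \<exists>w \<in> Uhad G (\<T> k). nrm G (\<lambda>x. u x - w x) < e)}"

definition lim_feasible :: "(real^3) set \<Rightarrow> (real^3 \<Rightarrow> real) \<Rightarrow> (real^3 \<Rightarrow> real) \<Rightarrow> vfield \<Rightarrow>
    (nat \<Rightarrow> (real^3) set set) \<Rightarrow> vfield \<Rightarrow> vfield \<Rightarrow> bool" where
  "lim_feasible G \<mu> \<sigma> f \<T> Y U \<longleftrightarrow> Y \<in> Vinf G \<T> \<and> U \<in> Uinfad G \<T> \<and>
     (\<forall>\<phi> \<in> Vinf G \<T>. Bf G \<mu> \<sigma> Y \<phi> = ip G (\<lambda>x. f x + U x) \<phi>)"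

definition lim_solution :: "(real^3) set \<Rightarrow> (real^3 \<Rightarrow> real) \<Rightarrow> (real^3 \<Rightarrow> real) \<Rightarrow> real \<Rightarrow>
    vfield \<Rightarrow> vfield \<Rightarrow> vfield \<Rightarrow> (nat \<Rightarrow> (real^3) set set) \<Rightarrow> vfield \<Rightarrow> vfield \<Rightarrow> bool" where
  "lim_solution G \<mu> \<sigma> \<alpha> f yd ud \<T> Y U \<longleftrightarrow> lim_feasible G \<mu> \<sigma> f \<T> Y U \<and>
     (\<forall>Y' U'. lim_feasible G \<mu> \<sigma> f \<T> Y' U' \<longrightarrow> Jcost G \<alpha> yd ud Y U \<le> Jcost G \<alpha> yd ud Y' U')"

definition weak_L2 :: "(real^3) set \<Rightarrow> (nat \<Rightarrow> vfield) \<Rightarrow> vfield \<Rightarrow> bool" where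
  "weak_L2 G X L \<longleftrightarrow> (\<forall>W. L2 G W \<longrightarrow> (\<lambda>k. ip G (X k) W) \<longlonglongrightarrow> ip G L W)"

definition weak_Hcurl0 :: "(real^3) set \<Rightarrow> (nat \<Rightarrow> vfield) \<Rightarrow> vfield \<Rightarrow> bool" where
  "weak_Hcurl0 G X L \<longleftrightarrow> (\<forall>W \<in> Hcurl0 G.
     (\<lambda>k. ip G (X k) W + ip G (wcurl G (X k)) (wcurl G W)) \<longlonglongrightarrow> ip G L W + ip G (wcurl G L) (wcurl G W))"

end

theory Submission
  imports Defs
begin

text \<open>
  The convergence is in fact strong, so no weak compactness is needed. Identify a state $y$ with
  the pair $(y, \mathrm{curl}\, y)$ in the Hilbert space $L^2 \times L^2$ of almost-everywhere classes.
  The limiting problem is a strongly convex minimisation over a closed convex set, hence uniquely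
  solvable, with an adjoint $p$ and a variational inequality as for the discrete problems. Testing the
  two variational inequalities and Galerkin orthogonality with approximants
  $Y_k, P_k \in V_k$, $w_k \in U_k^{ad}$ of $y$, $p$, $u$ gives
  $\alpha \|u - u_k\|^2 + \|\mathrm{curl}(y - y_k)\|^2 \le M (\|Y_k - y\| + \|P_k - p\| + \|w_k - u\|)$,
  since all iterates are bounded; nestedness makes the right-hand side tend to zero.
  The identification is legitimate because weak curls are unique up to null sets, by the
  fundamental lemma of the calculus of variations.
\<close>

text \<open>The theorem speaks of functions, while uniqueness, closures and completeness belong to
  almost-everywhere classes, and \<open>wcurl\<close> is an arbitrary choice among weak curls. All
  fields are therefore extended by zero and placed in one Hilbert space over the whole of R^3. The
  two limiting sets must then be recognised as closures of images; for the states this is the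
  closedness of the weak curl as an operator. Two further points bring the discrete and the limiting
  problem to one form. The mean-value projections disappear from the discrete variational
  inequality, because they are paired only with elementwise constants. And the cost sees the control
  and the curl of the state, but not the state itself; the missing part of its norm is supplied by
  the state equation, once for existence and once more for convergence.\<close>

section \<open>Nested Galerkin approximation of a control problem in Hilbert space\<close>

text \<open>Two near-minimisers that stay apart would have a competitor below the infimum, so every
  minimising sequence is Cauchy and completeness alone yields the minimiser.\<close>

lemma midpoint_convex_has_minimizer:
  fixes J :: "'a::complete_space \<Rightarrow> real"
  assumes "closed K" "K \<noteq> {}" "continuous_on K J" "0 < c"
    and lower: "\<And>x. x \<in> K \<Longrightarrow> b \<le> J x"
    and mid: "\<And>x y. x \<in> K \<Longrightarrow> y \<in> K \<Longrightarrow> \<exists>z\<in>K. J z \<le> (J x + J y) / 2 - c * (dist x y)\<^sup>2"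
  obtains x where "x \<in> K" "\<And>z. z \<in> K \<Longrightarrow> J x \<le> J z"
proof -
  define m where "m = Inf (J ` K)"
  have bdd: "bdd_below (J ` K)" using lower by (auto intro!: bdd_belowI2)
  have m_le: "m \<le> J z" if "z \<in> K" for z
    unfolding m_def using that bdd by (auto intro: cInf_lower)
  have "\<exists>z\<in>K. J z < m + inverse (real (Suc n))" for n
  proof -
    have "Inf (J ` K) < m + inverse (real (Suc n))" unfolding m_def by simp
    then show ?thesis using cInf_lessD[of "J ` K"] \<open>K \<noteq> {}\<close> by blast
  qed
  then obtain X where X: "\<And>n. X n \<in> K" "\<And>n. J (X n) < m + inverse (real (Suc n))" by metis
  have dist_X: "c * (dist (X i) (X j))\<^sup>2 \<le> inverse (real (Suc N))" if "N \<le> i" "N \<le> j" for i j N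
  proof -
    obtain z where "z \<in> K" "J z \<le> (J (X i) + J (X j)) / 2 - c * (dist (X i) (X j))\<^sup>2"
      using mid X(1) by metis
    then have "m \<le> (J (X i) + J (X j)) / 2 - c * (dist (X i) (X j))\<^sup>2"
      using m_le by force
    moreover have "inverse (real (Suc i)) \<le> inverse (real (Suc N))"
      "inverse (real (Suc j)) \<le> inverse (real (Suc N))"
      using that by (auto intro!: le_imp_inverse_le)
    ultimately show ?thesis using X(2)[of i] X(2)[of j] by argo
  qed
  have "Cauchy X"
  proof (rule metric_CauchyI)
    fix e :: real assume "0 < e"
    then obtain N where N: "inverse (real (Suc N)) < c * e\<^sup>2"
      using reals_Archimedean[of "c * e\<^sup>2"] \<open>0 < c\<close> by auto
    have "dist (X i) (X j) < e" if "N \<le> i" "N \<le> j" for i j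
    proof -
      have "c * (dist (X i) (X j))\<^sup>2 < c * e\<^sup>2" using dist_X[OF that] N by simp
      then have "(dist (X i) (X j))\<^sup>2 < e\<^sup>2" using \<open>0 < c\<close> by simp
      then show ?thesis using \<open>0 < e\<close> by (simp add: power2_less_imp_less)
    qed
    then show "\<exists>M. \<forall>m\<ge>M. \<forall>n\<ge>M. dist (X m) (X n) < e" by blast
  qed
  then obtain x where x: "X \<longlonglongrightarrow> x" using Cauchy_convergent convergent_def by blast
  have "x \<in> K" using closed_sequentially[OF \<open>closed K\<close>] X(1) x by blast
  have "(\<lambda>n. J (X n)) \<longlonglongrightarrow> J x"
    using assms(3) x X(1) \<open>x \<in> K\<close> continuous_on_sequentially[of K J] by (auto simp: comp_def)
  moreover have "(\<lambda>n. m + inverse (real (Suc n))) \<longlonglongrightarrow> m + 0"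
    by (intro tendsto_intros LIMSEQ_inverse_real_of_nat)
  ultimately have "J x \<le> m + 0" by (rule LIMSEQ_le) (use X(2) less_imp_le in blast)
  then show ?thesis using that[OF \<open>x \<in> K\<close>] m_le by fastforce
qed

text \<open>Division by t and t -> 0+ give the first-order condition for a quadratic along a
  segment. Only t up to 1 is available when the segment must stay in a convex set.\<close>

lemma linear_coeff_nonneg:
  fixes a b :: real
  assumes "\<And>t. 0 < t \<Longrightarrow> t \<le> 1 \<Longrightarrow> 0 \<le> t * a + t\<^sup>2 * b"
  shows "0 \<le> a"
proof (rule tendsto_lowerbound)
  show "((\<lambda>t. a + t * b) \<longlongrightarrow> a) (at_right 0)"
    by (auto intro!: tendsto_eq_intros)
  have "0 \<le> a + t * b" if "0 < t" "t \<le> 1" for t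
  proof -
    have "0 \<le> t * (a + t * b)" using assms[OF that] by (simp add: algebra_simps power2_eq_square)
    then show ?thesis using that by (simp add: zero_le_mult_iff)
  qed
  then show "\<forall>\<^sub>F t in at_right 0. 0 \<le> a + t * b"
    unfolding eventually_at_right_field by (auto intro!: exI[of _ 1])
qed simp

lemma bounded_bilinear_add:
  assumes "bounded_bilinear h" "bounded_bilinear g"
  shows "bounded_bilinear (\<lambda>x z. h x z + g x z)"
proof -
  interpret h: bounded_bilinear h by fact
  interpret g: bounded_bilinear g by fact
  show ?thesis
  proof
    obtain H C where HC: "\<And>x z. norm (h x z) \<le> norm x * norm z * H" "\<And>x z. norm (g x z) \<le> norm x * norm z * C"
      using h.bounded g.bounded by blast
    have "norm (h x z + g x z) \<le> norm x * norm z * (H + C)" for x z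
      using norm_triangle_mono[OF HC] by (simp add: distrib_left)
    then show "\<exists>K. \<forall>x z. norm (h x z + g x z) \<le> norm x * norm z * K" by blast
  qed (simp_all add: h.add_left g.add_left h.add_right g.add_right h.scaleR_left g.scaleR_left
      h.scaleR_right g.scaleR_right scaleR_add_right)
qed

text \<open>Nestedness makes the distance from x to \<open>S k\<close> tend to 0. This distance need
  not be attained, so w k is chosen nearest up to a slack 1/(k+1).\<close>

lemma nested_approximants:
  fixes S :: "nat \<Rightarrow> 'b::metric_space set"
  assumes mono: "\<And>i j. i \<le> j \<Longrightarrow> S i \<subseteq> S j" and ne: "\<And>k. S k \<noteq> {}"
    and x: "x \<in> closure (\<Union>k. S k)"
  obtains w where "\<And>k. w k \<in> S k" "w \<longlonglongrightarrow> x"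
proof -
  have "\<exists>w\<in>S k. dist x w \<le> infdist x (S k) + inverse (real (Suc k))" for k
  proof (rule ccontr)
    assume "\<not> ?thesis"
    then have "infdist x (S k) + inverse (real (Suc k)) \<le> dist x w" if "w \<in> S k" for w
      using that by force
    then have "infdist x (S k) + inverse (real (Suc k)) \<le> (INF w\<in>S k. dist x w)"
      by (rule cINF_greatest[OF ne])
    then show False using ne[of k] by (simp add: infdist_notempty)
  qed
  then obtain w where w: "\<And>k. w k \<in> S k" "\<And>k. dist x (w k) \<le> infdist x (S k) + inverse (real (Suc k))"
    by metis
  have "(\<lambda>k. infdist x (S k)) \<longlonglongrightarrow> 0"
  proof (rule LIMSEQ_I)
    fix e :: real assume "0 < e"
    then obtain z i where z: "z \<in> S i" "dist z x < e" using x unfolding closure_approachable by blast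
    have "infdist x (S k) < e" if "i \<le> k" for k
      using infdist_le[of z "S k" x] mono[OF that] z by (auto simp: dist_commute)
    then show "\<exists>N. \<forall>n\<ge>N. norm (infdist x (S n) - 0) < e" by (auto simp: infdist_nonneg)
  qed
  then have "(\<lambda>k. infdist x (S k) + inverse (real (Suc k))) \<longlonglongrightarrow> 0 + 0"
    by (intro tendsto_add LIMSEQ_inverse_real_of_nat)
  then have "(\<lambda>k. dist x (w k)) \<longlonglongrightarrow> 0"
    by (intro Lim_null_comparison[of "\<lambda>k. dist x (w k)"]) (use w in auto)
  then have "w \<longlonglongrightarrow> x" by (subst tendsto_dist_iff) (simp add: dist_commute)
  then show ?thesis using that w(1) by blast
qed

lemma Bseq_diff:
  fixes X Z :: "nat \<Rightarrow> 'b::real_normed_vector"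
  assumes "Bseq X" "Bseq Z"
  shows "Bseq (\<lambda>k. X k - Z k)"
proof -
  obtain a b where "\<And>k. norm (X k) \<le> a" "\<And>k. norm (Z k) \<le> b"
    using assms by (auto elim!: BseqE)
  then have "norm (X k - Z k) \<le> a + b" for k
    by (meson add_mono norm_triangle_ineq4 order_trans)
  then show ?thesis by (rule BseqI')
qed

lemma bounded_linear_Bseq:
  assumes "bounded_linear h" "Bseq X"
  shows "Bseq (\<lambda>k. h (X k))"
proof -
  obtain L a where L: "\<And>x. norm (h x) \<le> norm x * L" "0 \<le> L" and a: "\<And>k. norm (X k) \<le> a"
    using bounded_linear.nonneg_bounded[OF assms(1)] assms(2) by (auto elim!: BseqE)
  have "norm (h (X k)) \<le> a * L" for k
    using L(1) mult_right_mono[OF a L(2)] by (rule order_trans)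
  then show ?thesis by (rule BseqI')
qed

lemma bilinear_bounded_null:
  assumes "bounded_bilinear h" "Bseq X" "Z \<longlonglongrightarrow> 0"
  shows "(\<lambda>k. h (X k) (Z k)) \<longlonglongrightarrow> 0"
  using bounded_bilinear.Bfun_prod_Zfun[OF assms(1,2)] assms(3) by (simp add: tendsto_Zfun_iff)

section \<open>Symmetric coercive forms on closed subspaces\<close>

locale symmetric_coercive =
  fixes B :: "'h::{real_inner,complete_space} \<Rightarrow> 'h \<Rightarrow> real" and c :: real
  assumes bilin: "bounded_bilinear B"
    and sym: "B x y = B y x"
    and c_pos: "0 < c"
    and coercive: "c * (norm x)\<^sup>2 \<le> B x x"
begin

lemmas B_simps = bounded_bilinear.add_left[OF bilin] bounded_bilinear.add_right[OF bilin]
  bounded_bilinear.diff_left[OF bilin] bounded_bilinear.diff_right[OF bilin]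
  bounded_bilinear.scaleR_left[OF bilin] bounded_bilinear.scaleR_right[OF bilin]
  bounded_bilinear.zero_left[OF bilin] bounded_bilinear.zero_right[OF bilin]

text \<open>By symmetry the equation is the Euler equation of the energy B(v,v)/2 - l(v), which is
  strongly convex on V. The first variation is nonnegative in the directions \<phi> and -\<phi>,
  hence zero.\<close>

lemma lax_milgram:
  assumes "closed V" "subspace V" "bounded_linear l"
  obtains z where "z \<in> V" "\<And>\<phi>. \<phi> \<in> V \<Longrightarrow> B z \<phi> = l \<phi>"
proof -
  interpret l: bounded_linear l by fact
  obtain L where L: "\<And>v. norm (l v) \<le> norm v * L" "0 \<le> L" using l.nonneg_bounded by blast
  define J where "J v = B v v / 2 - l v" for v
  have "continuous_on V J" unfolding J_def
    by (intro continuous_intros bounded_bilinear.continuous_on[OF bilin]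
          linear_continuous_on l.bounded_linear_axioms) auto
  \<comment> \<open>The minimum over real r of c r^2/2 - L r, found by completing the
    square.\<close>
  moreover have "- L\<^sup>2 / (2 * c) \<le> J v" for v
  proof -
    have "J v \<ge> c * (norm v)\<^sup>2 / 2 - norm v * L"
      unfolding J_def using coercive[of v] L(1)[of v] by auto
    moreover have "0 \<le> (c * norm v - L)\<^sup>2 / (2 * c)" using c_pos by simp
    moreover have "(c * norm v - L)\<^sup>2 / (2 * c) = c * (norm v)\<^sup>2 / 2 - norm v * L + L\<^sup>2 / (2 * c)"
      using c_pos by (simp add: field_simps power2_eq_square)
    ultimately show ?thesis by (simp add: field_simps)
  qed
  \<comment> \<open>The parallelogram identity for \<open>B\<close>, with the factor 1/2 of the
    energy, gives a gain of exactly B(x-y,x-y)/8 at the midpoint; coercivity turns this into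
    c/8.\<close>
  moreover have "\<exists>z\<in>V. J z \<le> (J x + J y) / 2 - (c / 8) * (dist x y)\<^sup>2" if "x \<in> V" "y \<in> V" for x y
  proof
    show "(1/2) *\<^sub>R (x + y) \<in> V" using that \<open>subspace V\<close> by (simp add: subspace_add subspace_scale)
    have "J ((1/2) *\<^sub>R (x + y)) = (J x + J y) / 2 - B (x - y) (x - y) / 8"
      unfolding J_def by (simp add: B_simps l.add l.scaleR sym[of y x] field_simps)
    then show "J ((1/2) *\<^sub>R (x + y)) \<le> (J x + J y) / 2 - (c / 8) * (dist x y)\<^sup>2"
      using coercive[of "x - y"] by (simp add: dist_norm)
  qed
  moreover have "V \<noteq> {}" using \<open>subspace V\<close> subspace_0 by blast
  moreover have "0 < c / 8" using c_pos by simp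
  ultimately obtain z where z: "z \<in> V" "\<And>v. v \<in> V \<Longrightarrow> J z \<le> J v"
    using midpoint_convex_has_minimizer[OF \<open>closed V\<close>, of J "c / 8" "- L\<^sup>2 / (2 * c)"] by blast
  have *: "0 \<le> B z \<phi> - l \<phi>" if "\<phi> \<in> V" for \<phi>
  proof (rule linear_coeff_nonneg)
    fix t :: real assume "0 < t"
    have "J z \<le> J (z + t *\<^sub>R \<phi>)" using z that \<open>subspace V\<close> by (simp add: subspace_add subspace_scale)
    then show "0 \<le> t * (B z \<phi> - l \<phi>) + t\<^sup>2 * (B \<phi> \<phi> / 2)"
      unfolding J_def
      by (simp add: B_simps l.add l.scaleR sym[of \<phi> z] field_simps power2_eq_square)
  qed
  have "B z \<phi> = l \<phi>" if "\<phi> \<in> V" for \<phi>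
    using *[OF that] *[of "- \<phi>"] that \<open>subspace V\<close>
    by (simp add: subspace_neg bounded_bilinear.minus_right[OF bilin] linear_neg[OF l.linear_axioms])
  then show ?thesis using that z(1) by blast
qed

end

lemma norm_fst_le_norm: "norm (fst x) \<le> norm x" and norm_snd_le_norm: "norm (snd x) \<le> norm x"
  using norm_fst_le[of "fst x" "snd x"] norm_snd_le[of "snd x" "fst x"] by simp_all

text \<open>A pair holds a field in \<open>fst\<close> and its curl in \<open>snd\<close>. The load
  of the state equation therefore acts through \<open>fst\<close>, and the misfit driving the
  adjoint through \<open>snd\<close>. The variational inequality is stated without projections, so
  that discrete and limiting conditions have the same shape.\<close>

locale nested_control = symmetric_coercive B c
  for B :: "'u \<times> 'u \<Rightarrow> 'u::{real_inner,complete_space} \<times> 'u \<Rightarrow> real" and c :: real +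
  fixes V :: "nat \<Rightarrow> ('u \<times> 'u) set" and K :: "nat \<Rightarrow> 'u set"
    and f yd ud :: 'u and \<alpha> :: real
    and y p :: "nat \<Rightarrow> 'u \<times> 'u" and u :: "nat \<Rightarrow> 'u"
  assumes alpha: "0 < \<alpha>"
    and V_subspace: "subspace (V k)" and V_Suc: "V k \<subseteq> V (Suc k)"
    and K_convex: "convex (K k)" and K_0: "0 \<in> K k" and K_Suc: "K k \<subseteq> K (Suc k)"
    and y_in: "y k \<in> V k" and p_in: "p k \<in> V k" and u_in: "u k \<in> K k"
    and y_eq: "\<phi> \<in> V k \<Longrightarrow> B (y k) \<phi> = inner (f + u k) (fst \<phi>)"
    and p_eq: "\<phi> \<in> V k \<Longrightarrow> B (p k) \<phi> = inner (snd (y k) - yd) (snd \<phi>)"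
    and u_vi: "w \<in> K k \<Longrightarrow> 0 \<le> inner (fst (p k) + \<alpha> *\<^sub>R (u k - ud)) (w - u k)"
begin

section \<open>The limiting problem and convergence towards it\<close>

definition "Vlim = closure (\<Union>k. V k)"
definition "Klim = closure (\<Union>k. K k)"
definition "feasible Y U \<longleftrightarrow> Y \<in> Vlim \<and> U \<in> Klim \<and> (\<forall>\<phi>\<in>Vlim. B Y \<phi> = inner (f + U) (fst \<phi>))"
definition "cost Y U = (1/2) * (norm (snd Y - yd))\<^sup>2 + (\<alpha>/2) * (norm (U - ud))\<^sup>2"
definition "solution Y U \<longleftrightarrow> feasible Y U \<and> (\<forall>Y' U'. feasible Y' U' \<longrightarrow> cost Y U \<le> cost Y' U')"

lemma V_mono: "i \<le> j \<Longrightarrow> V i \<subseteq> V j"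
  by (rule lift_Suc_mono_le[of V, OF V_Suc])

lemma K_mono: "i \<le> j \<Longrightarrow> K i \<subseteq> K j"
  by (rule lift_Suc_mono_le[of K, OF K_Suc])

lemma V_Vlim: "V k \<subseteq> Vlim"
  unfolding Vlim_def by (rule order_trans[OF _ closure_subset]) auto

lemma K_Klim: "K k \<subseteq> Klim"
  unfolding Klim_def by (rule order_trans[OF _ closure_subset]) auto

lemma Vlim_closed: "closed Vlim" and Klim_closed: "closed Klim"
  unfolding Vlim_def Klim_def by auto

lemma Klim_convex: "convex Klim"
  unfolding Klim_def
proof (rule convex_closure, rule convexI)
  fix x z and a b :: real
  assume "x \<in> (\<Union>k. K k)" "z \<in> (\<Union>k. K k)" and ab: "0 \<le> a" "0 \<le> b" "a + b = 1"
  then obtain i j where "x \<in> K i" "z \<in> K j" by blast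
  then have "x \<in> K (max i j)" "z \<in> K (max i j)" using K_mono[of i "max i j"] K_mono[of j "max i j"] by auto
  then show "a *\<^sub>R x + b *\<^sub>R z \<in> (\<Union>k. K k)" using convexD[OF K_convex _ _ ab] by auto
qed

lemma V_ne: "V k \<noteq> {}" and K_ne: "K k \<noteq> {}"
  using y_in u_in by (metis empty_iff)+

lemma Vlim_approximants:
  assumes "x \<in> Vlim"
  obtains w where "\<And>k. w k \<in> V k" "w \<longlonglongrightarrow> x"
  using nested_approximants[of V, OF V_mono V_ne] assms unfolding Vlim_def by blast

lemma Vlim_subspace: "subspace Vlim"
  unfolding subspace_def
proof (intro conjI ballI allI)
  show "0 \<in> Vlim" using subspace_0[OF V_subspace] V_Vlim by blast
  fix x assume "x \<in> Vlim"
  then obtain v where v: "\<And>k. v k \<in> V k" "v \<longlonglongrightarrow> x" using Vlim_approximants by blast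
  have "a *\<^sub>R v k \<in> Vlim" for a k using subspace_scale[OF V_subspace v(1)] V_Vlim by blast
  then show "a *\<^sub>R x \<in> Vlim" for a
    by (rule closed_sequentially[OF Vlim_closed _ tendsto_scaleR[OF tendsto_const v(2)]])
  fix z assume "z \<in> Vlim"
  then obtain w where w: "\<And>k. w k \<in> V k" "w \<longlonglongrightarrow> z" using Vlim_approximants by blast
  have "v k + w k \<in> Vlim" for k using subspace_add[OF V_subspace v(1) w(1)] V_Vlim by blast
  then show "x + z \<in> Vlim"
    by (rule closed_sequentially[OF Vlim_closed _ tendsto_add[OF v(2) w(2)]])
qed

text \<open>A priori bound from testing an equation with its own solution; \<open>z\<close> stands
  for whichever component of \<open>Y\<close> the right-hand side acts on.\<close>

lemma norm_le_of_diagonal: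
  assumes "B Y Y = inner g z" "norm z \<le> norm Y"
  shows "c * norm Y \<le> norm g"
proof (cases "Y = 0")
  case False
  have "c * (norm Y)\<^sup>2 \<le> inner g z" using coercive[of Y] assms by simp
  also have "\<dots> \<le> norm g * norm z" by (rule norm_cauchy_schwarz)
  also have "\<dots> \<le> norm g * norm Y" using assms(2) by (simp add: mult_left_mono)
  finally show ?thesis using False by (simp add: power2_eq_square)
qed simp

lemma state_exists:
  obtains Y where "Y \<in> Vlim" "\<And>\<phi>. \<phi> \<in> Vlim \<Longrightarrow> B Y \<phi> = inner g (fst \<phi>)"
proof (rule lax_milgram[OF Vlim_closed Vlim_subspace])
  show "bounded_linear (\<lambda>\<phi>. inner g (fst \<phi>))"
    by (intro bounded_linear_compose[OF bounded_linear_inner_right] bounded_linear_fst)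
qed (use that in blast)

lemma adjoint_exists:
  obtains P where "P \<in> Vlim" "\<And>\<phi>. \<phi> \<in> Vlim \<Longrightarrow> B P \<phi> = inner g (snd \<phi>)"
proof (rule lax_milgram[OF Vlim_closed Vlim_subspace])
  show "bounded_linear (\<lambda>\<phi>. inner g (snd \<phi>))"
    by (intro bounded_linear_compose[OF bounded_linear_inner_right] bounded_linear_snd)
qed (use that in blast)

lemma feasible_combine:
  assumes "feasible Y U" "feasible Y' U'" "0 \<le> t" "t \<le> 1"
  shows "feasible (Y + t *\<^sub>R (Y' - Y)) (U + t *\<^sub>R (U' - U))"
proof -
  have "U + t *\<^sub>R (U' - U) = (1 - t) *\<^sub>R U + t *\<^sub>R U'" by (simp add: algebra_simps)
  then have "U + t *\<^sub>R (U' - U) \<in> Klim"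
    using convexD[OF Klim_convex, of U U' "1 - t" t] assms by (auto simp: feasible_def)
  then show ?thesis using assms Vlim_subspace unfolding feasible_def
    by (auto simp: subspace_add subspace_diff subspace_scale B_simps inner_simps algebra_simps)
qed

text \<open>The load f cancels in the difference of two states, so the control-to-state map is
  Lipschitz with constant 1/c. This lets the convexity in the control also account for the
  state.\<close>

lemma feasible_diff_le:
  assumes "feasible Y U" "feasible Y' U'"
  shows "c * norm (Y - Y') \<le> norm (U - U')"
proof (rule norm_le_of_diagonal[OF _ norm_fst_le_norm])
  have "Y - Y' \<in> Vlim" using assms subspace_diff[OF Vlim_subspace] by (auto simp: feasible_def)
  then show "B (Y - Y') (Y - Y') = inner (U - U') (fst (Y - Y'))"
    using assms unfolding feasible_def bounded_bilinear.diff_left[OF bilin] by (auto simp: inner_simps)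
qed

text \<open>The minimisation runs over state and control jointly. The cost is strongly convex in
  \<open>snd Y\<close> and \<open>U\<close> only, which is not enough for the full distance of
  pairs; on the feasible set \<open>feasible_diff_le\<close> bounds the states by the
  controls.\<close>

lemma solution_exists: obtains Y U where "solution Y U"
proof -
  let ?F = "{(Y, U). feasible Y U}" and ?J = "\<lambda>(Y, U). cost Y U"
  \<comment> \<open>The midpoint gain from the control term is (\<alpha>/8) |U-U'|^2, and the
    squared distance of feasible pairs is at most ((1/c)^2 + 1) |U-U'|^2; \<open>?d\<close> is the
    quotient of the two factors.\<close>
  let ?d = "(\<alpha> / 8) / ((1 / c)\<^sup>2 + 1)"
  have "closed ?F"
  proof -
    have F: "?F = (Vlim \<times> Klim) \<inter> (\<Inter>\<phi>\<in>Vlim. {(Y, U). B Y \<phi> = inner (f + U) (fst \<phi>)})"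
      unfolding feasible_def by auto
    have "closed {(Y, U). B Y \<phi> = inner (f + U) (fst \<phi>)}" for \<phi>
      unfolding case_prod_unfold
      by (intro closed_Collect_eq continuous_intros bounded_bilinear.continuous_on[OF bilin])
    then show ?thesis unfolding F using Vlim_closed Klim_closed by (intro closed_Int closed_Times closed_INT) auto
  qed
  moreover have "?F \<noteq> {}"
  proof -
    obtain Y where "Y \<in> Vlim" "\<And>\<phi>. \<phi> \<in> Vlim \<Longrightarrow> B Y \<phi> = inner (f + 0) (fst \<phi>)" using state_exists by blast
    then have "feasible Y 0" unfolding feasible_def using K_0 K_Klim by blast
    then show ?thesis by blast
  qed
  moreover have "continuous_on ?F ?J"
    unfolding cost_def case_prod_unfold by (intro continuous_intros)
  moreover have d: "0 < ?d" using alpha by (intro divide_pos_pos) (auto intro: add_nonneg_pos)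
  moreover have "0 \<le> ?J x" for x using alpha by (auto simp: cost_def split: prod.split)
  moreover have "\<exists>z\<in>?F. ?J z \<le> (?J x + ?J x') / 2 - ?d * (dist x x')\<^sup>2" if "x \<in> ?F" "x' \<in> ?F" for x x'
  proof -
    obtain Y U Y' U' where x: "x = (Y, U)" "x' = (Y', U')" by fastforce
    have fe: "feasible Y U" "feasible Y' U'" using that x by auto
    let ?z = "(Y + (1/2) *\<^sub>R (Y' - Y), U + (1/2) *\<^sub>R (U' - U))"
    have "?z \<in> ?F" using feasible_combine[OF fe, of "1/2"] by simp
    moreover have "?J ?z \<le> (?J x + ?J x') / 2 - ?d * (dist x x')\<^sup>2"
    proof -
      have half: "(norm (a + (1/2) *\<^sub>R (b - a) - g))\<^sup>2
          = ((norm (a - g))\<^sup>2 + (norm (b - g))\<^sup>2) / 2 - (norm (a - b))\<^sup>2 / 4" for a b g :: 'u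
        unfolding power2_norm_eq_inner
        by (simp add: inner_simps inner_commute algebra_simps) (simp add: field_simps)
      have "?J ?z = (?J x + ?J x') / 2 - (norm (snd Y - snd Y'))\<^sup>2 / 8 - \<alpha> * (norm (U - U'))\<^sup>2 / 8"
        unfolding x cost_def prod.case snd_add snd_scaleR snd_diff half by (simp add: field_simps)
      moreover have "(norm (Y - Y'))\<^sup>2 \<le> (norm (U - U') / c)\<^sup>2"
        using feasible_diff_le[OF fe] c_pos by (intro power_mono) (auto simp: field_simps)
      then have "(dist x x')\<^sup>2 \<le> (norm (U - U'))\<^sup>2 * ((1 / c)\<^sup>2 + 1)"
        unfolding x dist_Pair_Pair by (simp add: dist_norm power_divide algebra_simps)
      then have "?d * (dist x x')\<^sup>2 \<le> ?d * ((norm (U - U'))\<^sup>2 * ((1 / c)\<^sup>2 + 1))"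
        using d by (intro mult_left_mono) auto
      moreover have "?d * ((norm (U - U'))\<^sup>2 * ((1 / c)\<^sup>2 + 1)) = \<alpha> * (norm (U - U'))\<^sup>2 / 8"
        using add_nonneg_pos[of "(1/c)\<^sup>2" 1] by (simp add: field_simps)
      ultimately show ?thesis by (smt (verit) zero_le_power2 divide_nonneg_pos)
    qed
    ultimately show ?thesis by blast
  qed
  ultimately obtain x where "x \<in> ?F" "\<And>z. z \<in> ?F \<Longrightarrow> ?J x \<le> ?J z"
    using midpoint_convex_has_minimizer[of ?F ?J ?d 0] by blast
  then have "solution (fst x) (snd x)" unfolding solution_def by (auto simp: case_prod_unfold)
  then show ?thesis using that by blast
qed

text \<open>The cost is a quadratic polynomial in t along a feasible segment; the expression is its
  linear coefficient at the minimiser.\<close>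

lemma solution_stationary:
  assumes sol: "solution Y U" and fe: "feasible Z W"
  shows "0 \<le> inner (snd Y - yd) (snd (Z - Y)) + \<alpha> * inner (U - ud) (W - U)"
proof (rule linear_coeff_nonneg)
  fix t :: real assume t: "0 < t" "t \<le> 1"
  have "cost Y U \<le> cost (Y + t *\<^sub>R (Z - Y)) (U + t *\<^sub>R (W - U))"
    using sol feasible_combine[of Y U Z W t] fe t unfolding solution_def by (meson less_imp_le)
  also have "\<dots> = cost Y U + (t * (inner (snd Y - yd) (snd (Z - Y)) + \<alpha> * inner (U - ud) (W - U))
      + t\<^sup>2 * ((norm (snd (Z - Y)))\<^sup>2 / 2 + \<alpha> * (norm (W - U))\<^sup>2 / 2))"
  proof -
    have expand: "(norm (a + t *\<^sub>R b - g))\<^sup>2 = (norm (a - g))\<^sup>2 + 2 * t * inner (a - g) b + t\<^sup>2 * (norm b)\<^sup>2"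
      for a b g :: 'u
      unfolding power2_norm_eq_inner
      by (simp add: inner_simps inner_commute algebra_simps power2_eq_square)
    show ?thesis unfolding cost_def snd_add snd_scaleR expand by (simp add: field_simps)
  qed
  finally show "0 \<le> t * (inner (snd Y - yd) (snd (Z - Y)) + \<alpha> * inner (U - ud) (W - U))
      + t\<^sup>2 * ((norm (snd (Z - Y)))\<^sup>2 / 2 + \<alpha> * (norm (W - U))\<^sup>2 / 2)" by simp
qed

text \<open>The zero control is admissible on every level. Testing the variational inequality with
  it gives a bound on the control and the curl of the state together, in which the adjoint is
  absorbed through its own a priori bound; the full states and adjoints follow.\<close>

lemma bounded_iterates: "Bseq u" "Bseq y" "Bseq p"
proof -
  let ?D = "norm ud" and ?E = "norm yd" and ?F = "norm f"
  \<comment> \<open>\<open>?G\<close> collects the factors of |snd (y k)|: \<open>?E\<close> from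
    the target and \<open>?F / c\<close> from the bound on the adjoint. Young's inequality absorbs
    half of the left-hand side, and \<open>M\<close> is twice what remains.\<close>
  let ?G = "?E + ?F / c"
  define M where "M = \<alpha> * ?D\<^sup>2 + ?G\<^sup>2 + 2 * ?F * ?E / c"
  have p_le: "c * norm (p k) \<le> norm (snd (y k)) + ?E" for k
  proof -
    have "c * norm (p k) \<le> norm (snd (y k) - yd)"
      by (rule norm_le_of_diagonal[OF p_eq[OF p_in] norm_snd_le_norm])
    then show ?thesis using norm_triangle_ineq4[of "snd (y k)" yd] by linarith
  qed
  have y_le: "c * norm (y k) \<le> ?F + norm (u k)" for k
  proof -
    have "c * norm (y k) \<le> norm (f + u k)"
      by (rule norm_le_of_diagonal[OF y_eq[OF y_in] norm_fst_le_norm])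
    then show ?thesis using norm_triangle_ineq[of f "u k"] by linarith
  qed
  have main: "\<alpha> * (norm (u k))\<^sup>2 + (norm (snd (y k)))\<^sup>2 \<le> M" for k
  proof -
    let ?a = "norm (u k)" and ?b = "norm (snd (y k))"
    \<comment> \<open>Both sides equal B(y_k, p_k): the state equation is tested with the adjoint
      and the adjoint equation with the state.\<close>
    have "inner (f + u k) (fst (p k)) = inner (snd (y k) - yd) (snd (y k))"
      using y_eq[OF p_in] p_eq[OF y_in] sym by metis
    moreover have "0 \<le> inner (fst (p k) + \<alpha> *\<^sub>R (u k - ud)) (0 - u k)" using u_vi[OF K_0] .
    ultimately have "\<alpha> * ?a\<^sup>2 + ?b\<^sup>2 \<le> \<alpha> * inner ud (u k) + inner yd (snd (y k)) + inner f (fst (p k))"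
      unfolding power2_norm_eq_inner by (simp add: inner_simps inner_commute algebra_simps)
    also have "\<dots> \<le> \<alpha> * (?D * ?a) + ?E * ?b + ?F * norm (p k)"
    proof (intro add_mono mult_left_mono norm_cauchy_schwarz)
      have "inner f (fst (p k)) \<le> ?F * norm (fst (p k))" by (rule norm_cauchy_schwarz)
      also have "\<dots> \<le> ?F * norm (p k)" by (intro mult_left_mono norm_fst_le_norm) auto
      finally show "inner f (fst (p k)) \<le> ?F * norm (p k)" .
    qed (use alpha in auto)
    also have "\<dots> \<le> \<alpha> * (?D * ?a) + ?E * ?b + ?F * ((?b + ?E) / c)"
      using p_le[of k] c_pos by (intro add_left_mono mult_left_mono) (auto simp: field_simps)
    also have "\<dots> = \<alpha> * (?D * ?a) + ?G * ?b + ?F * ?E / c"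
      by (simp add: field_simps add_divide_distrib)
    also have "\<dots> \<le> \<alpha> * (?D\<^sup>2 / 2 + ?a\<^sup>2 / 2) + (?G\<^sup>2 / 2 + ?b\<^sup>2 / 2) + ?F * ?E / c"
    proof -
      have young: "s * t \<le> s\<^sup>2 / 2 + t\<^sup>2 / 2" for s t :: real
        using sum_squares_bound[of s t] by simp
      have "\<alpha> * (?D * ?a) \<le> \<alpha> * (?D\<^sup>2 / 2 + ?a\<^sup>2 / 2)"
        using alpha young by (intro mult_left_mono) auto
      then show ?thesis using young[of ?G ?b] by linarith
    qed
    also have "\<dots> = (M + (\<alpha> * ?a\<^sup>2 + ?b\<^sup>2)) / 2" unfolding M_def by (simp add: field_simps)
    finally show ?thesis by simp
  qed
  have u_bd: "norm (u k) \<le> sqrt (M / \<alpha>)" for k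
  proof (rule real_le_rsqrt)
    have "\<alpha> * (norm (u k))\<^sup>2 \<le> M" using main[of k] zero_le_power2[of "norm (snd (y k))"] by linarith
    then show "(norm (u k))\<^sup>2 \<le> M / \<alpha>" using alpha by (simp add: field_simps)
  qed
  then show "Bseq u" by (rule BseqI')
  have "norm (y k) \<le> (?F + sqrt (M / \<alpha>)) / c" for k
    using y_le[of k] u_bd[of k] c_pos by (simp add: field_simps)
  then show "Bseq y" by (rule BseqI')
  have "norm (snd (y k)) \<le> sqrt M" for k
  proof (rule real_le_rsqrt)
    have "0 \<le> \<alpha> * (norm (u k))\<^sup>2" using alpha by simp
    then show "(norm (snd (y k)))\<^sup>2 \<le> M" using main[of k] by linarith
  qed
  then have "norm (p k) \<le> (sqrt M + ?E) / c" for k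
    using p_le[of k] c_pos by (simp add: field_simps) (smt (verit))
  then show "Bseq p" by (rule BseqI')
qed

text \<open>If Z is the state of the control W, then by symmetry pairing the misfit with the curl of
  Z - Y is the same as pairing W - U with the adjoint. This removes the state from the stationarity
  condition.\<close>

lemma adjoint_vi:
  assumes sol: "solution Y U" and P: "P \<in> Vlim" "\<And>\<phi>. \<phi> \<in> Vlim \<Longrightarrow> B P \<phi> = inner (snd Y - yd) (snd \<phi>)"
    and W: "W \<in> Klim"
  shows "0 \<le> inner (fst P + \<alpha> *\<^sub>R (U - ud)) (W - U)"
proof -
  obtain Z where Z: "Z \<in> Vlim" "\<And>\<phi>. \<phi> \<in> Vlim \<Longrightarrow> B Z \<phi> = inner (f + W) (fst \<phi>)"
    using state_exists[of "f + W"] by blast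
  have fe: "feasible Y U" using sol by (simp add: solution_def)
  have "Z - Y \<in> Vlim" using Z fe subspace_diff[OF Vlim_subspace] by (auto simp: feasible_def)
  then have "inner (snd Y - yd) (snd (Z - Y)) = B (Z - Y) P" using P sym by metis
  also have "\<dots> = inner (W - U) (fst P)"
    using Z(2)[OF P(1)] fe P(1) unfolding bounded_bilinear.diff_left[OF bilin]
    by (auto simp: feasible_def inner_simps)
  finally show ?thesis using solution_stationary[OF sol, of Z W] Z W
    by (simp add: feasible_def inner_simps inner_commute algebra_simps)
qed

lemma solution_limit:
  assumes sol: "solution Y U"
  shows "u \<longlonglongrightarrow> U" "y \<longlonglongrightarrow> Y"
proof -
  have fe: "feasible Y U" using sol by (simp add: solution_def)
  obtain P where P: "P \<in> Vlim" "\<And>\<phi>. \<phi> \<in> Vlim \<Longrightarrow> B P \<phi> = inner (snd Y - yd) (snd \<phi>)"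
    using adjoint_exists by blast
  obtain Yk where Yk: "\<And>k. Yk k \<in> V k" "Yk \<longlonglongrightarrow> Y"
    using Vlim_approximants fe unfolding feasible_def by blast
  obtain Pk where Pk: "\<And>k. Pk k \<in> V k" "Pk \<longlonglongrightarrow> P"
    using Vlim_approximants[OF P(1)] by blast
  obtain w where w: "\<And>k. w k \<in> K k" "w \<longlonglongrightarrow> U"
    using nested_approximants[of K, OF K_mono K_ne] fe unfolding feasible_def Klim_def by blast
  have galerkin_y: "B (Y - y k) \<phi> = inner (U - u k) (fst \<phi>)" if "\<phi> \<in> V k" for k \<phi>
    using fe y_eq[OF that] that V_Vlim[of k] unfolding bounded_bilinear.diff_left[OF bilin]
    by (auto simp: feasible_def inner_simps)
  have galerkin_p: "B (P - p k) \<phi> = inner (snd (Y - y k)) (snd \<phi>)" if "\<phi> \<in> V k" for k \<phi>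
    using P(2)[of \<phi>] p_eq[OF that] that V_Vlim[of k] unfolding bounded_bilinear.diff_left[OF bilin]
    by (auto simp: inner_simps)
  \<comment> \<open>Every summand pairs a bounded sequence with the error of an approximant.\<close>
  define r where "r k = inner (fst (p k) - (\<alpha> *\<^sub>R ud - \<alpha> *\<^sub>R u k)) (w k - U)
      + inner (U - u k) (fst (Pk k - P)) + B (Y - y k) (P - Pk k)
      + B (p k - P) (Y - Yk k) - inner (snd (Y - y k)) (snd (Yk k - Y))" for k
  have key: "\<alpha> * (norm (U - u k))\<^sup>2 + (norm (snd (Y - y k)))\<^sup>2 \<le> r k" for k
  proof -
    \<comment> \<open>U need not be admissible on level k, so the discrete inequality is tested with
      its approximant \<open>w k\<close>. In the other direction \<open>u k\<close> is admissible
      for the limit and can be used directly.\<close>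
    have "0 \<le> inner (fst (p k) + \<alpha> *\<^sub>R (u k - ud)) (w k - u k)" using u_vi w(1) .
    moreover have "0 \<le> inner (fst P + \<alpha> *\<^sub>R (U - ud)) (u k - U)"
      using adjoint_vi[OF sol P] u_in K_Klim by blast
    ultimately have 1: "\<alpha> * (norm (U - u k))\<^sup>2 \<le> inner (U - u k) (fst (p k - P))
        + inner (fst (p k) - (\<alpha> *\<^sub>R ud - \<alpha> *\<^sub>R u k)) (w k - U)"
      unfolding power2_norm_eq_inner by (simp add: inner_simps inner_commute algebra_simps)
    have "p k - Pk k \<in> V k" using p_in Pk(1) subspace_diff[OF V_subspace] by blast
    then have 2: "inner (U - u k) (fst (p k - Pk k)) = B (Y - y k) (p k - Pk k)"
      using galerkin_y by simp
    have "Yk k - y k \<in> V k" using y_in Yk(1) subspace_diff[OF V_subspace] by blast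
    then have 3: "B (P - p k) (Yk k - y k) = inner (snd (Y - y k)) (snd (Yk k - y k))"
      using galerkin_p by simp
    have 4: "inner (U - u k) (fst (p k - P))
        = inner (U - u k) (fst (p k - Pk k)) + inner (U - u k) (fst (Pk k - P))"
      by (simp add: inner_simps)
    \<comment> \<open>Inserting P and Y isolates the pairing of P - p_k with Yk - y_k. By 3 and 6 it
      equals |snd (Y - y k)|^2 up to an approximation error, and its negative sign moves the curl
      error to the left-hand side of the estimate.\<close>
    have 5: "B (Y - y k) (p k - Pk k) = B (Y - y k) (P - Pk k) + B (p k - P) (Y - Yk k) - B (P - p k) (Yk k - y k)"
      by (simp add: B_simps sym[of "p k"] sym[of P])
    have 6: "inner (snd (Y - y k)) (snd (Yk k - y k))
        = (norm (snd (Y - y k)))\<^sup>2 + inner (snd (Y - y k)) (snd (Yk k - Y))"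
      unfolding power2_norm_eq_inner by (simp add: inner_simps algebra_simps)
    show ?thesis using 1 2 3 4 5 6 unfolding r_def by linarith
  qed
  have bdd: "Bseq (\<lambda>k. U - u k)" "Bseq (\<lambda>k. Y - y k)" "Bseq (\<lambda>k. p k - P)"
    by (intro Bseq_diff Bfun_const bounded_iterates)+
  have bdd_snd: "Bseq (\<lambda>k. snd (Y - y k))"
    using bounded_linear_Bseq[OF bounded_linear_snd bdd(2)] .
  have bdd_grad: "Bseq (\<lambda>k. fst (p k) - (\<alpha> *\<^sub>R ud - \<alpha> *\<^sub>R u k))"
    using bounded_linear_Bseq[OF bounded_linear_fst bounded_iterates(3)]
      bounded_linear_Bseq[OF bounded_linear_scaleR_right bounded_iterates(1), of \<alpha>]
    by (intro Bseq_diff) auto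
  have null: "(\<lambda>k. w k - U) \<longlonglongrightarrow> 0" "(\<lambda>k. fst (Pk k - P)) \<longlonglongrightarrow> 0" "(\<lambda>k. P - Pk k) \<longlonglongrightarrow> 0"
    "(\<lambda>k. Y - Yk k) \<longlonglongrightarrow> 0" "(\<lambda>k. snd (Yk k - Y)) \<longlonglongrightarrow> 0"
    using tendsto_diff[OF w(2) tendsto_const[of U]] tendsto_fst[OF tendsto_diff[OF Pk(2) tendsto_const[of P]]]
      tendsto_diff[OF tendsto_const[of P] Pk(2)] tendsto_diff[OF tendsto_const[of Y] Yk(2)]
      tendsto_snd[OF tendsto_diff[OF Yk(2) tendsto_const[of Y]]] by auto
  have "r \<longlonglongrightarrow> 0 + 0 + 0 + 0 - 0" unfolding r_def
    by (intro tendsto_add tendsto_diff bilinear_bounded_null[OF bounded_bilinear_inner]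
        bilinear_bounded_null[OF bilin] bdd bdd_snd bdd_grad null)
  then have "(\<lambda>k. r k / \<alpha>) \<longlonglongrightarrow> 0" using tendsto_divide_zero by auto
  then have "(\<lambda>k. (norm (U - u k))\<^sup>2) \<longlonglongrightarrow> 0"
  proof (rule Lim_null_comparison[rotated], intro always_eventually allI)
    fix k
    have "\<alpha> * (norm (U - u k))\<^sup>2 \<le> r k" using key[of k] zero_le_power2[of "norm (snd (Y - y k))"] by linarith
    then show "norm ((norm (U - u k))\<^sup>2) \<le> r k / \<alpha>" using alpha by (simp add: field_simps)
  qed
  then have norm_u: "(\<lambda>k. norm (U - u k)) \<longlonglongrightarrow> 0"
    by (simp add: power_tendsto_0_iff)
  then have Uu: "(\<lambda>k. U - u k) \<longlonglongrightarrow> 0" by (rule tendsto_norm_zero_cancel)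
  show "u \<longlonglongrightarrow> U" using tendsto_diff[OF tendsto_const[of U] Uu] by simp
  \<comment> \<open>The bound by \<open>r\<close> controls just the curl part of the state error.
    The full error follows from its energy once the controls converge; the difference of first
    components is fst (Yk k - y k), an admissible test direction for Galerkin orthogonality.\<close>
  define s where "s k = B (Y - y k) (Y - Yk k) + inner (fst (Y - y k) - fst (Y - Yk k)) (U - u k)" for k
  have "c * (norm (Y - y k))\<^sup>2 \<le> s k" for k
  proof -
    have "Yk k - y k \<in> V k" using y_in Yk(1) subspace_diff[OF V_subspace] by blast
    then have "B (Y - y k) (Yk k - y k) = inner (U - u k) (fst (Yk k - y k))" using galerkin_y by simp
    moreover have "B (Y - y k) (Y - y k) = B (Y - y k) (Y - Yk k) + B (Y - y k) (Yk k - y k)"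
      by (simp add: B_simps)
    ultimately have "B (Y - y k) (Y - y k) = s k" unfolding s_def by (simp add: inner_commute)
    then show ?thesis using coercive[of "Y - y k"] by simp
  qed
  then have s_le: "norm ((norm (Y - y k))\<^sup>2) \<le> s k / c" for k using c_pos by (simp add: field_simps)
  have "Bseq (\<lambda>k. fst (Y - Yk k))"
    using tendsto_fst[OF null(4)] by (intro convergent_imp_Bseq convergentI)
  then have "Bseq (\<lambda>k. fst (Y - y k) - fst (Y - Yk k))"
    using bounded_linear_Bseq[OF bounded_linear_fst bdd(2)] Bseq_diff by blast
  then have "s \<longlonglongrightarrow> 0 + 0" unfolding s_def
    by (intro tendsto_add bilinear_bounded_null[OF bounded_bilinear_inner]
        bilinear_bounded_null[OF bilin] bdd null Uu)
  then have "(\<lambda>k. s k / c) \<longlonglongrightarrow> 0" using tendsto_divide_zero by auto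
  then have "(\<lambda>k. (norm (Y - y k))\<^sup>2) \<longlonglongrightarrow> 0"
    by (rule Lim_null_comparison[rotated]) (use s_le in auto)
  then have "(\<lambda>k. Y - y k) \<longlonglongrightarrow> 0"
    by (intro tendsto_norm_zero_cancel[of "\<lambda>k. Y - y k"]) (simp add: power_tendsto_0_iff)
  then show "y \<longlonglongrightarrow> Y" using tendsto_diff[OF tendsto_const[of Y]] by fastforce
qed

text \<open>Every solution is a limit of the same discrete sequence, and limits are unique.\<close>

lemma solution_unique:
  assumes "solution Y U" "solution Y' U'"
  shows "Y = Y'" "U = U'"
  using solution_limit[OF assms(1)] solution_limit[OF assms(2)] LIMSEQ_unique by blast+

end

section \<open>The Hilbert space of square-integrable functions\<close>

definition sq_integrable :: "('a::euclidean_space \<Rightarrow> 'b::euclidean_space) \<Rightarrow> bool" where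
  "sq_integrable f \<longleftrightarrow> f \<in> borel_measurable lebesgue \<and> integrable lebesgue (\<lambda>x. (norm (f x))\<^sup>2)"

lemma sq_integrable_measurable [measurable_dest]: "sq_integrable f \<Longrightarrow> f \<in> borel_measurable lebesgue"
  by (simp add: sq_integrable_def)

lemma sq_integrable_weighted_inner:
  fixes a :: "'a::euclidean_space \<Rightarrow> real"
  assumes f: "sq_integrable f" and g: "sq_integrable g"
    and [measurable]: "a \<in> borel_measurable lebesgue" and a: "\<And>x. \<bar>a x\<bar> \<le> C"
  shows "integrable lebesgue (\<lambda>x. a x * inner (f x) (g x))"
proof (rule Bochner_Integration.integrable_bound)
  note [measurable] = sq_integrable_measurable[OF f] sq_integrable_measurable[OF g]
  show "integrable lebesgue (\<lambda>x. C * ((norm (f x))\<^sup>2 + (norm (g x))\<^sup>2))"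
    using f g by (auto simp: sq_integrable_def)
  show "(\<lambda>x. a x * inner (f x) (g x)) \<in> borel_measurable lebesgue" by measurable
  show "AE x in lebesgue. norm (a x * inner (f x) (g x)) \<le> norm (C * ((norm (f x))\<^sup>2 + (norm (g x))\<^sup>2))"
  proof (intro AE_I2)
    fix x
    have "\<bar>inner (f x) (g x)\<bar> \<le> norm (f x) * norm (g x)" by (rule Cauchy_Schwarz_ineq2)
    also have "\<dots> \<le> (norm (f x))\<^sup>2 + (norm (g x))\<^sup>2"
      using sum_squares_bound[of "norm (f x)" "norm (g x)"]
        mult_nonneg_nonneg[OF norm_ge_zero norm_ge_zero, of "f x" "g x"] by linarith
    finally have "\<bar>a x\<bar> * \<bar>inner (f x) (g x)\<bar> \<le> C * ((norm (f x))\<^sup>2 + (norm (g x))\<^sup>2)"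
      using a[of x] by (intro mult_mono) auto
    moreover have "0 \<le> C" using a[of x] by simp
    ultimately show "norm (a x * inner (f x) (g x)) \<le> norm (C * ((norm (f x))\<^sup>2 + (norm (g x))\<^sup>2))"
      by (simp add: abs_mult)
  qed
qed

lemma sq_integrable_inner:
  assumes "sq_integrable f" "sq_integrable g"
  shows "integrable lebesgue (\<lambda>x. inner (f x) (g x))"
  using sq_integrable_weighted_inner[OF assms, of "\<lambda>_. 1" 1] by simp

lemma sq_integrable_add:
  assumes f: "sq_integrable f" and g: "sq_integrable g"
  shows "sq_integrable (\<lambda>x. f x + g x)"
proof -
  have "integrable lebesgue (\<lambda>x. (norm (f x))\<^sup>2 + 2 * inner (f x) (g x) + (norm (g x))\<^sup>2)"
    using f g sq_integrable_inner[OF f g] by (auto simp: sq_integrable_def)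
  moreover have "(norm (f x + g x))\<^sup>2 = (norm (f x))\<^sup>2 + 2 * inner (f x) (g x) + (norm (g x))\<^sup>2" for x
    unfolding power2_norm_eq_inner by (simp add: inner_simps inner_commute)
  ultimately show ?thesis using f g by (auto simp: sq_integrable_def intro!: borel_measurable_add)
qed

lemma sq_integrable_scaleR: "sq_integrable f \<Longrightarrow> sq_integrable (\<lambda>x. r *\<^sub>R f x)"
  by (auto simp: sq_integrable_def power_mult_distrib)

lemma sq_integrable_zero: "sq_integrable (\<lambda>x. 0)"
  by (simp add: sq_integrable_def)

lemma sq_integrable_uminus: "sq_integrable f \<Longrightarrow> sq_integrable (\<lambda>x. - f x)"
  using sq_integrable_scaleR[of f "-1"] by simp

lemma sq_integrable_diff: "sq_integrable f \<Longrightarrow> sq_integrable g \<Longrightarrow> sq_integrable (\<lambda>x. f x - g x)"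
  using sq_integrable_add[of f "\<lambda>x. - g x"] sq_integrable_uminus[of g] by simp

\<comment> \<open>The quotient is partial because the relation is reflexive only at
  square-integrable functions; all others have no class.\<close>
quotient_type (overloaded) ('a, 'b) l2 = "'a::euclidean_space \<Rightarrow> 'b::euclidean_space" / partial:
  "\<lambda>f g. sq_integrable f \<and> sq_integrable g \<and> (AE x in lebesgue. f x = g x)"
proof (rule part_equivpI)
  show "\<exists>f::'a \<Rightarrow> 'b. sq_integrable f \<and> sq_integrable f \<and> (AE x in lebesgue. f x = f x)"
    using sq_integrable_zero by (intro exI[of _ "\<lambda>x. 0"]) simp
qed (auto simp: symp_def transp_def)

instantiation l2 :: (euclidean_space, euclidean_space) real_inner
begin

lift_definition zero_l2 :: "('a, 'b) l2" is "\<lambda>x. 0"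
  by (simp add: sq_integrable_zero)

lift_definition plus_l2 :: "('a, 'b) l2 \<Rightarrow> ('a, 'b) l2 \<Rightarrow> ('a, 'b) l2" is "\<lambda>f g x. f x + g x"
  by (auto simp: sq_integrable_add elim: eventually_elim2)

lift_definition minus_l2 :: "('a, 'b) l2 \<Rightarrow> ('a, 'b) l2 \<Rightarrow> ('a, 'b) l2" is "\<lambda>f g x. f x - g x"
  by (auto simp: sq_integrable_diff elim: eventually_elim2)

lift_definition uminus_l2 :: "('a, 'b) l2 \<Rightarrow> ('a, 'b) l2" is "\<lambda>f x. - f x"
  by (auto simp: sq_integrable_uminus elim: eventually_mono)

lift_definition scaleR_l2 :: "real \<Rightarrow> ('a, 'b) l2 \<Rightarrow> ('a, 'b) l2" is "\<lambda>r f x. r *\<^sub>R f x"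
  by (auto simp: sq_integrable_scaleR elim: eventually_mono)

lift_definition inner_l2 :: "('a, 'b) l2 \<Rightarrow> ('a, 'b) l2 \<Rightarrow> real" is
  "\<lambda>f g. \<integral>x. inner (f x) (g x) \<partial>lebesgue"
proof (elim conjE, rule integral_cong_AE)
  fix f f' g g' :: "'a \<Rightarrow> 'b"
  assume "sq_integrable f" "sq_integrable f'" "sq_integrable g" "sq_integrable g'"
  note [measurable] = this[THEN sq_integrable_measurable]
  show "(\<lambda>x. inner (f x) (g x)) \<in> borel_measurable lebesgue"
    "(\<lambda>x. inner (f' x) (g' x)) \<in> borel_measurable lebesgue" by measurable
  assume "AE x in lebesgue. f x = f' x" "AE x in lebesgue. g x = g' x"
  then show "AE x in lebesgue. inner (f x) (g x) = inner (f' x) (g' x)" by eventually_elim simp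
qed

definition norm_l2 :: "('a, 'b) l2 \<Rightarrow> real" where "norm_l2 f = sqrt (inner f f)"
definition sgn_l2 :: "('a, 'b) l2 \<Rightarrow> ('a, 'b) l2" where "sgn_l2 f = scaleR (inverse (norm f)) f"
definition dist_l2 :: "('a, 'b) l2 \<Rightarrow> ('a, 'b) l2 \<Rightarrow> real" where "dist_l2 f g = norm (f - g)"
definition uniformity_l2 :: "(('a, 'b) l2 \<times> ('a, 'b) l2) filter" where
  "uniformity_l2 = (INF e\<in>{0<..}. principal {(x, y). dist x y < e})"
definition open_l2 :: "('a, 'b) l2 set \<Rightarrow> bool" where
  "open_l2 S \<longleftrightarrow> (\<forall>x\<in>S. \<forall>\<^sub>F (x', y) in uniformity. x' = x \<longrightarrow> y \<in> S)"

instance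
proof
  fix f g h :: "('a, 'b) l2" and r s :: real
  show "f + g + h = f + (g + h)" by transfer (auto simp: sq_integrable_add add.assoc)
  show "f + g = g + f" by transfer (auto simp: sq_integrable_add add.commute)
  show "0 + f = f" by transfer auto
  show "- f + f = 0" by transfer (auto simp: sq_integrable_zero)
  show "f - g = f + - g" by transfer (auto simp: sq_integrable_diff)
  show "r *\<^sub>R (f + g) = r *\<^sub>R f + r *\<^sub>R g"
    by transfer (auto simp: sq_integrable_add sq_integrable_scaleR scaleR_add_right)
  show "(r + s) *\<^sub>R f = r *\<^sub>R f + s *\<^sub>R f"
    by transfer (auto simp: sq_integrable_add sq_integrable_scaleR scaleR_add_left)
  show "r *\<^sub>R s *\<^sub>R f = (r * s) *\<^sub>R f" by transfer (auto simp: sq_integrable_scaleR)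
  show "1 *\<^sub>R f = f" by transfer auto
  show "dist f g = norm (f - g)" by (simp add: dist_l2_def)
  show "sgn f = scaleR (inverse (norm f)) f" by (simp add: sgn_l2_def)
  show "uniformity = (INF e\<in>{0<..}. principal {(x, y). dist x (y :: ('a, 'b) l2) < e})"
    by (simp add: uniformity_l2_def)
  show "open U \<longleftrightarrow> (\<forall>x\<in>U. \<forall>\<^sub>F (x', y) in uniformity. x' = x \<longrightarrow> y \<in> U)" for U :: "('a, 'b) l2 set"
    by (simp add: open_l2_def)
  show "inner f g = inner g f" by transfer (simp add: inner_commute)
  show "inner (f + g) h = inner f h + inner g h"
    by transfer (auto simp: inner_add_left intro!: Bochner_Integration.integral_add sq_integrable_inner)
  show "inner (r *\<^sub>R f) g = r * inner f g" by transfer simp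
  show "0 \<le> inner f f" by transfer (auto intro!: integral_nonneg_AE)
  show "inner f f = 0 \<longleftrightarrow> f = 0"
  proof (transfer, elim conjE)
    fix f :: "'a \<Rightarrow> 'b" assume f: "sq_integrable f"
    have "(\<integral>x. inner (f x) (f x) \<partial>lebesgue) = 0 \<longleftrightarrow> (AE x in lebesgue. inner (f x) (f x) = 0)"
      by (rule integral_nonneg_eq_0_iff_AE[OF sq_integrable_inner[OF f f]]) simp
    then show "(\<integral>x. inner (f x) (f x) \<partial>lebesgue) = 0 \<longleftrightarrow>
        sq_integrable f \<and> sq_integrable (\<lambda>x. 0 :: 'b) \<and> (AE x in lebesgue. f x = 0)"
      using f by (simp add: sq_integrable_zero)
  qed
  show "norm f = sqrt (inner f f)" by (simp add: norm_l2_def)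
qed

end

section \<open>Passage between functions and classes, and completeness\<close>

lemma rep_l2: "sq_integrable (rep_l2 F)" "abs_l2 (rep_l2 F) = F"
  using Quotient_rep_reflp[OF Quotient_l2] Quotient_abs_rep[OF Quotient_l2] by blast+

lemma abs_l2_eq_iff:
  "sq_integrable f \<Longrightarrow> sq_integrable g \<Longrightarrow> abs_l2 f = abs_l2 g \<longleftrightarrow> (AE x in lebesgue. f x = g x)"
  using Quotient_rel[OF Quotient_l2] by blast

lemma rep_abs_l2:
  assumes "sq_integrable f"
  shows "AE x in lebesgue. rep_l2 (abs_l2 f) x = f x"
  using abs_l2_eq_iff[OF rep_l2(1) assms] rep_l2(2) by blast

lemma abs_l2_add: "sq_integrable f \<Longrightarrow> sq_integrable g \<Longrightarrow> abs_l2 f + abs_l2 g = abs_l2 (\<lambda>x. f x + g x)"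
  by (simp add: plus_l2.abs_eq)

lemma abs_l2_diff: "sq_integrable f \<Longrightarrow> sq_integrable g \<Longrightarrow> abs_l2 f - abs_l2 g = abs_l2 (\<lambda>x. f x - g x)"
  by (simp add: minus_l2.abs_eq)

lemma abs_l2_scaleR: "sq_integrable f \<Longrightarrow> r *\<^sub>R abs_l2 f = abs_l2 (\<lambda>x. r *\<^sub>R f x)"
  by (simp add: scaleR_l2.abs_eq)

lemma inner_abs_l2:
  "sq_integrable f \<Longrightarrow> sq_integrable g \<Longrightarrow> inner (abs_l2 f) (abs_l2 g) = (\<integral>x. inner (f x) (g x) \<partial>lebesgue)"
  by (simp add: inner_l2.abs_eq)

lemma norm_abs_l2:
  "sq_integrable f \<Longrightarrow> (norm (abs_l2 f))\<^sup>2 = (\<integral>x. (norm (f x))\<^sup>2 \<partial>lebesgue)"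
  by (simp add: power2_norm_eq_inner inner_abs_l2)

lemma nn_integral_norm_l2:
  assumes "sq_integrable f"
  shows "(\<integral>\<^sup>+x. ennreal ((norm (f x))\<^sup>2) \<partial>lebesgue) = ennreal ((norm (abs_l2 f))\<^sup>2)"
  using assms by (subst nn_integral_eq_integral) (auto simp: norm_abs_l2 sq_integrable_def)

lemma fast_Cauchy_summable_AE:
  fixes d :: "nat \<Rightarrow> 'a::euclidean_space \<Rightarrow> 'b::euclidean_space"
  assumes d: "\<And>k. sq_integrable (d k)" and small: "\<And>k. norm (abs_l2 (d k)) \<le> (1/4) ^ k"
  shows "AE x in lebesgue. summable (\<lambda>k. d k x)"
proof -
  note [measurable] = sq_integrable_measurable[OF d]
  \<comment> \<open>A weighted sum of squares with finite integral forces geometric decay of $|d_k(x)|$.\<close>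
  have "(\<integral>\<^sup>+x. (\<Sum>k. ennreal (4 ^ k * (norm (d k x))\<^sup>2)) \<partial>lebesgue)
      = (\<Sum>k. (\<integral>\<^sup>+x. ennreal (4 ^ k * (norm (d k x))\<^sup>2) \<partial>lebesgue))"
    by (rule nn_integral_suminf) measurable
  also have "\<dots> = (\<Sum>k. ennreal (4 ^ k * (norm (abs_l2 (d k)))\<^sup>2))"
  proof (rule suminf_cong)
    fix k show "(\<integral>\<^sup>+x. ennreal (4 ^ k * (norm (d k x))\<^sup>2) \<partial>lebesgue) = ennreal (4 ^ k * (norm (abs_l2 (d k)))\<^sup>2)"
      by (simp add: ennreal_mult nn_integral_cmult nn_integral_norm_l2[OF d])
  qed
  also have "\<dots> \<le> (\<Sum>k. ennreal ((1/4) ^ k))"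
  proof (rule suminf_le)
    fix k
    \<comment> \<open>The squared norms are at most 16^(-k), so the weight 4^k still leaves a
      geometric series; conversely, boundedness of the weighted squares at a point gives decay like
      2^(-k).\<close>
    have "4 ^ k * (norm (abs_l2 (d k)))\<^sup>2 \<le> 4 ^ k * ((1/4) ^ k)\<^sup>2"
      using small by (intro mult_left_mono power_mono) auto
    also have "\<dots> = (1/4) ^ k" by (simp add: power2_eq_square power_one_over)
    finally show "ennreal (4 ^ k * (norm (abs_l2 (d k)))\<^sup>2) \<le> ennreal ((1/4) ^ k)" by (rule ennreal_leI)
  qed auto
  also have "\<dots> < \<infinity>"
    by (subst suminf_ennreal2) (auto intro!: summable_geometric)
  finally have "(\<integral>\<^sup>+x. (\<Sum>k. ennreal (4 ^ k * (norm (d k x))\<^sup>2)) \<partial>lebesgue) \<noteq> \<infinity>" by simp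
  then have "AE x in lebesgue. (\<Sum>k. ennreal (4 ^ k * (norm (d k x))\<^sup>2)) \<noteq> \<infinity>"
    by (intro nn_integral_PInf_AE) measurable
  then show ?thesis
  proof eventually_elim
    fix x assume "(\<Sum>k. ennreal (4 ^ k * (norm (d k x))\<^sup>2)) \<noteq> \<infinity>"
    then have "summable (\<lambda>k. 4 ^ k * (norm (d k x))\<^sup>2)"
      by (intro summable_suminf_not_top) auto
    then have "Bseq (\<lambda>k. 4 ^ k * (norm (d k x))\<^sup>2)" by (rule summable_imp_Bseq)
    then obtain M where M: "0 < M" "\<And>k. norm (4 ^ k * (norm (d k x))\<^sup>2) \<le> M" by (auto elim!: BseqE)
    have "norm (d k x) \<le> sqrt M * (1/2) ^ k" for k
    proof -
      have "(4::real) ^ k = (2 ^ k)\<^sup>2" by (simp add: power2_eq_square flip: power_mult_distrib)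
      then have "(2 ^ k * norm (d k x))\<^sup>2 = 4 ^ k * (norm (d k x))\<^sup>2"
        by (simp only: power_mult_distrib)
      then have "(2 ^ k * norm (d k x))\<^sup>2 \<le> M" using M(2)[of k] by simp
      then have "2 ^ k * norm (d k x) \<le> sqrt M" by (rule real_le_rsqrt)
      then show ?thesis by (simp add: field_simps power_one_over)
    qed
    then show "summable (\<lambda>k. d k x)"
      using summable_comparison_test'[of "\<lambda>k. sqrt M * (1/2) ^ k" 0 "\<lambda>k. d k x"]
        summable_mult[OF summable_geometric[of "1/2 :: real"], of "sqrt M"] by simp
  qed
qed

text \<open>Riesz-Fischer: a fast subsequence converges pointwise almost everywhere, and Fatou's
  lemma turns the pointwise limit into a limit in norm of the whole sequence.\<close>

instance l2 :: (euclidean_space, euclidean_space) complete_space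
proof
  fix X :: "nat \<Rightarrow> ('a, 'b) l2" assume X: "Cauchy X"
  define F where "F n = rep_l2 (X n)" for n
  have F: "sq_integrable (F n)" and X_F: "X n = abs_l2 (F n)" for n
    unfolding F_def by (simp_all add: rep_l2)
  note [measurable] = sq_integrable_measurable[OF F]
  have "\<forall>k. \<exists>N. \<forall>m\<ge>N. \<forall>n\<ge>N. dist (X m) (X n) < (1/4) ^ k"
    using X unfolding Cauchy_def by simp
  then obtain N where N: "\<And>k m n. m \<ge> N k \<Longrightarrow> n \<ge> N k \<Longrightarrow> dist (X m) (X n) < (1/4) ^ k"
    by metis
  \<comment> \<open>The partial sums make the indices monotone and at least \<open>N k\<close>; the
    summand k also makes r tend to infinity, as the Fatou argument requires.\<close>
  define r where "r k = k + (\<Sum>j\<le>k. N j)" for k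
  have r: "N k \<le> r k" "r k \<le> r (Suc k)" "k \<le> r k" for k
  proof -
    have "N k \<le> (\<Sum>j\<le>k. N j)" by (rule member_le_sum) auto
    then show "N k \<le> r k" unfolding r_def by simp
  qed (simp_all add: r_def)
  define d where "d k x = F (r (Suc k)) x - F (r k) x" for k x
  have "AE x in lebesgue. summable (\<lambda>k. d k x)"
  proof (rule fast_Cauchy_summable_AE)
    fix k
    show "sq_integrable (d k)" unfolding d_def by (intro sq_integrable_diff F)
    have "abs_l2 (d k) = X (r (Suc k)) - X (r k)"
      unfolding X_F d_def by (rule abs_l2_diff[OF F F, symmetric])
    moreover have "dist (X (r (Suc k))) (X (r k)) < (1/4) ^ k"
      using r[of k] by (intro N) auto
    ultimately show "norm (abs_l2 (d k)) \<le> (1/4) ^ k" by (simp add: dist_norm)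
  qed
  then have conv: "AE x in lebesgue. (\<lambda>k. F (r k) x) \<longlonglongrightarrow> lim (\<lambda>k. F (r k) x)"
  proof eventually_elim
    fix x assume "summable (\<lambda>k. d k x)"
    then have "convergent (\<lambda>n. \<Sum>k<n. d k x)" by (simp add: summable_iff_convergent)
    moreover have "(\<Sum>k<n. d k x) = F (r n) x - F (r 0) x" for n
      unfolding d_def by (induction n) auto
    ultimately have "convergent (\<lambda>n. F (r n) x - F (r 0) x)" by simp
    then show "(\<lambda>k. F (r k) x) \<longlonglongrightarrow> lim (\<lambda>k. F (r k) x)"
      by (simp add: convergent_diff_const_right_iff convergent_LIMSEQ_iff)
  qed
  \<comment> \<open>On the null set where the subsequence diverges, \<open>lim\<close> has a default
    value; measurability is unaffected.\<close>
  define G where "G x = lim (\<lambda>k. F (r k) x)" for x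
  have G_meas [measurable]: "G \<in> borel_measurable lebesgue"
    unfolding G_def by (rule borel_measurable_lim_metric) measurable
  \<comment> \<open>Fatou is applied along the subsequence with n held fixed. For large j both
    \<open>r j\<close> and n exceed \<open>N k\<close>, so the Cauchy bound survives in the
    limit.\<close>
  have bound: "(\<integral>\<^sup>+x. ennreal ((norm (G x - F n x))\<^sup>2) \<partial>lebesgue) \<le> ennreal (((1/4) ^ k)\<^sup>2)"
    if n: "n \<ge> N k" for k n
  proof -
    have "(\<integral>\<^sup>+x. ennreal ((norm (G x - F n x))\<^sup>2) \<partial>lebesgue)
        = (\<integral>\<^sup>+x. liminf (\<lambda>j. ennreal ((norm (F (r j) x - F n x))\<^sup>2)) \<partial>lebesgue)"
    proof (rule nn_integral_cong_AE, use conv in eventually_elim)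
      fix x assume "(\<lambda>k. F (r k) x) \<longlonglongrightarrow> lim (\<lambda>k. F (r k) x)"
      then have "(\<lambda>j. ennreal ((norm (F (r j) x - F n x))\<^sup>2)) \<longlonglongrightarrow> ennreal ((norm (G x - F n x))\<^sup>2)"
        unfolding G_def by (intro tendsto_intros)
      then show "ennreal ((norm (G x - F n x))\<^sup>2) = liminf (\<lambda>j. ennreal ((norm (F (r j) x - F n x))\<^sup>2))"
        by (intro lim_imp_Liminf[symmetric]) simp_all
    qed
    also have "\<dots> \<le> liminf (\<lambda>j. \<integral>\<^sup>+x. ennreal ((norm (F (r j) x - F n x))\<^sup>2) \<partial>lebesgue)"
      by (rule nn_integral_liminf) measurable
    also have "\<dots> \<le> liminf (\<lambda>j. ennreal (((1/4) ^ k)\<^sup>2))"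
    proof (rule Liminf_mono, rule eventually_sequentiallyI[of "N k"])
      fix j assume "N k \<le> j"
      then have "N k \<le> r j" using r(3)[of j] by simp
      then have "dist (X (r j)) (X n) < (1/4) ^ k" using n by (rule N)
      then have "(norm (X (r j) - X n))\<^sup>2 \<le> ((1/4) ^ k)\<^sup>2"
        by (intro power_mono) (auto simp: dist_norm)
      then show "(\<integral>\<^sup>+x. ennreal ((norm (F (r j) x - F n x))\<^sup>2) \<partial>lebesgue) \<le> ennreal (((1/4) ^ k)\<^sup>2)"
        using nn_integral_norm_l2[OF sq_integrable_diff[OF F F], of "r j" n]
        by (simp add: X_F abs_l2_diff[OF F F] ennreal_leI)
    qed
    also have "\<dots> = ennreal (((1/4) ^ k)\<^sup>2)" by (simp add: Liminf_const)
    finally show ?thesis .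
  qed
  have GF: "sq_integrable (\<lambda>x. G x - F n x)" if "n \<ge> N k" for n k
    unfolding sq_integrable_def
  proof
    show "integrable lebesgue (\<lambda>x. (norm (G x - F n x))\<^sup>2)"
      using order.strict_trans1[OF bound[OF that]] by (intro integrableI_nonneg) auto
  qed measurable
  \<comment> \<open>The bound for k = 0 makes G minus one member of the sequence square integrable;
    adding this member back recovers G.\<close>
  have G: "sq_integrable G"
    using sq_integrable_add[OF GF[OF order_refl, of 0] F[of "N 0"]] by simp
  have "X \<longlonglongrightarrow> abs_l2 G"
  proof (rule metric_LIMSEQ_I)
    fix e :: real assume "0 < e"
    then obtain k where k: "(1/4) ^ k < e" using real_arch_pow_inv[of e "1/4"] by auto
    have "dist (X n) (abs_l2 G) < e" if "n \<ge> N k" for n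
    proof -
      have "ennreal ((norm (abs_l2 (\<lambda>x. G x - F n x)))\<^sup>2) \<le> ennreal (((1/4) ^ k)\<^sup>2)"
        using bound[OF that] nn_integral_norm_l2[OF GF[OF that]] by simp
      then have "(norm (abs_l2 (\<lambda>x. G x - F n x)))\<^sup>2 \<le> ((1/4) ^ k)\<^sup>2" by simp
      then have "norm (abs_l2 (\<lambda>x. G x - F n x)) \<le> (1/4) ^ k"
        by (rule power2_le_imp_le) simp
      then show ?thesis using k by (simp add: X_F abs_l2_diff[OF G F, symmetric] dist_norm norm_minus_commute)
    qed
    then show "\<exists>no. \<forall>n\<ge>no. dist (X n) (abs_l2 G) < e" by blast
  qed
  then show "convergent X" by (rule convergentI)
qed

text \<open>Chosen representatives make the formula meaningful for every weight;
  \<open>weighted_inner_abs\<close> shows that for a measurable weight the choice is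
  irrelevant.\<close>

definition weighted_inner :: "('a::euclidean_space \<Rightarrow> real) \<Rightarrow> ('a, 'b::euclidean_space) l2 \<Rightarrow> ('a, 'b) l2 \<Rightarrow> real" where
  "weighted_inner a F G = (\<integral>x. a x * inner (rep_l2 F x) (rep_l2 G x) \<partial>lebesgue)"

lemma weighted_inner_abs:
  assumes a [measurable]: "a \<in> borel_measurable lebesgue" and f: "sq_integrable f" and g: "sq_integrable g"
  shows "weighted_inner a (abs_l2 f) (abs_l2 g) = (\<integral>x. a x * inner (f x) (g x) \<partial>lebesgue)"
  unfolding weighted_inner_def
proof (rule integral_cong_AE)
  note [measurable] = f[THEN sq_integrable_measurable] g[THEN sq_integrable_measurable]
    rep_l2(1)[THEN sq_integrable_measurable, of "abs_l2 f"] rep_l2(1)[THEN sq_integrable_measurable, of "abs_l2 g"]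
  show "AE x in lebesgue. a x * inner (rep_l2 (abs_l2 f) x) (rep_l2 (abs_l2 g) x) = a x * inner (f x) (g x)"
    using rep_abs_l2[OF f] rep_abs_l2[OF g] by eventually_elim simp
  show "(\<lambda>x. a x * inner (rep_l2 (abs_l2 f) x) (rep_l2 (abs_l2 g) x)) \<in> borel_measurable lebesgue" by measurable
  show "(\<lambda>x. a x * inner (f x) (g x)) \<in> borel_measurable lebesgue" by measurable
qed

lemma weighted_inner_commute: "weighted_inner a F G = weighted_inner a G F"
  by (simp add: weighted_inner_def inner_commute)

lemma sq_integrable_mult:
  assumes f: "sq_integrable f" and a: "a \<in> borel_measurable lebesgue" "\<And>x. \<bar>a x\<bar> \<le> C"
  shows "sq_integrable (\<lambda>x. a x *\<^sub>R f x)"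
proof -
  note [measurable] = f[THEN sq_integrable_measurable] a(1)
  have "integrable lebesgue (\<lambda>x. (a x)\<^sup>2 * inner (f x) (f x))"
  proof (rule sq_integrable_weighted_inner[OF f f])
    show "\<bar>(a x)\<^sup>2\<bar> \<le> C\<^sup>2" for x using power_mono[OF a(2), of x 2] by simp
  qed measurable
  then show ?thesis unfolding sq_integrable_def
    by (simp add: power_mult_distrib power2_norm_eq_inner)
qed

text \<open>The representative of a sum need not be the sum of the representatives, so additivity is
  not visible in the integral. Writing the form as the inner product of \<open>M F\<close> with G,
  where \<open>M\<close> is multiplication by the weight and has norm at most C, gives linearity in
  G; commutativity gives it in F.\<close>

lemma bounded_bilinear_weighted_inner:
  fixes a :: "'a::euclidean_space \<Rightarrow> real"
  assumes a: "a \<in> borel_measurable lebesgue" "\<And>x. \<bar>a x\<bar> \<le> C"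
  shows "bounded_bilinear (weighted_inner a :: ('a, 'b::euclidean_space) l2 \<Rightarrow> ('a, 'b) l2 \<Rightarrow> real)"
proof -
  define M where "M F = (abs_l2 (\<lambda>x. a x *\<^sub>R rep_l2 F x) :: ('a, 'b) l2)" for F
  have aF: "sq_integrable (\<lambda>x. a x *\<^sub>R rep_l2 F x)" for F :: "('a, 'b) l2"
    by (rule sq_integrable_mult[OF rep_l2(1) a])
  have M: "weighted_inner a F G = inner (M F) G" for F G :: "('a, 'b) l2"
    using inner_abs_l2[OF aF[of F] rep_l2(1)[of G]] by (simp add: M_def rep_l2 weighted_inner_def)
  have norm_M: "norm (M F) \<le> C * norm F" for F
  proof (rule power2_le_imp_le)
    have "(norm (M F))\<^sup>2 = (\<integral>x. (norm (a x *\<^sub>R rep_l2 F x))\<^sup>2 \<partial>lebesgue)"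
      unfolding M_def by (rule norm_abs_l2[OF aF])
    also have "\<dots> \<le> (\<integral>x. C\<^sup>2 * (norm (rep_l2 F x))\<^sup>2 \<partial>lebesgue)"
    proof (rule integral_mono)
      show "(norm (a x *\<^sub>R rep_l2 F x))\<^sup>2 \<le> C\<^sup>2 * (norm (rep_l2 F x))\<^sup>2" for x
        using power_mono[OF a(2), of x 2] by (simp add: power_mult_distrib mult_right_mono)
    qed (use aF rep_l2(1) in \<open>auto simp: sq_integrable_def\<close>)
    also have "\<dots> = (C * norm F)\<^sup>2"
      using norm_abs_l2[OF rep_l2(1), of F] by (simp add: rep_l2 power_mult_distrib)
    finally show "(norm (M F))\<^sup>2 \<le> (C * norm F)\<^sup>2" .
    show "0 \<le> C * norm F" using a(2)[of undefined] by auto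
  qed
  have add: "weighted_inner a F (G + H) = weighted_inner a F G + weighted_inner a F H" for F G H :: "('a, 'b) l2"
    by (simp add: M inner_add_right)
  have scale: "weighted_inner a F (s *\<^sub>R G) = s *\<^sub>R weighted_inner a F G" for F G :: "('a, 'b) l2" and s
    by (simp add: M)
  show ?thesis
  proof
    fix F G H :: "('a, 'b) l2" and s :: real
    show "weighted_inner a F (G + H) = weighted_inner a F G + weighted_inner a F H" by (rule add)
    show "weighted_inner a (F + G) H = weighted_inner a F H + weighted_inner a G H"
      using add weighted_inner_commute by metis
    show "weighted_inner a F (s *\<^sub>R G) = s *\<^sub>R weighted_inner a F G" by (rule scale)
    show "weighted_inner a (s *\<^sub>R F) G = s *\<^sub>R weighted_inner a F G"
      using scale weighted_inner_commute by metis
    have "norm (weighted_inner a F G) \<le> norm F * norm G * C" for F G :: "('a, 'b) l2"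
    proof -
      have "norm (weighted_inner a F G) \<le> norm (M F) * norm G"
        unfolding M real_norm_def by (rule Cauchy_Schwarz_ineq2)
      also have "\<dots> \<le> C * norm F * norm G" using norm_M by (rule mult_right_mono) simp
      finally show ?thesis by (simp add: mult_ac)
    qed
    then show "\<exists>K. \<forall>F G :: ('a, 'b) l2. norm (weighted_inner a F G) \<le> norm F * norm G * K" by blast
  qed
qed

lemma weighted_inner_coercive:
  assumes a: "a \<in> borel_measurable lebesgue" "\<And>x. \<bar>a x\<bar> \<le> C" "\<And>x. c \<le> a x"
  shows "c * (norm F)\<^sup>2 \<le> weighted_inner a F F"
proof -
  have "c * (norm F)\<^sup>2 = (\<integral>x. c * inner (rep_l2 F x) (rep_l2 F x) \<partial>lebesgue)"
    using inner_abs_l2[OF rep_l2(1) rep_l2(1), of F F] by (simp add: rep_l2 power2_norm_eq_inner)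
  also have "\<dots> \<le> weighted_inner a F F" unfolding weighted_inner_def
    using a sq_integrable_inner[OF rep_l2(1) rep_l2(1), of F F] sq_integrable_weighted_inner[OF rep_l2(1) rep_l2(1) a(1,2), of F F]
    by (intro integral_mono mult_right_mono) auto
  finally show ?thesis .
qed

section \<open>Smooth bump functions and the fundamental lemma\<close>

text \<open>Differentiating exp(-1/t) produces powers of 1/t. Including them as an index n makes the
  family stable under differentiation up to linear combinations.\<close>

definition flat :: "nat \<Rightarrow> real \<Rightarrow> real" where
  "flat n t = (if 0 < t then (1 / t) ^ n * exp (- 1 / t) else 0)"

lemma flat_tendsto_0: "(flat n \<longlongrightarrow> 0) (at 0)"
proof -
  have "((\<lambda>s. s ^ n / exp s) \<longlongrightarrow> (0::real)) at_top" by (rule tendsto_power_div_exp_0)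
  moreover have "filterlim inverse at_top (at_right (0::real))" by (rule filterlim_inverse_at_top_right)
  ultimately have "((\<lambda>t. inverse t ^ n / exp (inverse t)) \<longlongrightarrow> (0::real)) (at_right 0)"
    by (rule filterlim_compose)
  then have "(flat n \<longlongrightarrow> 0) (at_right 0)"
    by (rule Lim_transform_eventually)
      (auto simp: flat_def eventually_at_filter exp_minus divide_inverse)
  moreover have "(flat n \<longlongrightarrow> 0) (at_left 0)"
    by (rule Lim_transform_eventually[OF tendsto_const]) (auto simp: flat_def eventually_at_filter)
  ultimately show ?thesis by (simp add: filterlim_at_split)
qed

lemma flat_has_derivative:
  "(flat n has_real_derivative flat (n + 2) t - real n * flat (n + 1) t) (at t)"
proof -
  consider "0 < t" | "t < 0" | "t = 0" by linarith
  then show ?thesis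
  proof cases
    case 1
    have "((\<lambda>t. (1 / t) ^ n * exp (- 1 / t)) has_real_derivative flat (n + 2) t - real n * flat (n + 1) t) (at t)"
      using 1 by (auto intro!: derivative_eq_intros simp: flat_def)
        (cases n; simp add: field_simps power2_eq_square)
    then show ?thesis
      by (rule has_field_derivative_transform_within_open[of _ _ _ "{0<..}"]) (use 1 in \<open>auto simp: flat_def\<close>)
  next
    case 2
    have "((\<lambda>t. 0) has_real_derivative flat (n + 2) t - real n * flat (n + 1) t) (at t)"
      using 2 by (simp add: flat_def)
    then show ?thesis
      by (rule has_field_derivative_transform_within_open[of _ _ _ "{..<0}"]) (use 2 in \<open>auto simp: flat_def\<close>)
  next
    case 3
    \<comment> \<open>The difference quotient at 0 is \<open>flat (n + 1)\<close> away from 0, whose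
      limit there is known.\<close>
    have "((\<lambda>h. (flat n (0 + h) - flat n 0) / h) \<longlongrightarrow> 0) (at 0)"
      by (rule Lim_transform_eventually[OF flat_tendsto_0[of "n + 1"]])
        (auto simp: flat_def eventually_at_filter)
    then show ?thesis using 3 by (simp add: DERIV_def flat_def)
  qed
qed

text \<open>An algebra of functions that contains the bumps and is closed under partial derivatives,
  so that all iterated derivatives exist at once.\<close>

inductive smooth_alg :: "(real^3 \<Rightarrow> real) \<Rightarrow> bool" where
  flat: "smooth_alg (\<lambda>x. flat n (a + s * x $ i))"
| scale: "smooth_alg F \<Longrightarrow> smooth_alg (\<lambda>x. r * F x)"
| add: "smooth_alg F \<Longrightarrow> smooth_alg G \<Longrightarrow> smooth_alg (\<lambda>x. F x + G x)"
| mult: "smooth_alg F \<Longrightarrow> smooth_alg G \<Longrightarrow> smooth_alg (\<lambda>x. F x * G x)"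

lemma smooth_alg_derivative:
  assumes "smooth_alg F"
  shows "\<exists>D. (\<forall>x. (F has_derivative D x) (at x)) \<and> (\<forall>j. smooth_alg (\<lambda>x. D x (axis j 1)))"
  using assms
proof induction
  case (flat n a s i)
  let ?d = "\<lambda>x::real^3. flat (n + 2) (a + s * x $ i) - real n * flat (n + 1) (a + s * x $ i)"
  have "((\<lambda>x. flat n (a + s * x $ i)) has_derivative (\<lambda>h. ?d x * (s * h $ i))) (at x)" for x :: "real^3"
  proof -
    have "((\<lambda>x. a + s * x $ i) has_derivative (\<lambda>h. s * h $ i)) (at x)"
      by (auto intro!: derivative_eq_intros bounded_linear.has_derivative[OF bounded_linear_vec_nth])
    then show ?thesis
      using has_derivative_compose[of "\<lambda>x. a + s * x $ i" _ x UNIV "flat n"] flat_has_derivative[of n "a + s * x $ i"]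
      unfolding has_field_derivative_def by blast
  qed
  moreover have "smooth_alg (\<lambda>x. ?d x * (s * axis j 1 $ i))" for j :: 3
  proof -
    have "smooth_alg (\<lambda>x. (s * axis j 1 $ i) * (flat (n + 2) (a + s * x $ i) + (- real n) * flat (n + 1) (a + s * x $ i)))"
      by (intro smooth_alg.intros)
    then show ?thesis by (simp add: mult.commute)
  qed
  ultimately show ?case by (intro exI[of _ "\<lambda>x h. ?d x * (s * h $ i)"]) blast
next
  case (scale F r)
  then obtain D where D: "\<And>x. (F has_derivative D x) (at x)" "\<And>j. smooth_alg (\<lambda>x. D x (axis j 1))" by blast
  then show ?case by (intro exI[of _ "\<lambda>x h. r * D x h"])
      (auto intro!: smooth_alg.scale has_derivative_mult_right)
next
  case (add F G)
  then obtain D E where D: "\<And>x. (F has_derivative D x) (at x)" "\<And>j. smooth_alg (\<lambda>x. D x (axis j 1))"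
    and E: "\<And>x. (G has_derivative E x) (at x)" "\<And>j. smooth_alg (\<lambda>x. E x (axis j 1))" by blast
  then show ?case by (intro exI[of _ "\<lambda>x h. D x h + E x h"])
      (auto intro!: smooth_alg.add has_derivative_add)
next
  case (mult F G)
  then obtain D E where D: "\<And>x. (F has_derivative D x) (at x)" "\<And>j. smooth_alg (\<lambda>x. D x (axis j 1))"
    and E: "\<And>x. (G has_derivative E x) (at x)" "\<And>j. smooth_alg (\<lambda>x. E x (axis j 1))" by blast
  then show ?case using mult.hyps by (intro exI[of _ "\<lambda>x h. F x * E x h + D x h * G x"])
      (auto intro!: smooth_alg.add smooth_alg.mult has_derivative_mult)
qed

section \<open>Iterated derivatives and smooth approximation of boxes\<close>

lemma pd_eqI: "(F has_derivative D) (at x) \<Longrightarrow> pd j F x = D (axis j 1)"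
  unfolding pd_def by (simp add: frechet_derivative_at[symmetric])

lemma smooth_alg_pd:
  assumes "smooth_alg F"
  shows "smooth_alg (pd j F)" "F differentiable (at x)"
proof -
  obtain D where D: "\<And>x. (F has_derivative D x) (at x)" "\<And>j. smooth_alg (\<lambda>x. D x (axis j 1))"
    using smooth_alg_derivative[OF assms] by blast
  have "pd j F = (\<lambda>x. D x (axis j 1))" using pd_eqI[OF D(1)] by blast
  then show "smooth_alg (pd j F)" using D(2) by simp
  show "F differentiable (at x)" using D(1) differentiableI by blast
qed

text \<open>Iterated derivatives of a scalar function times a fixed vector fall on the scalar factor
  alone, so the scalar algebra is enough for vector test fields.\<close>

lemma smooth_alg_smooth3:
  assumes "smooth_alg F"
  shows "smooth3 (\<lambda>x. F x *\<^sub>R (b::'b::real_normed_vector))"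
proof -
  have "smooth_alg (dit js F) \<and> dit js (\<lambda>x. F x *\<^sub>R b) = (\<lambda>x. dit js F x *\<^sub>R b)" for js
  proof (induction js)
    case (Cons j js)
    then have sm: "smooth_alg (dit js F)" by simp
    have "pd j (\<lambda>x. dit js F x *\<^sub>R b) x = pd j (dit js F) x *\<^sub>R b" for x
    proof -
      obtain D where D: "(dit js F has_derivative D) (at x)"
        using smooth_alg_pd(2)[OF sm] by (auto simp: differentiable_def)
      then show ?thesis using pd_eqI[OF has_derivative_scaleR_left[OF D]] pd_eqI[OF D] by simp
    qed
    then show ?case using Cons smooth_alg_pd(1)[OF sm] by auto
  qed (simp add: assms)
  then show ?thesis unfolding smooth3_def
    using smooth_alg_pd(2) by (auto intro!: differentiable_scaleR)
qed

text \<open>For r > 0 the product is positive exactly on the open box. The parameter r is a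
  steepness: each factor has the form exp(-1/(r t)) there and tends to 1 as r grows, so the bumps
  approach the indicator of the box.\<close>

definition bump :: "real \<Rightarrow> real^3 \<Rightarrow> real^3 \<Rightarrow> real^3 \<Rightarrow> real" where
  "bump r a b x = (\<Prod>i\<in>UNIV. flat 0 (r * (x $ i - a $ i)) * flat 0 (r * (b $ i - x $ i)))"

lemma smooth_alg_bump: "smooth_alg (bump r a b)"
proof -
  have "smooth_alg (\<lambda>x. flat 0 (r * (x $ i - a $ i)))" "smooth_alg (\<lambda>x. flat 0 (r * (b $ i - x $ i)))" for i
    using smooth_alg.flat[of 0 "- r * a $ i" r i] smooth_alg.flat[of 0 "r * b $ i" "- r" i]
    by (simp_all add: algebra_simps)
  then have "smooth_alg (\<lambda>x. (flat 0 (r * (x $ 1 - a $ 1)) * flat 0 (r * (b $ 1 - x $ 1)))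
      * (flat 0 (r * (x $ 2 - a $ 2)) * flat 0 (r * (b $ 2 - x $ 2)))
      * (flat 0 (r * (x $ 3 - a $ 3)) * flat 0 (r * (b $ 3 - x $ 3))))"
    by (intro smooth_alg.mult)
  moreover have "bump r a b x = (flat 0 (r * (x $ 1 - a $ 1)) * flat 0 (r * (b $ 1 - x $ 1)))
      * (flat 0 (r * (x $ 2 - a $ 2)) * flat 0 (r * (b $ 2 - x $ 2)))
      * (flat 0 (r * (x $ 3 - a $ 3)) * flat 0 (r * (b $ 3 - x $ 3)))" for x
    unfolding bump_def UNIV_3 by (simp add: mult_ac)
  ultimately show ?thesis by (metis (no_types, lifting) ext)
qed

lemma flat_0_bounds: "0 \<le> flat 0 t" "flat 0 t \<le> 1"
  by (auto simp: flat_def)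

lemma bump_bounds: "0 \<le> bump r a b x" "bump r a b x \<le> 1"
  unfolding bump_def by (auto intro!: prod_nonneg prod_le_1 mult_nonneg_nonneg mult_le_one flat_0_bounds)

lemma bump_outside:
  assumes "0 < r" "x \<notin> box a b"
  shows "bump r a b x = 0"
proof -
  obtain i where "x $ i \<le> a $ i \<or> b $ i \<le> x $ i" using assms(2) by (auto simp: mem_box_cart not_less)
  then have "flat 0 (r * (x $ i - a $ i)) * flat 0 (r * (b $ i - x $ i)) = 0"
    using assms(1) by (auto simp: flat_def zero_less_mult_iff)
  then show ?thesis unfolding bump_def by (intro prod_zero) auto
qed

lemma bump_tendsto_indicator: "(\<lambda>n. bump (real (Suc n)) a b x) \<longlonglongrightarrow> indicator (box a b) x"
proof (cases "x \<in> box a b")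
  case True
  have *: "(\<lambda>n. flat 0 (real (Suc n) * t)) \<longlonglongrightarrow> 1" if "0 < t" for t
  proof -
    have "(\<lambda>n. exp (- (inverse (real (Suc n)) * (1 / t)))) \<longlonglongrightarrow> exp (- (0 * (1 / t)))"
      by (intro tendsto_intros LIMSEQ_inverse_real_of_nat)
    then show ?thesis using that by (simp add: flat_def divide_inverse)
  qed
  have "(\<lambda>n. bump (real (Suc n)) a b x) \<longlonglongrightarrow> (\<Prod>i\<in>(UNIV::3 set). 1 * 1)"
    unfolding bump_def using True by (intro tendsto_prod tendsto_mult *) (auto simp: mem_box_cart)
  then show ?thesis using True by simp
qed (simp add: bump_outside)

lemma test_fun_bump:
  assumes "0 < r" "cbox a b \<subseteq> G"
  shows "test_fun G (\<lambda>x. bump r a b x *\<^sub>R v)"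
  unfolding test_fun_def
proof (intro conjI exI[of _ "cbox a b"])
  show "\<forall>x. x \<notin> cbox a b \<longrightarrow> bump r a b x *\<^sub>R v = 0"
    using bump_outside[OF assms(1)] box_subset_cbox by fastforce
qed (use assms smooth_alg_smooth3[OF smooth_alg_bump] in auto)

text \<open>Classes are formed over the whole space, so \<open>l2\<close> carries no domain; a field
  on a domain enters through its extension by zero.\<close>

definition zero_ext :: "'a set \<Rightarrow> ('a \<Rightarrow> 'b::zero) \<Rightarrow> 'a \<Rightarrow> 'b" where
  "zero_ext G F x = (if x \<in> G then F x else 0)"

lemma L2_iff_zero_ext:
  fixes F :: "real^3 \<Rightarrow> 'b::euclidean_space"
  assumes "G \<in> sets lebesgue"
  shows "L2 G F \<longleftrightarrow> sq_integrable (zero_ext G F)"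
proof -
  have "zero_ext G F \<in> borel_measurable lebesgue \<longleftrightarrow> F \<in> borel_measurable (lebesgue_on G)"
    using borel_measurable_if[OF assms, of F] by (simp add: zero_ext_def[abs_def])
  moreover have "(norm (zero_ext G F x))\<^sup>2 = indicator G x *\<^sub>R (norm (F x))\<^sup>2" for x
    by (simp add: zero_ext_def)
  ultimately show ?thesis unfolding L2_def sq_integrable_def
    using assms integrable_restrict_space[of G lebesgue "\<lambda>x. (norm (F x))\<^sup>2"] by simp
qed

lemma ip_zero_ext:
  assumes "G \<in> sets lebesgue"
  shows "ip G F H = (\<integral>x. inner (zero_ext G F x) (zero_ext G H x) \<partial>lebesgue)"
proof -
  have "inner (zero_ext G F x) (zero_ext G H x) = indicator G x *\<^sub>R inner (F x) (H x)" for x by (simp add: zero_ext_def)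
  then show ?thesis unfolding ip_def
    using assms integral_restrict_space[of G lebesgue "\<lambda>x. inner (F x) (H x)"] by simp
qed

text \<open>Open boxes form an intersection-stable generator of the Borel sets, and the sets over
  which g integrates to 0 form a Dynkin system; \<open>total\<close> handles the complements. A
  function with zero integral over every measurable set vanishes almost everywhere.\<close>

lemma AE_zero_of_box_integrals:
  fixes g :: "'a::euclidean_space \<Rightarrow> real"
  assumes g: "integrable lebesgue g" and total: "(\<integral>x. g x \<partial>lebesgue) = 0"
    and boxes: "\<And>a b. (\<integral>x\<in>box a b. g x \<partial>lebesgue) = 0"
  shows "AE x in lebesgue. g x = 0"
proof (rule density_unique_real[OF g integrable_zero])
  let ?E = "range (\<lambda>(a, b). box a b :: 'a set)"
  have borel: "(\<integral>x\<in>A. g x \<partial>lebesgue) = 0" if "A \<in> sigma_sets UNIV ?E" for A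
  proof (rule sigma_sets_induct_disjoint[of ?E UNIV A "\<lambda>A. (\<integral>x\<in>A. g x \<partial>lebesgue) = 0"])
    show "Int_stable ?E" by (auto simp: Int_stable_def box_Int_box)
    have sets_eq: "sigma_sets UNIV ?E = sets borel" by (simp add: borel_eq_box)
    fix A assume "A \<in> sigma_sets UNIV ?E" and A0: "(\<integral>x\<in>A. g x \<partial>lebesgue) = 0"
    then have A: "A \<in> sets lebesgue" using sets_eq by auto
    have "set_integrable lebesgue A g" "set_integrable lebesgue (- A) g"
      unfolding set_integrable_def using A g by (blast intro: integrable_mult_indicator sets.compl_sets[of A lebesgue, simplified, folded Compl_eq_Diff_UNIV])+
    then have "(\<integral>x\<in>A \<union> - A. g x \<partial>lebesgue) = (\<integral>x\<in>A. g x \<partial>lebesgue) + (\<integral>x\<in>- A. g x \<partial>lebesgue)"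
      by (intro set_integral_Un) auto
    then show "(\<integral>x\<in>UNIV - A. g x \<partial>lebesgue) = 0"
      using A0 total by (simp add: set_lebesgue_integral_def Compl_eq_Diff_UNIV)
  next
    have sets_eq: "sigma_sets UNIV ?E = sets borel" by (simp add: borel_eq_box)
    fix A :: "nat \<Rightarrow> 'a set"
    assume A: "disjoint_family A" "range A \<subseteq> sigma_sets UNIV ?E" "\<And>i. (\<integral>x\<in>A i. g x \<partial>lebesgue) = 0"
    have meas: "A i \<in> sets lebesgue" for i using A(2) sets_eq by auto
    have "set_integrable lebesgue (\<Union>i. A i) g"
      unfolding set_integrable_def using meas g by (blast intro: integrable_mult_indicator)
    then have "(\<integral>x\<in>(\<Union>i. A i). g x \<partial>lebesgue) = (\<Sum>i. (\<integral>x\<in>A i. g x \<partial>lebesgue))"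
      using A(1) meas by (intro lebesgue_integral_countable_add) (auto simp: disjoint_family_on_def)
    then show "(\<integral>x\<in>(\<Union>i. A i). g x \<partial>lebesgue) = 0" using A(3) by simp
  qed (use that boxes in \<open>auto simp: set_lebesgue_integral_def\<close>)
  \<comment> \<open>The Dynkin argument reaches Borel sets; a Lebesgue set is an F-sigma set up to a
    null set.\<close>
  fix A :: "'a set" assume "A \<in> sets lebesgue"
  then obtain C N where CN: "fsigma C" "N \<in> null_sets lebesgue" "C \<union> N = A"
    by (rule lebesgue_set_almost_fsigma)
  have C: "C \<in> sets borel" using CN(1) by (auto elim!: fsigma.cases)
  have "AE x in lebesgue. x \<notin> N" using CN(2) by (rule AE_not_in)
  then have "(\<integral>x\<in>A. g x \<partial>lebesgue) = (\<integral>x\<in>C. g x \<partial>lebesgue)"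
    unfolding set_lebesgue_integral_def
    using \<open>A \<in> sets lebesgue\<close> C g
    by (intro integral_cong_AE borel_measurable_scaleR borel_measurable_indicator)
      (auto elim!: eventually_mono simp: indicator_def CN(3)[symmetric])
  also have "\<dots> = 0" using C by (intro borel) (simp add: borel_eq_box)
  finally show "(\<integral>x\<in>A. g x \<partial>lebesgue) = (\<integral>x\<in>A. 0 \<partial>lebesgue)"
    by (simp add: set_lebesgue_integral_def)
qed

text \<open>Bumps times a coordinate vector are test fields. They converge pointwise to the
  indicator of the box and are bounded by 1, so dominated convergence with the component of F on the
  closed box passes the vanishing integrals to the limit.\<close>

lemma fundamental_lemma_box:
  assumes G: "G \<in> sets lebesgue" and F: "L2 G F"
    and zero: "\<And>\<phi>. test_fun G \<phi> \<Longrightarrow> ip G F \<phi> = 0" and sub: "cbox a b \<subseteq> G"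
  shows "set_integrable lebesgue (cbox a b) (\<lambda>x. F x $ i)" "(\<integral>x\<in>box a b. F x $ i \<partial>lebesgue) = 0"
proof -
  let ?g = "\<lambda>x. indicator (cbox a b) x *\<^sub>R F x $ i"
  have cutF: "sq_integrable (zero_ext G F)" using F L2_iff_zero_ext[OF G] by blast
  \<comment> \<open>As a pairing of two square-integrable fields, the cut-off component is
    integrable.\<close>
  have g_eq: "?g = (\<lambda>x. inner (zero_ext G F x) (indicator (cbox a b) x *\<^sub>R axis i 1))"
    using sub by (auto simp: zero_ext_def inner_axis indicator_def fun_eq_iff)
  have "sq_integrable (\<lambda>x. indicator (cbox a b) x *\<^sub>R axis i (1::real) :: real^3)"
  proof -
    have "integrable lebesgue (indicator (cbox a b) :: real^3 \<Rightarrow> real)"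
      by (simp add: integrable_indicator_iff emeasure_lborel_cbox_eq)
    moreover have "(norm (indicator (cbox a b) x *\<^sub>R axis i (1::real) :: real^3))\<^sup>2 = indicator (cbox a b) x" for x :: "real^3"
      by (simp add: norm_axis_1 indicator_def)
    ultimately show ?thesis unfolding sq_integrable_def by simp
  qed
  then have g: "integrable lebesgue ?g" unfolding g_eq by (rule sq_integrable_inner[OF cutF])
  then show "set_integrable lebesgue (cbox a b) (\<lambda>x. F x $ i)" by (simp add: set_integrable_def)
  have bump_meas: "bump r a b \<in> borel_measurable lebesgue" for r
  proof -
    have "continuous_on UNIV (bump r a b)"
      using smooth_alg_pd(2)[OF smooth_alg_bump]
      by (auto intro!: continuous_at_imp_continuous_on differentiable_imp_continuous_within)
    then show ?thesis by (auto intro!: measurable_completion borel_measurable_continuous_onI)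
  qed
  have "(\<lambda>n. \<integral>x. bump (real (Suc n)) a b x * ?g x \<partial>lebesgue) \<longlonglongrightarrow> (\<integral>x. indicator (box a b) x * ?g x \<partial>lebesgue)"
  proof (rule integral_dominated_convergence[where w="\<lambda>x. \<bar>?g x\<bar>"])
    show "AE x in lebesgue. (\<lambda>n. bump (real (Suc n)) a b x * ?g x) \<longlonglongrightarrow> indicator (box a b) x * ?g x"
      by (intro AE_I2 tendsto_mult bump_tendsto_indicator tendsto_const)
    show "AE x in lebesgue. norm (bump (real (Suc n)) a b x * ?g x) \<le> \<bar>?g x\<bar>" for n
      using bump_bounds by (auto simp: abs_mult intro!: mult_left_le_one_le)
    show "(\<lambda>x. indicator (box a b) x * ?g x) \<in> borel_measurable lebesgue"
      using borel_measurable_integrable[OF g]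
      by (intro borel_measurable_times borel_measurable_indicator) simp_all
  qed (use g bump_meas in auto)
  moreover have "(\<integral>x. bump (real (Suc n)) a b x * ?g x \<partial>lebesgue) = 0" for n
  proof -
    have "bump (real (Suc n)) a b x * ?g x = inner (zero_ext G F x) (zero_ext G (\<lambda>x. bump (real (Suc n)) a b x *\<^sub>R axis i 1) x)" for x
      using sub bump_outside[of "real (Suc n)" x a b] box_subset_cbox[of a b]
      by (auto simp: zero_ext_def inner_axis indicator_def)
    then show ?thesis using zero[OF test_fun_bump[OF _ sub]] by (simp add: ip_zero_ext[OF G])
  qed
  ultimately have "(\<lambda>n. 0) \<longlonglongrightarrow> (\<integral>x. indicator (box a b) x * ?g x \<partial>lebesgue)"
    by (simp only:)
  then have "0 = (\<integral>x. indicator (box a b) x * ?g x \<partial>lebesgue)"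
    by (rule LIMSEQ_unique[OF tendsto_const])
  moreover have "indicator (box a b) x * ?g x = indicator (box a b) x *\<^sub>R F x $ i" for x
    using box_subset_cbox[of a b] by (auto simp: indicator_def)
  ultimately show "(\<integral>x\<in>box a b. F x $ i \<partial>lebesgue) = 0"
    unfolding set_lebesgue_integral_def by (simp only:)
qed

text \<open>The argument is local. An open set is a countable union of closed boxes, and on each one
  the field cut off to that box satisfies the criterion on box integrals.\<close>

lemma fundamental_lemma:
  assumes "open G" and F: "L2 G F" and zero: "\<And>\<phi>. test_fun G \<phi> \<Longrightarrow> ip G F \<phi> = 0"
  shows "AE x in lebesgue. zero_ext G F x = 0"
proof -
  have G: "G \<in> sets lebesgue" using \<open>open G\<close> by (simp add: borel_open)
  note * = fundamental_lemma_box[OF G F zero]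
  have box0: "(\<integral>x\<in>box a b. F x $ i \<partial>lebesgue) = 0" if "box a b = {} \<or> cbox a b \<subseteq> G" for a b i
    using that *(2) by (auto simp: set_lebesgue_integral_def)
  have cboxes: "AE x in lebesgue. x \<in> cbox a b \<longrightarrow> F x = 0" if sub: "cbox a b \<subseteq> G" for a b
  proof -
    have "AE x in lebesgue. indicator (cbox a b) x *\<^sub>R F x $ i = 0" for i
    proof (rule AE_zero_of_box_integrals)
      let ?g = "\<lambda>x. indicator (cbox a b) x *\<^sub>R F x $ i"
      show g: "integrable lebesgue ?g" using *(1)[OF _ sub] by (simp add: set_integrable_def)
      have meas: "(\<lambda>x. indicator S x * ?g x) \<in> borel_measurable lebesgue" if "open S" for S
        using borel_measurable_integrable[OF g] that
        by (intro borel_measurable_times borel_measurable_indicator) (simp_all add: borel_open)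
      have "AE x in lebesgue. x \<notin> cbox a b - box a b"
        by (intro AE_not_in) (metis negligible_iff_null_sets negligible_frontier_interval)
      then have AE: "AE x in lebesgue. x \<in> cbox a b \<longleftrightarrow> x \<in> box a b"
        using box_subset_cbox[of a b] by (auto elim!: eventually_mono)
      have int_box: "(\<integral>x\<in>box c d. ?g x \<partial>lebesgue) = (\<integral>x\<in>box a b \<inter> box c d. F x $ i \<partial>lebesgue)" for c d
      proof -
        have "indicator (box a b \<inter> box c d) x *\<^sub>R F x $ i = indicator (box a b \<inter> box c d) x * ?g x" for x
          using box_subset_cbox[of a b] by (auto simp: indicator_def)
        moreover have "(\<integral>x. indicator (box c d) x *\<^sub>R ?g x \<partial>lebesgue)
            = (\<integral>x. indicator (box a b \<inter> box c d) x * ?g x \<partial>lebesgue)"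
        proof (rule integral_cong_AE)
          show "AE x in lebesgue. indicator (box c d) x *\<^sub>R ?g x = indicator (box a b \<inter> box c d) x * ?g x"
            using AE by eventually_elim (auto simp: indicator_def)
          show "(\<lambda>x. indicator (box c d) x *\<^sub>R ?g x) \<in> borel_measurable lebesgue"
            using meas[OF open_box] by simp
          show "(\<lambda>x. indicator (box a b \<inter> box c d) x * ?g x) \<in> borel_measurable lebesgue"
            by (intro meas open_Int open_box)
        qed
        ultimately show ?thesis unfolding set_lebesgue_integral_def by (simp only:)
      qed
      show "(\<integral>x\<in>box c d. ?g x \<partial>lebesgue) = 0" for c d
      proof -
        \<comment> \<open>The intersection of two open boxes is an open box; if it is nonempty, its
          closure stays in \<open>cbox a b\<close> and thus in G, as \<open>box0\<close>
          demands.\<close>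
        obtain c' d' where cd: "box a b \<inter> box c d = box c' d'" using box_Int_box by blast
        have "cbox c' d' \<subseteq> G" if "box c' d' \<noteq> {}"
        proof -
          have "cbox c' d' = closure (box c' d')" using closure_box[OF that] by simp
          also have "\<dots> \<subseteq> cbox a b" using cd box_subset_cbox[of a b] by (intro closure_minimal) auto
          finally show ?thesis using sub by blast
        qed
        then show ?thesis unfolding int_box cd by (intro box0) blast
      qed
      have "(\<integral>x. ?g x \<partial>lebesgue) = (\<integral>x\<in>box a b. F x $ i \<partial>lebesgue)"
      proof -
        have "indicator (box a b) x *\<^sub>R F x $ i = indicator (box a b) x * ?g x" for x
          using box_subset_cbox[of a b] by (auto simp: indicator_def)
        moreover have "(\<integral>x. ?g x \<partial>lebesgue) = (\<integral>x. indicator (box a b) x * ?g x \<partial>lebesgue)"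
        proof (rule integral_cong_AE)
          show "AE x in lebesgue. ?g x = indicator (box a b) x * ?g x"
            using AE by eventually_elim (auto simp: indicator_def)
        qed (intro meas open_box borel_measurable_integrable[OF g])+
        ultimately show ?thesis unfolding set_lebesgue_integral_def by (simp only:)
      qed
      then show "(\<integral>x. ?g x \<partial>lebesgue) = 0" using box0 sub by simp
    qed
    then have "AE x in lebesgue. \<forall>i. indicator (cbox a b) x *\<^sub>R F x $ i = 0"
      by (rule eventually_all_finite)
    then show ?thesis by eventually_elim (auto simp: vec_eq_iff)
  qed
  obtain D where D: "countable D" "D \<subseteq> Pow G" "\<And>X. X \<in> D \<Longrightarrow> \<exists>a b. X = cbox a b" "\<Union>D = G"
    using open_countable_Union_open_cbox[OF \<open>open G\<close>] by metis
  have "AE x in lebesgue. \<forall>X\<in>D. x \<in> X \<longrightarrow> F x = 0"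
  proof (subst AE_ball_countable[OF D(1)], intro ballI)
    fix X assume "X \<in> D"
    then obtain a b where "X = cbox a b" "cbox a b \<subseteq> G" using D by blast
    then show "AE x in lebesgue. x \<in> X \<longrightarrow> F x = 0" using cboxes by simp
  qed
  then show ?thesis by eventually_elim (use D(4) in \<open>auto simp: zero_ext_def\<close>)
qed

section \<open>The graph of the weak curl\<close>

definition emb :: "(real^3) set \<Rightarrow> vfield \<Rightarrow> (real^3, real^3) l2" where
  "emb G F = abs_l2 (zero_ext G F)"

definition graph_emb :: "(real^3) set \<Rightarrow> vfield \<Rightarrow> (real^3, real^3) l2 \<times> (real^3, real^3) l2" where
  "graph_emb G F = (emb G F, emb G (wcurl G F))"

lemma zero_ext_lincomb:
  "zero_ext G (\<lambda>x. a *\<^sub>R F x + b *\<^sub>R H x) = (\<lambda>x. a *\<^sub>R zero_ext G F x + b *\<^sub>R zero_ext G H x)"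
  for F H :: "_ \<Rightarrow> 'b::real_vector"
  by (simp add: zero_ext_def fun_eq_iff)

section \<open>Fields on a measurable set as classes\<close>

context
  fixes G :: "(real^3) set"
  assumes G: "G \<in> sets lebesgue"
begin

lemma L2_lincomb: "L2 G F \<Longrightarrow> L2 G H \<Longrightarrow> L2 G (\<lambda>x. a *\<^sub>R F x + b *\<^sub>R H x)" for F H :: vfield
  unfolding L2_iff_zero_ext[OF G] zero_ext_lincomb
  by (intro sq_integrable_add sq_integrable_scaleR)

lemma emb_lincomb:
  assumes "L2 G F" "L2 G H"
  shows "emb G (\<lambda>x. a *\<^sub>R F x + b *\<^sub>R H x) = a *\<^sub>R emb G F + b *\<^sub>R emb G H"
  using assms unfolding emb_def L2_iff_zero_ext[OF G] zero_ext_lincomb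
  by (simp add: abs_l2_add abs_l2_scaleR sq_integrable_scaleR)

lemma L2_diff: "L2 G F \<Longrightarrow> L2 G H \<Longrightarrow> L2 G (\<lambda>x. F x - H x)" for F H :: vfield
  using L2_lincomb[of F H 1 "-1"] by simp

lemma emb_diff: "L2 G F \<Longrightarrow> L2 G H \<Longrightarrow> emb G (\<lambda>x. F x - H x) = emb G F - emb G H"
  using emb_lincomb[of F H 1 "-1"] by simp

lemma L2_add: "L2 G F \<Longrightarrow> L2 G H \<Longrightarrow> L2 G (\<lambda>x. F x + H x)" for F H :: vfield
  using L2_lincomb[of F H 1 1] by simp

lemma emb_add: "L2 G F \<Longrightarrow> L2 G H \<Longrightarrow> emb G (\<lambda>x. F x + H x) = emb G F + emb G H"
  using emb_lincomb[of F H 1 1] by simp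

lemma L2_scaleR: "L2 G F \<Longrightarrow> L2 G (\<lambda>x. a *\<^sub>R F x)" for F :: vfield
  using L2_lincomb[of F F a 0] by simp

lemma emb_scaleR: "L2 G F \<Longrightarrow> emb G (\<lambda>x. a *\<^sub>R F x) = a *\<^sub>R emb G F"
  using emb_lincomb[of F F a 0] by simp

lemma L2_zero: "L2 G (\<lambda>x. 0 :: real^3)"
  by (simp add: L2_def)

lemma emb_zero: "emb G (\<lambda>x. 0) = 0"
  using emb_scaleR[OF L2_zero, of 0] by simp

lemma ip_emb: "L2 G F \<Longrightarrow> L2 G H \<Longrightarrow> ip G F H = inner (emb G F) (emb G H)"
  by (simp add: ip_zero_ext[OF G] emb_def inner_abs_l2 L2_iff_zero_ext[OF G])

lemma nrm_emb: "L2 G F \<Longrightarrow> nrm G F = norm (emb G F)"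
  by (simp add: nrm_def ip_emb norm_eq_sqrt_inner)

lemma emb_eq_iff:
  "L2 G F \<Longrightarrow> L2 G H \<Longrightarrow> emb G F = emb G H \<longleftrightarrow> (AE x in lebesgue. zero_ext G F x = zero_ext G H x)"
  by (simp add: emb_def abs_l2_eq_iff L2_iff_zero_ext[OF G])

lemma L2_rep: "L2 G (rep_l2 g)"
proof -
  have "zero_ext G (rep_l2 g) = (\<lambda>x. indicator G x *\<^sub>R rep_l2 g x)" by (auto simp: zero_ext_def)
  then show ?thesis unfolding L2_iff_zero_ext[OF G]
    using sq_integrable_mult[OF rep_l2(1), of "indicator G" 1 g] G by (simp add: indicator_def)
qed

text \<open>Cutting a representative off outside G brings it no farther from fields that already
  vanish there. The purpose is \<open>emb_limit\<close>: the image of the fields on G is closed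
  under limits.\<close>

lemma dist_emb_rep_le:
  assumes F: "L2 G F"
  shows "dist (emb G F) (emb G (rep_l2 g)) \<le> dist (emb G F) g"
proof -
  have sq: "sq_integrable (zero_ext G F)" "sq_integrable (zero_ext G (rep_l2 g))"
    using F L2_rep L2_iff_zero_ext[OF G] by blast+
  have "(norm (emb G F - emb G (rep_l2 g)))\<^sup>2 = (\<integral>x. (norm (zero_ext G F x - zero_ext G (rep_l2 g) x))\<^sup>2 \<partial>lebesgue)"
    unfolding emb_def abs_l2_diff[OF sq] by (rule norm_abs_l2[OF sq_integrable_diff[OF sq]])
  also have "\<dots> \<le> (\<integral>x. (norm (zero_ext G F x - rep_l2 g x))\<^sup>2 \<partial>lebesgue)"
  proof (rule integral_mono)
    show "integrable lebesgue (\<lambda>x. (norm (zero_ext G F x - zero_ext G (rep_l2 g) x))\<^sup>2)"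
      "integrable lebesgue (\<lambda>x. (norm (zero_ext G F x - rep_l2 g x))\<^sup>2)"
      using sq_integrable_diff[OF sq] sq_integrable_diff[OF sq(1) rep_l2(1)] by (auto simp: sq_integrable_def)
  qed (simp add: zero_ext_def)
  also have "\<dots> = (norm (emb G F - g))\<^sup>2"
    using norm_abs_l2[OF sq_integrable_diff[OF sq(1) rep_l2(1)]] abs_l2_diff[OF sq(1) rep_l2(1)]
    by (simp add: emb_def rep_l2)
  finally show ?thesis unfolding dist_norm by (rule power2_le_imp_le) simp
qed

lemma emb_limit:
  assumes F: "\<And>n. L2 G (F n)" and lim: "(\<lambda>n. emb G (F n)) \<longlonglongrightarrow> g"
  shows "emb G (rep_l2 g) = g"
proof -
  have "(\<lambda>n. dist (emb G (F n)) g) \<longlonglongrightarrow> 0" using lim by (rule tendsto_dist_iff[THEN iffD1])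
  then have "(\<lambda>n. dist (emb G (F n)) (emb G (rep_l2 g))) \<longlonglongrightarrow> 0"
    by (rule Lim_null_comparison[rotated]) (simp add: dist_emb_rep_le[OF F])
  then have "(\<lambda>n. emb G (F n)) \<longlonglongrightarrow> emb G (rep_l2 g)" by (rule tendsto_dist_iff[THEN iffD2])
  then show ?thesis using lim LIMSEQ_unique by blast
qed

text \<open>The nontrivial inclusion needs a field behind each limit class. Its representative
  serves: restricted to G it still has the same class, by \<open>emb_limit\<close>.\<close>

lemma closure_emb_Uhad: "closure (\<Union>k. emb G ` Uhad G (\<T> k)) = emb G ` Uinfad G \<T>"
proof (intro equalityI subsetI)
  have Uhad_L2: "L2 G w" if "w \<in> Uhad G T" for w T using that by (simp add: Uhad_def Uh_def)
  fix g assume g: "g \<in> closure (\<Union>k. emb G ` Uhad G (\<T> k))"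
  then obtain X where X: "\<And>n. X n \<in> (\<Union>k. emb G ` Uhad G (\<T> k))" "X \<longlonglongrightarrow> g"
    unfolding closure_sequential by blast
  then have "\<forall>n. \<exists>F. L2 G F \<and> X n = emb G F" using Uhad_L2 by blast
  then obtain F where F: "\<And>n. L2 G (F n)" "\<And>n. X n = emb G (F n)" by metis
  have "X = (\<lambda>n. emb G (F n))" using F(2) by blast
  then have eq: "emb G (rep_l2 g) = g" using emb_limit[of F, OF F(1)] X(2) by simp
  have "rep_l2 g \<in> Uinfad G \<T>"
    unfolding Uinfad_def
  proof (intro CollectI conjI allI impI L2_rep)
    fix e :: real assume "0 < e"
    then obtain k w where w: "w \<in> Uhad G (\<T> k)" "dist (emb G w) g < e"
      using g unfolding closure_approachable by blast
    then have "nrm G (\<lambda>x. rep_l2 g x - w x) < e"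
      using Uhad_L2 by (simp add: nrm_emb L2_diff emb_diff L2_rep eq dist_norm norm_minus_commute)
    then show "\<exists>k. \<exists>w\<in>Uhad G (\<T> k). nrm G (\<lambda>x. rep_l2 g x - w x) < e" using w(1) by blast
  qed
  then show "g \<in> emb G ` Uinfad G \<T>" using eq by (metis imageI)
next
  fix g assume "g \<in> emb G ` Uinfad G \<T>"
  then obtain F where F: "g = emb G F" "L2 G F"
    "\<And>e. 0 < e \<Longrightarrow> \<exists>k. \<exists>w\<in>Uhad G (\<T> k). nrm G (\<lambda>x. F x - w x) < e"
    unfolding Uinfad_def by blast
  show "g \<in> closure (\<Union>k. emb G ` Uhad G (\<T> k))"
    unfolding closure_approachable
  proof (intro allI impI)
    fix e :: real assume "0 < e"
    then obtain k w where w: "w \<in> Uhad G (\<T> k)" "nrm G (\<lambda>x. F x - w x) < e" using F(3) by blast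
    have "L2 G w" using w(1) by (simp add: Uhad_def Uh_def)
    then have "dist (emb G w) g < e"
      using w(2) F by (simp add: nrm_emb L2_diff emb_diff dist_norm norm_minus_commute)
    then show "\<exists>y\<in>\<Union>k. emb G ` Uhad G (\<T> k). dist y g < e" using w(1) by blast
  qed
qed

lemma convex_emb_Uhad: "convex (emb G ` Uhad G T)"
proof (rule convexI)
  fix x z and a b :: real
  assume "x \<in> emb G ` Uhad G T" "z \<in> emb G ` Uhad G T" and ab: "0 \<le> a" "0 \<le> b" "a + b = 1"
  then obtain U W where UW: "x = emb G U" "z = emb G W" "U \<in> Uhad G T" "W \<in> Uhad G T" by blast
  then have L2: "L2 G U" "L2 G W" by (auto simp: Uhad_def Uh_def)
  have "(\<lambda>x. a *\<^sub>R U x + b *\<^sub>R W x) \<in> Uhad G T"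
    unfolding Uhad_def
  proof
    show "(\<lambda>x. a *\<^sub>R U x + b *\<^sub>R W x) \<in> Uh G T"
      using UW(3,4) L2_lincomb[OF L2] unfolding Uhad_def Uh_def by (auto, metis)
    have "AE x in lebesgue_on G. \<forall>i. 0 \<le> U x $ i" "AE x in lebesgue_on G. \<forall>i. 0 \<le> W x $ i"
      using UW(3,4) by (auto simp: Uhad_def Uad_def)
    then have "AE x in lebesgue_on G. \<forall>i. 0 \<le> (a *\<^sub>R U x + b *\<^sub>R W x) $ i"
      by eventually_elim (simp add: ab)
    then show "(\<lambda>x. a *\<^sub>R U x + b *\<^sub>R W x) \<in> Uad G" unfolding Uad_def using L2_lincomb[OF L2] by simp
  qed
  then show "a *\<^sub>R x + b *\<^sub>R z \<in> emb G ` Uhad G T"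
    unfolding UW(1,2) emb_lincomb[OF L2, symmetric] by blast
qed

lemma zero_in_emb_Uhad: "0 \<in> emb G ` Uhad G T"
proof -
  have "(\<lambda>x. 0) \<in> Uhad G T" by (auto simp: Uhad_def Uh_def Uad_def L2_zero)
  then show ?thesis using emb_zero by (metis imageI)
qed

end

section \<open>Test fields and the weak curl operator\<close>

lemma sq_integrable_compact_support:
  fixes F :: "'a::euclidean_space \<Rightarrow> 'b::euclidean_space"
  assumes cont: "continuous_on UNIV F" and K: "compact K" "\<And>x. x \<notin> K \<Longrightarrow> F x = 0"
  shows "sq_integrable F"
proof -
  have meas: "F \<in> borel_measurable lebesgue"
    using cont by (auto intro!: measurable_completion borel_measurable_continuous_onI)
  have "compact (F ` K)" using cont K(1) by (blast intro: compact_continuous_image continuous_on_subset)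
  then obtain M where M: "\<And>x. x \<in> K \<Longrightarrow> norm (F x) \<le> M"
    using compact_imp_bounded[of "F ` K"] unfolding bounded_iff by blast
  have "integrable lebesgue (\<lambda>x. (norm (F x))\<^sup>2)"
  proof (rule Bochner_Integration.integrable_bound)
    have "K \<in> lmeasurable" using K(1) by (rule lmeasurable_compact)
    then show "integrable lebesgue (\<lambda>x. M\<^sup>2 * indicator K x :: real)"
      unfolding lmeasurable_iff_integrable by (rule integrable_mult_right)
    show "(\<lambda>x. (norm (F x))\<^sup>2) \<in> borel_measurable lebesgue" using meas by measurable
    show "AE x in lebesgue. norm ((norm (F x))\<^sup>2) \<le> norm (M\<^sup>2 * indicator K x)"
      using M K(2) by (intro AE_I2) (auto simp: indicator_def power_mono)
  qed
  then show ?thesis using meas by (simp add: sq_integrable_def)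
qed

text \<open>A sum of scalars times fixed vectors, so that continuity and vanishing can be read off
  from the partial derivatives.\<close>

lemma ccurl_axis:
  "ccurl F x = (pd 2 F x $ 3 - pd 3 F x $ 2) *\<^sub>R axis 1 1 + (pd 3 F x $ 1 - pd 1 F x $ 3) *\<^sub>R axis 2 1
    + (pd 1 F x $ 2 - pd 2 F x $ 1) *\<^sub>R axis 3 1"
  unfolding ccurl_def vec_eq_iff forall_3 by (simp add: vector_3 axis_def)

lemma L2_test_fun:
  fixes \<phi> :: vfield
  assumes "test_fun G \<phi>" "G \<in> sets lebesgue"
  shows "L2 G \<phi>" "L2 G (ccurl \<phi>)"
proof -
  obtain K where K: "compact K" "K \<subseteq> G" "\<And>x. x \<notin> K \<Longrightarrow> \<phi> x = 0" and sm: "smooth3 \<phi>"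
    using assms(1) unfolding test_fun_def by blast
  have cont: "continuous_on UNIV (dit js \<phi>)" for js
    using sm unfolding smooth3_def
    by (auto intro!: continuous_at_imp_continuous_on differentiable_imp_continuous_within)
  have pd0: "pd j \<phi> x = 0" if "x \<notin> K" for x j
  proof -
    have "open (- K)" using K(1) compact_imp_closed by blast
    moreover have "((\<lambda>x. 0) has_derivative (\<lambda>h. 0)) (at x)" by simp
    ultimately have "(\<phi> has_derivative (\<lambda>h. 0)) (at x)"
      using that K(3) has_derivative_transform_within_open[of "\<lambda>x. 0" "\<lambda>h. 0" x UNIV "- K" \<phi>] by simp
    then show ?thesis by (rule pd_eqI)
  qed
  have curl0: "ccurl \<phi> x = 0" if "x \<notin> K" for x using pd0[OF that] by (simp add: ccurl_axis)
  have "zero_ext G \<phi> x = \<phi> x" "zero_ext G (ccurl \<phi>) x = ccurl \<phi> x" for x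
    using K(2) K(3)[of x] curl0[of x] by (auto simp: zero_ext_def)
  then have "zero_ext G \<phi> = \<phi>" "zero_ext G (ccurl \<phi>) = ccurl \<phi>" by blast+
  moreover have "sq_integrable \<phi>"
    using cont[of "[]"] K by (intro sq_integrable_compact_support[of _ K]) auto
  moreover have "sq_integrable (ccurl \<phi>)"
  proof (rule sq_integrable_compact_support[OF _ K(1)])
    have pd: "continuous_on UNIV (pd j \<phi>)" for j using cont[of "[j]"] by simp
    show "continuous_on UNIV (ccurl \<phi>)" unfolding ccurl_axis[abs_def]
      by (intro continuous_intros bounded_linear.continuous_on[OF bounded_linear_vec_nth] pd)
    show "ccurl \<phi> x = 0" if "x \<notin> K" for x using curl0[OF that] .
  qed
  ultimately show "L2 G \<phi>" "L2 G (ccurl \<phi>)" by (simp_all add: L2_iff_zero_ext[OF assms(2)])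
qed

lemma wcurl_L2:
  assumes "F \<in> Hcurl G"
  shows "L2 G F" "L2 G (wcurl G F)" "is_wcurl G F (wcurl G F)"
proof -
  have ex: "\<exists>C. L2 G C \<and> is_wcurl G F C" and "L2 G F" using assms by (auto simp: Hcurl_def)
  then show "L2 G F" "L2 G (wcurl G F)" "is_wcurl G F (wcurl G F)"
    using someI_ex[OF ex] unfolding wcurl_def by auto
qed

context
  fixes G :: "(real^3) set"
  assumes G_open: "open G"
begin

lemma lebesgue_of_open: "G \<in> sets lebesgue"
  using G_open by (simp add: borel_open)

lemma is_wcurl_iff:
  assumes "L2 G F" "L2 G C"
  shows "is_wcurl G F C \<longleftrightarrow> (\<forall>\<phi>. test_fun G \<phi> \<longrightarrow> inner (emb G F) (emb G (ccurl \<phi>)) = inner (emb G C) (emb G \<phi>))"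
  unfolding is_wcurl_def using assms L2_test_fun[OF _ lebesgue_of_open] by (auto simp: ip_emb[OF lebesgue_of_open])

text \<open>The difference of two weak curls annihilates every test field, hence is null. Any
  convenient weak curl may therefore replace the chosen \<open>wcurl\<close> after passing to
  classes.\<close>

lemma wcurl_eqI:
  assumes F: "L2 G F" and C: "L2 G C" and curl: "is_wcurl G F C"
  shows "F \<in> Hcurl G" "graph_emb G F = (emb G F, emb G C)"
proof -
  show F_Hcurl: "F \<in> Hcurl G" using assms by (auto simp: Hcurl_def)
  note W = wcurl_L2[OF F_Hcurl]
  have "AE x in lebesgue. zero_ext G (\<lambda>x. wcurl G F x - C x) x = 0"
  proof (rule fundamental_lemma[OF G_open L2_diff[OF lebesgue_of_open W(2) C]])
    fix \<phi> :: vfield assume \<phi>: "test_fun G \<phi>"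
    have "inner (emb G (wcurl G F)) (emb G \<phi>) = inner (emb G C) (emb G \<phi>)"
      using \<phi> curl W(3) is_wcurl_iff[OF F] W(2) C by auto
    then show "ip G (\<lambda>x. wcurl G F x - C x) \<phi> = 0"
      using L2_test_fun[OF \<phi> lebesgue_of_open] W(2) C
      by (simp add: ip_emb[OF lebesgue_of_open] L2_diff[OF lebesgue_of_open] emb_diff[OF lebesgue_of_open] inner_diff_left)
  qed
  then have "AE x in lebesgue. zero_ext G (wcurl G F) x = zero_ext G C x"
    by eventually_elim (auto simp: zero_ext_def split: if_splits)
  then show "graph_emb G F = (emb G F, emb G C)"
    using emb_eq_iff[OF lebesgue_of_open W(2) C] by (simp add: graph_emb_def)
qed

text \<open>The chosen curl of a combination need not be the combination of the chosen curls as a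
  function. Their classes agree, which is why linearity is stated for graphs.\<close>

lemma Hcurl_lincomb:
  assumes F: "F \<in> Hcurl G" and H: "H \<in> Hcurl G"
  shows "(\<lambda>x. a *\<^sub>R F x + b *\<^sub>R H x) \<in> Hcurl G"
    "graph_emb G (\<lambda>x. a *\<^sub>R F x + b *\<^sub>R H x) = a *\<^sub>R graph_emb G F + b *\<^sub>R graph_emb G H"
proof -
  note F' = wcurl_L2[OF F] and H' = wcurl_L2[OF H]
  have L2: "L2 G (\<lambda>x. a *\<^sub>R F x + b *\<^sub>R H x)" "L2 G (\<lambda>x. a *\<^sub>R wcurl G F x + b *\<^sub>R wcurl G H x)"
    using F' H' L2_lincomb[OF lebesgue_of_open] by auto
  have "is_wcurl G (\<lambda>x. a *\<^sub>R F x + b *\<^sub>R H x) (\<lambda>x. a *\<^sub>R wcurl G F x + b *\<^sub>R wcurl G H x)"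
    unfolding is_wcurl_iff[OF L2] emb_lincomb[OF lebesgue_of_open F'(1) H'(1)] emb_lincomb[OF lebesgue_of_open F'(2) H'(2)]
    using F'(3) H'(3) unfolding is_wcurl_iff[OF F'(1,2)] is_wcurl_iff[OF H'(1,2)]
    by (simp add: inner_add_left)
  note * = wcurl_eqI[OF L2 this]
  show "(\<lambda>x. a *\<^sub>R F x + b *\<^sub>R H x) \<in> Hcurl G" by (rule *)
  show "graph_emb G (\<lambda>x. a *\<^sub>R F x + b *\<^sub>R H x) = a *\<^sub>R graph_emb G F + b *\<^sub>R graph_emb G H"
    unfolding *(2) emb_lincomb[OF lebesgue_of_open F'(1) H'(1)] emb_lincomb[OF lebesgue_of_open F'(2) H'(2)]
    by (simp add: graph_emb_def)
qed

lemma Hcurl_diff: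
  assumes "F \<in> Hcurl G" "H \<in> Hcurl G"
  shows "(\<lambda>x. F x - H x) \<in> Hcurl G" "graph_emb G (\<lambda>x. F x - H x) = graph_emb G F - graph_emb G H"
  using Hcurl_lincomb[OF assms, of 1 "-1"] by simp_all

lemma nrm_curl_graph_emb:
  assumes "F \<in> Hcurl G"
  shows "nrm_curl G F = norm (graph_emb G F)"
  unfolding nrm_curl_def graph_emb_def norm_Pair
  using wcurl_L2[OF assms] by (simp add: nrm_emb[OF lebesgue_of_open])

lemma Hcurl0_iff:
  "F \<in> Hcurl0 G \<longleftrightarrow> F \<in> Hcurl G \<and>
    (\<forall>W\<in>Hcurl G. inner (snd (graph_emb G F)) (fst (graph_emb G W)) = inner (fst (graph_emb G F)) (snd (graph_emb G W)))"
  unfolding Hcurl0_def graph_emb_def using wcurl_L2 by (auto simp: ip_emb[OF lebesgue_of_open])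

lemma Vh_Hcurl: "v \<in> Vh G T \<Longrightarrow> v \<in> Hcurl G"
  by (simp add: Vh_def Hcurl0_def)

lemma Vh_lincomb:
  assumes v: "v \<in> Vh G T" and w: "w \<in> Vh G T"
  shows "(\<lambda>x. s *\<^sub>R v x + t *\<^sub>R w x) \<in> Vh G T"
proof -
  note * = Hcurl_lincomb[OF Vh_Hcurl[OF v] Vh_Hcurl[OF w], of s t]
  have "v \<in> Hcurl0 G" "w \<in> Hcurl0 G" using v w by (auto simp: Vh_def)
  then have "(\<lambda>x. s *\<^sub>R v x + t *\<^sub>R w x) \<in> Hcurl0 G"
    unfolding Hcurl0_iff *(2) using *(1) by (auto simp: inner_add_left)
  moreover have "\<exists>a b. \<forall>x\<in>interior (convex hull S). s *\<^sub>R v x + t *\<^sub>R w x = cross3 a x + b" if S: "S \<in> T" for S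
  proof -
    obtain a b a' b' where
      "\<forall>x\<in>interior (convex hull S). v x = cross3 a x + b" "\<forall>x\<in>interior (convex hull S). w x = cross3 a' x + b'"
      using v w S unfolding Vh_def by blast
    then show ?thesis
      by (intro exI[of _ "s *\<^sub>R a + t *\<^sub>R a'"] exI[of _ "s *\<^sub>R b + t *\<^sub>R b'"])
        (simp add: cross_add_left cross_mult_left algebra_simps)
  qed
  ultimately show ?thesis by (simp add: Vh_def)
qed

lemma subspace_graph_emb_Vh: "subspace (graph_emb G ` Vh G T)"
proof -
  have "is_wcurl G (\<lambda>x. 0) (\<lambda>x. 0)" by (simp add: is_wcurl_def ip_def)
  note zero = wcurl_eqI[OF L2_zero L2_zero this, OF lebesgue_of_open lebesgue_of_open]
  have zero_Vh: "(\<lambda>x. 0) \<in> Vh G T" unfolding Vh_def Hcurl0_iff using zero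
    by (auto simp: emb_zero[OF lebesgue_of_open] intro!: exI[of _ 0])
  show ?thesis unfolding subspace_def
  proof (intro conjI ballI allI)
    show "0 \<in> graph_emb G ` Vh G T"
      using zero_Vh zero(2) by (auto simp: emb_zero[OF lebesgue_of_open] image_iff zero_prod_def intro!: bexI[of _ "\<lambda>x. 0"])
    fix x z assume "x \<in> graph_emb G ` Vh G T"
    then obtain v where v: "x = graph_emb G v" "v \<in> Vh G T" by blast
    show "c *\<^sub>R x \<in> graph_emb G ` Vh G T" for c
      using Vh_lincomb[OF v(2) v(2), of c 0] Hcurl_lincomb(2)[of v v c 0] Vh_Hcurl[OF v(2)] v(1)
      by (auto simp: image_iff intro!: bexI[of _ "\<lambda>x. c *\<^sub>R v x"])
    assume "z \<in> graph_emb G ` Vh G T"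
    then obtain w where w: "z = graph_emb G w" "w \<in> Vh G T" by blast
    show "x + z \<in> graph_emb G ` Vh G T"
      using Vh_lincomb[OF v(2) w(2), of 1 1] Hcurl_lincomb(2)[of v w 1 1] Vh_Hcurl[OF v(2)] Vh_Hcurl[OF w(2)] v(1) w(1)
      by (auto simp: image_iff intro!: bexI[of _ "\<lambda>x. v x + w x"])
  qed
qed

text \<open>The weak curl is a closed operator: for a fixed test field, both sides of its defining
  identity are continuous in the pair of classes, so a limit of graph points is again a graph
  point.\<close>

lemma closure_graph_emb_Vh: "closure (\<Union>k. graph_emb G ` Vh G (\<T> k)) = graph_emb G ` Vinf G \<T>"
proof (intro equalityI subsetI)
  fix g assume g: "g \<in> closure (\<Union>k. graph_emb G ` Vh G (\<T> k))"
  then obtain X where X: "\<And>n. X n \<in> (\<Union>k. graph_emb G ` Vh G (\<T> k))" "X \<longlonglongrightarrow> g"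
    unfolding closure_sequential by blast
  then have "\<forall>n. \<exists>F. F \<in> Hcurl G \<and> X n = graph_emb G F" using Vh_Hcurl by blast
  then obtain F where F: "\<And>n. F n \<in> Hcurl G" "\<And>n. X n = graph_emb G (F n)" by metis
  have lim: "(\<lambda>n. emb G (F n)) \<longlonglongrightarrow> fst g" "(\<lambda>n. emb G (wcurl G (F n))) \<longlonglongrightarrow> snd g"
    using tendsto_fst[OF X(2)] tendsto_snd[OF X(2)] by (simp_all add: F(2) graph_emb_def)
  let ?f = "rep_l2 (fst g)" and ?c = "rep_l2 (snd g)"
  have L2: "L2 G ?f" "L2 G ?c" by (rule L2_rep[OF lebesgue_of_open])+
  have eq: "emb G ?f = fst g" "emb G ?c = snd g"
    using emb_limit[OF lebesgue_of_open wcurl_L2(1)[OF F(1)] lim(1)]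
      emb_limit[OF lebesgue_of_open wcurl_L2(2)[OF F(1)] lim(2)] by auto
  have "is_wcurl G ?f ?c"
    unfolding is_wcurl_iff[OF L2] eq
  proof (intro allI impI)
    fix \<phi> :: vfield assume \<phi>: "test_fun G \<phi>"
    have "inner (emb G (F n)) (emb G (ccurl \<phi>)) = inner (emb G (wcurl G (F n))) (emb G \<phi>)" for n
      using wcurl_L2[OF F(1)] \<phi> is_wcurl_iff by blast
    moreover have "(\<lambda>n. inner (emb G (F n)) (emb G (ccurl \<phi>))) \<longlonglongrightarrow> inner (fst g) (emb G (ccurl \<phi>))"
      "(\<lambda>n. inner (emb G (wcurl G (F n))) (emb G \<phi>)) \<longlonglongrightarrow> inner (snd g) (emb G \<phi>)"
      by (intro tendsto_inner tendsto_const lim)+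
    ultimately show "inner (fst g) (emb G (ccurl \<phi>)) = inner (snd g) (emb G \<phi>)"
      using LIMSEQ_unique by simp
  qed
  note f = wcurl_eqI[OF L2 this, unfolded eq prod.collapse]
  have "?f \<in> Vinf G \<T>"
    unfolding Vinf_def
  proof (intro CollectI conjI allI impI f)
    fix e :: real assume "0 < e"
    then obtain k w where w: "w \<in> Vh G (\<T> k)" "dist (graph_emb G w) g < e"
      using g unfolding closure_approachable by blast
    then have "nrm_curl G (\<lambda>x. ?f x - w x) < e"
      using Hcurl_diff[OF f(1) Vh_Hcurl[OF w(1)]]
      by (simp add: nrm_curl_graph_emb f(2) dist_norm norm_minus_commute)
    then show "\<exists>k. \<exists>w\<in>Vh G (\<T> k). nrm_curl G (\<lambda>x. ?f x - w x) < e" using w(1) by blast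
  qed
  then show "g \<in> graph_emb G ` Vinf G \<T>" using f(2) by (metis imageI)
next
  fix g assume "g \<in> graph_emb G ` Vinf G \<T>"
  then obtain F where F: "g = graph_emb G F" "F \<in> Hcurl G"
    "\<And>e. 0 < e \<Longrightarrow> \<exists>k. \<exists>w\<in>Vh G (\<T> k). nrm_curl G (\<lambda>x. F x - w x) < e"
    unfolding Vinf_def by blast
  show "g \<in> closure (\<Union>k. graph_emb G ` Vh G (\<T> k))"
    unfolding closure_approachable
  proof (intro allI impI)
    fix e :: real assume "0 < e"
    then obtain k w where w: "w \<in> Vh G (\<T> k)" "nrm_curl G (\<lambda>x. F x - w x) < e" using F(3) by blast
    then have "dist (graph_emb G w) g < e"
      using Hcurl_diff[OF F(2) Vh_Hcurl[OF w(1)]] F(1)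
      by (simp add: nrm_curl_graph_emb dist_norm norm_minus_commute)
    then show "\<exists>y\<in>\<Union>k. graph_emb G ` Vh G (\<T> k). dist y g < e" using w(1) by blast
  qed
qed

end

section \<open>Meshes, element means and coefficients\<close>

text \<open>A Lipschitz domain has no slits. At a boundary point it lies below a graph in local
  coordinates, so the points just above form an open set missing the domain, hence missing its
  closure. The mesh fills the closure of the domain, and this places the open cells in the domain
  itself.\<close>

lemma interior_closure_lipschitz_domain:
  assumes "lipschitz_domain G"
  shows "interior (closure G) \<subseteq> G"
proof
  fix x assume x: "x \<in> interior (closure G)"
  show "x \<in> G"
  proof (rule ccontr)
    assume "x \<notin> G"
    have "open G" using assms by (simp add: lipschitz_domain_def)
    then have "x \<in> frontier G"
      using x \<open>x \<notin> G\<close> interior_subset[of "closure G"] by (auto simp: frontier_def interior_open)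
    then obtain r L and Q :: "real^3 \<Rightarrow> real^3" and g :: "real \<times> real \<Rightarrow> real"
      where r: "0 < r" and Q: "orthogonal_transformation Q" and g: "L-lipschitz_on UNIV g"
      and chart: "G \<inter> ball x r = {z \<in> ball x r. Q (z - x) $ 3 < g (Q (z - x) $ 1, Q (z - x) $ 2)}"
      using assms unfolding lipschitz_domain_def by meson
    have lin: "linear Q" using Q by (rule orthogonal_transformation_linear)
    have "g (0, 0) \<le> 0"
    proof -
      have "x \<notin> {z \<in> ball x r. Q (z - x) $ 3 < g (Q (z - x) $ 1, Q (z - x) $ 2)}"
        using \<open>x \<notin> G\<close> chart by blast
      then show ?thesis using r by (simp add: linear_0[OF lin])
    qed
    obtain e where e: "0 < e" "ball x e \<subseteq> closure G" using x by (auto simp: mem_interior)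
    obtain v where v: "Q v = axis 3 1" using orthogonal_transformation_surj[OF Q] by (metis surjD)
    have "norm v = 1" using orthogonal_transformation_norm[OF Q, of v] v by (simp add: norm_axis_1)
    define s where "s = min e r / 2"
    have s: "0 < s" "s < e" "s < r" using e r by (auto simp: s_def)
    define S where "S = ball x r \<inter> {z. g (Q (z - x) $ 1, Q (z - x) $ 2) < Q (z - x) $ 3}"
    have cont: "continuous_on UNIV (\<lambda>z. Q (z - x) $ i)" for i
      by (intro bounded_linear.continuous_on[OF bounded_linear_vec_nth] linear_continuous_on_compose[OF _ lin] continuous_intros)
    have "open S" unfolding S_def
      by (intro open_Int open_ball open_Collect_less cont
          continuous_on_compose2[OF lipschitz_on_continuous_on[OF g]] continuous_on_Pair) auto
    moreover have "S \<inter> G = {}"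
    proof -
      have "S \<inter> G = S \<inter> (G \<inter> ball x r)" by (auto simp: S_def)
      also have "\<dots> = {}" unfolding chart by (auto simp: S_def)
      finally show ?thesis .
    qed
    ultimately have "S \<inter> closure G = {}" using open_Int_closure_eq_empty by blast
    moreover have "x + s *\<^sub>R v \<in> S"
      using s \<open>g (0, 0) \<le> 0\<close> \<open>norm v = 1\<close> v
      by (auto simp: S_def dist_norm linear_scale[OF lin] axis_def)
    moreover have "x + s *\<^sub>R v \<in> ball x e" using s \<open>norm v = 1\<close> by (auto simp: dist_norm)
    ultimately show False using e(2) by blast
  qed
qed

lemma sq_integrable_imp_integrable_on:
  assumes F: "sq_integrable F" and S: "S \<in> lmeasurable"
  shows "integrable lebesgue (\<lambda>x. indicator S x *\<^sub>R F x)"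
proof (rule Bochner_Integration.integrable_bound)
  have iS: "integrable lebesgue (indicator S :: _ \<Rightarrow> real)" using S lmeasurable_iff_integrable by blast
  then show "integrable lebesgue (\<lambda>x. indicator S x + (norm (F x))\<^sup>2)"
    using F by (auto simp: sq_integrable_def)
  show "(\<lambda>x. indicator S x *\<^sub>R F x) \<in> borel_measurable lebesgue"
    using borel_measurable_integrable[OF iS] sq_integrable_measurable[OF F] by (rule borel_measurable_scaleR)
  have "t \<le> 1 + t\<^sup>2" for t :: real using sum_squares_bound[of 1 t] zero_le_power2[of t] by (simp only: mult_1_right power_one)
  then show "AE x in lebesgue. norm (indicator S x *\<^sub>R F x) \<le> norm (indicator S x + (norm (F x))\<^sup>2)"
    by (intro AE_I2) (auto simp: indicator_def)
qed

lemma sq_integrable_indicator: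
  assumes "S \<in> lmeasurable"
  shows "sq_integrable (\<lambda>x. indicator S x *\<^sub>R c)"
proof -
  have iS: "integrable lebesgue (indicator S :: _ \<Rightarrow> real)" using assms lmeasurable_iff_integrable by blast
  have "(norm (indicator S x *\<^sub>R c))\<^sup>2 = (norm c)\<^sup>2 * indicator S x" for x by (simp add: indicator_def)
  then show ?thesis unfolding sq_integrable_def
    using iS borel_measurable_integrable[OF iS] by (auto intro!: borel_measurable_scaleR)
qed

lemma sq_integrable_sum:
  "(\<And>i. i \<in> I \<Longrightarrow> sq_integrable (f i)) \<Longrightarrow> sq_integrable (\<lambda>x. \<Sum>i\<in>I. f i x)"
  by (induction I rule: infinite_finite_induct) (auto intro: sq_integrable_add simp: sq_integrable_zero)

lemma abs_l2_sum:
  "(\<And>i. i \<in> I \<Longrightarrow> sq_integrable (f i)) \<Longrightarrow> abs_l2 (\<lambda>x. \<Sum>i\<in>I. f i x) = (\<Sum>i\<in>I. abs_l2 (f i))"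
  by (induction I rule: infinite_finite_induct)
    (auto simp: zero_l2.abs_eq abs_l2_add[symmetric] sq_integrable_sum)

section \<open>Cells of one mesh, elementwise means and coefficients\<close>

locale mesh_domain =
  fixes \<Omega> :: "(real^3) set" and \<T> :: "(real^3) set set"
  assumes dom: "lipschitz_domain \<Omega>" and mesh: "conforming_mesh \<Omega> \<T>"
begin

definition cell :: "(real^3) set \<Rightarrow> (real^3) set" where "cell T = interior (convex hull T)"

lemma open_dom: "open \<Omega>"
  using dom by (simp add: lipschitz_domain_def)

lemma lebesgue_dom: "\<Omega> \<in> sets lebesgue"
  using lebesgue_of_open[OF open_dom] .

lemma finite_mesh: "finite \<T>"
  using mesh by (simp add: conforming_mesh_def)

lemma compact_hull: "T \<in> \<T> \<Longrightarrow> compact (convex hull T)"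
  using mesh by (auto simp: conforming_mesh_def intro!: finite_imp_compact_convex_hull card_ge_0_finite)

lemma cell_subset: "T \<in> \<T> \<Longrightarrow> cell T \<subseteq> \<Omega>"
proof -
  assume "T \<in> \<T>"
  then have "convex hull T \<subseteq> closure \<Omega>" using mesh unfolding conforming_mesh_def by blast
  then show ?thesis unfolding cell_def
    using interior_mono interior_closure_lipschitz_domain[OF dom] by blast
qed

text \<open>Distinct elements share at most three vertices, and the hull of three points has empty
  interior in R^3. This makes the choice of element in \<open>Ph\<close> unambiguous.\<close>

lemma cell_unique:
  assumes T: "T \<in> \<T>" "S \<in> \<T>" and x: "x \<in> cell T" "x \<in> cell S"
  shows "T = S"
proof (rule ccontr)
  assume "T \<noteq> S"
  have card: "card T = 4" "card S = 4" using T mesh by (auto simp: conforming_mesh_def)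
  have "finite T" using card(1) card.infinite by fastforce
  have "card (T \<inter> S) < 4"
  proof (rule ccontr)
    assume "\<not> card (T \<inter> S) < 4"
    then have "card T \<le> card (T \<inter> S)" "card S \<le> card (T \<inter> S)" using card by auto
    moreover have "finite S" using card(2) card.infinite by fastforce
    ultimately have "T \<inter> S = T" "T \<inter> S = S"
      using \<open>finite T\<close> card_seteq[of T "T \<inter> S"] card_seteq[of S "T \<inter> S"] by blast+
    then show False using \<open>T \<noteq> S\<close> by blast
  qed
  then have "interior (convex hull (T \<inter> S)) = {}"
    using \<open>finite T\<close> by (intro empty_interior_convex_hull) auto
  moreover have "convex hull T \<inter> convex hull S = convex hull (T \<inter> S)"
    using T mesh by (auto simp: conforming_mesh_def)
  ultimately have "cell T \<inter> cell S = {}" unfolding cell_def by (metis interior_Int)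
  then show False using x by blast
qed

lemma AE_hull_cell: "AE x in lebesgue. x \<in> convex hull T \<longrightarrow> x \<in> cell T"
proof -
  have "AE x in lebesgue. x \<notin> frontier (convex hull T)"
    using negligible_convex_frontier[of "convex hull T"]
    by (intro AE_not_in) (simp add: negligible_iff_null_sets)
  then show ?thesis
    by eventually_elim (use closure_subset[of "convex hull T"] in \<open>auto simp: frontier_def cell_def\<close>)
qed

lemma AE_cells: "AE x in lebesgue. x \<in> \<Omega> \<longrightarrow> x \<in> (\<Union>T\<in>\<T>. cell T)"
proof -
  have "AE x in lebesgue. \<forall>T\<in>\<T>. x \<in> convex hull T \<longrightarrow> x \<in> cell T"
    using AE_hull_cell by (simp add: AE_finite_all[OF finite_mesh])
  then show ?thesis
  proof eventually_elim
    fix x assume "\<forall>T\<in>\<T>. x \<in> convex hull T \<longrightarrow> x \<in> cell T"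
    moreover have "\<Omega> \<subseteq> \<Union>{convex hull T | T. T \<in> \<T>}"
      using mesh closure_subset[of \<Omega>] by (simp add: conforming_mesh_def)
    ultimately show "x \<in> \<Omega> \<longrightarrow> x \<in> (\<Union>T\<in>\<T>. cell T)" by blast
  qed
qed

lemma lmeasurable_cell: "T \<in> \<T> \<Longrightarrow> cell T \<in> lmeasurable"
  unfolding cell_def using compact_hull compact_imp_bounded bounded_interior
  by (intro lmeasurable_open) auto

lemma Ph_cell:
  assumes "T \<in> \<T>" "x \<in> cell T"
  shows "Ph \<T> F x = (1 / measure lebesgue (convex hull T)) *\<^sub>R integral\<^sup>L (lebesgue_on (convex hull T)) F"
proof -
  have "(SOME T. T \<in> \<T> \<and> x \<in> interior (convex hull T)) = T"
    using assms cell_unique unfolding cell_def by (intro some_equality) auto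
  then show ?thesis unfolding Ph_def using assms by (auto simp: cell_def Let_def)
qed

lemma sum_indicator_cell:
  fixes c :: "(real^3) set \<Rightarrow> 'b::real_vector"
  assumes "T \<in> \<T>" "x \<in> cell T"
  shows "(\<Sum>S\<in>\<T>. indicator (cell S) x *\<^sub>R c S) = c T"
proof -
  have "(\<Sum>S\<in>\<T>. indicator (cell S) x *\<^sub>R c S) = (\<Sum>S\<in>\<T>. if S = T then c S else 0)"
    using assms cell_unique[OF assms(1)] by (intro sum.cong) (auto simp: indicator_def)
  then show ?thesis using finite_mesh assms(1) by simp
qed

lemma L2_Ph: "L2 \<Omega> (Ph \<T> F)"
proof -
  let ?m = "\<lambda>T. (1 / measure lebesgue (convex hull T)) *\<^sub>R integral\<^sup>L (lebesgue_on (convex hull T)) F"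
  have "zero_ext \<Omega> (Ph \<T> F) x = (\<Sum>T\<in>\<T>. indicator (cell T) x *\<^sub>R ?m T)" for x
  proof (cases "\<exists>T\<in>\<T>. x \<in> cell T")
    case True
    then obtain T where T: "T \<in> \<T>" "x \<in> cell T" by blast
    then show ?thesis using Ph_cell[OF T] sum_indicator_cell[OF T, of ?m] cell_subset by (auto simp: zero_ext_def)
  next
    case False
    then have "Ph \<T> F x = 0" by (auto simp: Ph_def cell_def)
    moreover have "(\<Sum>T\<in>\<T>. indicator (cell T) x *\<^sub>R ?m T) = 0" using False by (intro sum.neutral) auto
    ultimately show ?thesis by (simp add: zero_ext_def)
  qed
  then have "zero_ext \<Omega> (Ph \<T> F) = (\<lambda>x. \<Sum>T\<in>\<T>. indicator (cell T) x *\<^sub>R ?m T)" by blast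
  then show ?thesis unfolding L2_iff_zero_ext[OF lebesgue_dom]
    by (simp only:) (intro sq_integrable_sum sq_integrable_indicator lmeasurable_cell)
qed

lemma inner_Ph_cell:
  assumes F: "L2 \<Omega> F" and T: "T \<in> \<T>"
  shows "inner (emb \<Omega> (Ph \<T> F)) (abs_l2 (\<lambda>x. indicator (cell T) x *\<^sub>R c))
    = inner (emb \<Omega> F) (abs_l2 (\<lambda>x. indicator (cell T) x *\<^sub>R c))"
proof -
  let ?H = "convex hull T"
  let ?I = "integral\<^sup>L (lebesgue_on ?H) F"
  have sqF: "sq_integrable (zero_ext \<Omega> F)" and sqPh: "sq_integrable (zero_ext \<Omega> (Ph \<T> F))"
    using F L2_Ph L2_iff_zero_ext[OF lebesgue_dom] by blast+
  note sqc = sq_integrable_indicator[OF lmeasurable_cell[OF T], of c]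
  have H: "?H \<in> lmeasurable" using compact_hull[OF T] by (rule lmeasurable_compact)
  have int: "integrable lebesgue (\<lambda>x. indicator (cell T) x *\<^sub>R F x)"
  proof -
    have "indicator (cell T) x *\<^sub>R zero_ext \<Omega> F x = indicator (cell T) x *\<^sub>R F x" for x
      using cell_subset[OF T] by (auto simp: zero_ext_def indicator_def)
    then show ?thesis using sq_integrable_imp_integrable_on[OF sqF lmeasurable_cell[OF T]] by (simp only:)
  qed
  \<comment> \<open>\<open>Ph\<close> averages over the closed tetrahedron, while fields in
    \<open>Uh\<close> are constant on the open cell; the boundary is a null set.\<close>
  have cell_AE: "AE x in lebesgue. x \<in> ?H \<longleftrightarrow> x \<in> cell T"
    using AE_hull_cell[of T] by eventually_elim (use interior_subset in \<open>auto simp: cell_def\<close>)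
  have "?I = (\<integral>x. indicator ?H x *\<^sub>R F x \<partial>lebesgue)"
    using H by (intro integral_restrict_space) (auto dest: fmeasurableD)
  also have "\<dots> = (\<integral>x. indicator (cell T) x *\<^sub>R F x \<partial>lebesgue)"
  proof (rule integral_cong_AE)
    show eq: "AE x in lebesgue. indicator ?H x *\<^sub>R F x = indicator (cell T) x *\<^sub>R F x"
      using cell_AE by eventually_elim (auto simp: indicator_def)
    show "(\<lambda>x. indicator (cell T) x *\<^sub>R F x) \<in> borel_measurable lebesgue" using int by simp
    then show "(\<lambda>x. indicator ?H x *\<^sub>R F x) \<in> borel_measurable lebesgue"
      by (rule borel_measurable_AE) (use eq in eventually_elim, simp only:)
  qed
  finally have I: "?I = (\<integral>x. indicator (cell T) x *\<^sub>R F x \<partial>lebesgue)" .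
  have meas: "measure lebesgue (cell T) = measure lebesgue ?H"
    using cell_AE lmeasurable_cell[OF T] H by (intro measure_eq_AE) (auto dest: fmeasurableD elim!: eventually_mono)
  have "inner (emb \<Omega> F) (abs_l2 (\<lambda>x. indicator (cell T) x *\<^sub>R c))
      = (\<integral>x. inner (zero_ext \<Omega> F x) (indicator (cell T) x *\<^sub>R c) \<partial>lebesgue)"
    unfolding emb_def by (rule inner_abs_l2[OF sqF sqc])
  also have "\<dots> = (\<integral>x. inner (indicator (cell T) x *\<^sub>R F x) c \<partial>lebesgue)"
    using cell_subset[OF T] by (intro Bochner_Integration.integral_cong) (auto simp: zero_ext_def indicator_def)
  also have "\<dots> = inner ?I c"
    unfolding I using int by (rule integral_inner_left)
  finally have 1: "inner (emb \<Omega> F) (abs_l2 (\<lambda>x. indicator (cell T) x *\<^sub>R c)) = inner ?I c" .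
  have "inner (emb \<Omega> (Ph \<T> F)) (abs_l2 (\<lambda>x. indicator (cell T) x *\<^sub>R c))
      = (\<integral>x. inner (zero_ext \<Omega> (Ph \<T> F) x) (indicator (cell T) x *\<^sub>R c) \<partial>lebesgue)"
    unfolding emb_def by (rule inner_abs_l2[OF sqPh sqc])
  also have "\<dots> = (\<integral>x. indicator (cell T) x * (inner ?I c / measure lebesgue ?H) \<partial>lebesgue)"
    using cell_subset[OF T] Ph_cell[OF T, of _ F]
    by (intro Bochner_Integration.integral_cong) (auto simp: zero_ext_def indicator_def)
  also have "\<dots> = measure lebesgue (cell T) * (inner ?I c / measure lebesgue ?H)"
    by simp
  also have "\<dots> = inner ?I c"
  \<comment> \<open>For a null element the quotient is 0 by convention, and so is \<open>?I\<close>
    as an integral over a null set.\<close>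
  proof (cases "measure lebesgue ?H = 0")
    case True
    then have "negligible ?H" using H by (simp add: negligible_iff_measure0)
    then have "AE x in lebesgue. indicator (cell T) x *\<^sub>R F x = 0"
      using cell_AE AE_not_in[of ?H lebesgue]
      by (auto simp: negligible_iff_null_sets indicator_def elim!: eventually_elim2)
    then have "?I = 0" unfolding I by (rule integral_eq_zero_AE)
    then show ?thesis by simp
  qed (simp add: meas)
  finally show ?thesis using 1 by simp
qed

text \<open>The error of the mean-value projection is orthogonal to elementwise constants. This
  eliminates both projections from the discrete variational inequality.\<close>

lemma inner_Ph:
  assumes F: "L2 \<Omega> F" and W: "W \<in> Uh \<Omega> \<T>"
  shows "inner (emb \<Omega> (Ph \<T> F)) (emb \<Omega> W) = inner (emb \<Omega> F) (emb \<Omega> W)"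
proof -
  have LW: "L2 \<Omega> W" and "\<forall>T\<in>\<T>. \<exists>c. \<forall>x\<in>cell T. W x = c" using W by (auto simp: Uh_def cell_def)
  then obtain c where c: "\<And>T x. T \<in> \<T> \<Longrightarrow> x \<in> cell T \<Longrightarrow> W x = c T" by metis
  have sq: "sq_integrable (\<lambda>x. indicator (cell T) x *\<^sub>R c T)" if "T \<in> \<T>" for T
    by (rule sq_integrable_indicator[OF lmeasurable_cell[OF that]])
  have "AE x in lebesgue. zero_ext \<Omega> W x = (\<Sum>T\<in>\<T>. indicator (cell T) x *\<^sub>R c T)"
    using AE_cells
  proof eventually_elim
    fix x assume x: "x \<in> \<Omega> \<longrightarrow> x \<in> (\<Union>T\<in>\<T>. cell T)"
    show "zero_ext \<Omega> W x = (\<Sum>T\<in>\<T>. indicator (cell T) x *\<^sub>R c T)"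
    proof (cases "x \<in> \<Omega>")
      case True
      then obtain T where T: "T \<in> \<T>" "x \<in> cell T" using x by blast
      then show ?thesis using True sum_indicator_cell[OF T, of c] c[OF T] by (simp add: zero_ext_def)
    next
      case False
      then have "(\<Sum>T\<in>\<T>. indicator (cell T) x *\<^sub>R c T) = 0"
        using cell_subset by (intro sum.neutral) (auto simp: indicator_def)
      then show ?thesis using False by (simp add: zero_ext_def)
    qed
  qed
  then have "emb \<Omega> W = abs_l2 (\<lambda>x. \<Sum>T\<in>\<T>. indicator (cell T) x *\<^sub>R c T)"
    unfolding emb_def using LW sq
    by (subst abs_l2_eq_iff) (auto simp: L2_iff_zero_ext[OF lebesgue_dom] intro!: sq_integrable_sum)
  also have "\<dots> = (\<Sum>T\<in>\<T>. abs_l2 (\<lambda>x. indicator (cell T) x *\<^sub>R c T))" by (rule abs_l2_sum[OF sq])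
  finally have "emb \<Omega> W = (\<Sum>T\<in>\<T>. abs_l2 (\<lambda>x. indicator (cell T) x *\<^sub>R c T))" .
  then show ?thesis using inner_Ph_cell[OF F] by (simp add: inner_sum_right)
qed

text \<open>Each cell lies in one subdomain, where the coefficient is a polynomial, bounded on the
  compact hull; there are finitely many cells. Since cells are open, continuity is checked on each
  separately, jumps being confined to the omitted faces.\<close>

lemma piecewise_poly_coefficient:
  assumes compat: "subdomain_compatible m Om \<T>" and a: "piecewise_poly m Om a"
  shows "continuous_on (\<Union>T\<in>\<T>. cell T) a" "\<exists>C. \<forall>x\<in>(\<Union>T\<in>\<T>. cell T). \<bar>a x\<bar> \<le> C"
proof -
  have p: "\<exists>p. continuous_on UNIV p \<and> (\<forall>x\<in>cell T. a x = p x)" if "T \<in> \<T>" for T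
  proof -
    have "\<exists>i<m. cell T \<subseteq> Om i" using compat that by (simp add: subdomain_compatible_def cell_def)
    then obtain i where "i < m" "cell T \<subseteq> Om i" by blast
    then obtain p where p: "poly3 p" "\<forall>x\<in>cell T. a x = p x" using a unfolding piecewise_poly_def by blast
    obtain c N where "\<And>x. p x = (\<Sum>a\<le>N. \<Sum>b\<le>N. \<Sum>d\<le>N. c a b d * (x $ 1) ^ a * (x $ 2) ^ b * (x $ 3) ^ d)"
      using p(1) unfolding poly3_def by blast
    then have "p = (\<lambda>x. \<Sum>a\<le>N. \<Sum>b\<le>N. \<Sum>d\<le>N. c a b d * (x $ 1) ^ a * (x $ 2) ^ b * (x $ 3) ^ d)" by blast
    then have "continuous_on UNIV p" by (simp only:) (intro continuous_on_sum continuous_on_mult continuous_on_power continuous_on_const continuous_on_id bounded_linear.continuous_on[OF bounded_linear_vec_nth])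
    then show ?thesis using p(2) by blast
  qed
  show "continuous_on (\<Union>T\<in>\<T>. cell T) a"
  proof (rule continuous_on_open_UN)
    fix T assume "T \<in> \<T>"
    then obtain q where "continuous_on UNIV q" "\<forall>x\<in>cell T. a x = q x" using p by blast
    then show "continuous_on (cell T) a"
      using continuous_on_eq[OF continuous_on_subset[of UNIV q "cell T"]] by simp
  qed (simp add: cell_def)
  have "\<exists>C. \<forall>x\<in>cell T. \<bar>a x\<bar> \<le> C" if T: "T \<in> \<T>" for T
  proof -
    obtain p where q: "continuous_on UNIV p" "\<forall>x\<in>cell T. a x = p x" using p[OF T] by blast
    have "compact (p ` (convex hull T))"
      using q(1) compact_hull[OF T] by (blast intro: compact_continuous_image continuous_on_subset)
    then have "bounded (p ` (convex hull T))" by (rule compact_imp_bounded)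
    then obtain C where "\<forall>x\<in>convex hull T. \<bar>p x\<bar> \<le> C" by (auto simp: bounded_iff)
    then show ?thesis using q(2) interior_subset[of "convex hull T"] unfolding cell_def by (metis subsetD)
  qed
  then obtain C where C: "\<And>T x. T \<in> \<T> \<Longrightarrow> x \<in> cell T \<Longrightarrow> \<bar>a x\<bar> \<le> C T" by metis
  have "\<bar>a x\<bar> \<le> (\<Sum>S\<in>\<T>. \<bar>C S\<bar>)" if "T \<in> \<T>" "x \<in> cell T" for x T
  proof -
    have "\<bar>a x\<bar> \<le> \<bar>C T\<bar>" using C[OF that] by simp
    also have "\<dots> \<le> (\<Sum>S\<in>\<T>. \<bar>C S\<bar>)" using that(1) finite_mesh by (intro member_le_sum) auto
    finally show ?thesis .
  qed
  then show "\<exists>C. \<forall>x\<in>(\<Union>T\<in>\<T>. cell T). \<bar>a x\<bar> \<le> C" by blast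
qed

text \<open>The value 1 off the cells keeps the coefficient bounded and coercive on the whole space;
  inside the domain only a null set is affected.\<close>

definition cell_coeff :: "(real^3 \<Rightarrow> real) \<Rightarrow> real^3 \<Rightarrow> real" where
  "cell_coeff a x = (if x \<in> (\<Union>T\<in>\<T>. cell T) then a x else 1)"

lemma cell_coeff_measurable:
  assumes "continuous_on (\<Union>T\<in>\<T>. cell T) a"
  shows "cell_coeff a \<in> borel_measurable lebesgue"
proof -
  let ?D = "\<Union>T\<in>\<T>. cell T"
  have "open ?D" by (auto simp: cell_def)
  then have D: "?D \<in> sets lebesgue" by (simp add: borel_open)
  have "(\<lambda>x. if x \<in> ?D then a x else 0) \<in> borel_measurable lebesgue"
    using borel_measurable_if[OF D, of a] continuous_imp_measurable_on_sets_lebesgue[OF assms D] by simp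
  then have "(\<lambda>x. (if x \<in> ?D then a x else 0) + indicator (- ?D) x) \<in> borel_measurable lebesgue"
    using D by (intro borel_measurable_add borel_measurable_indicator) (simp only: Compl_in_sets_lebesgue)+
  moreover have "(\<lambda>x. (if x \<in> ?D then a x else 0) + indicator (- ?D) x) = cell_coeff a"
    by (auto simp: cell_coeff_def fun_eq_iff indicator_def)
  ultimately show ?thesis by simp
qed

text \<open>Inside the domain the two weights differ only off the cells, on a null set; outside it,
  the zero extensions remove the weight.\<close>

lemma ip_weighted:
  assumes a: "continuous_on (\<Union>T\<in>\<T>. cell T) a" and F: "L2 \<Omega> F" and H: "L2 \<Omega> H"
  shows "ip \<Omega> (\<lambda>x. a x *\<^sub>R F x) H = weighted_inner (cell_coeff a) (emb \<Omega> F) (emb \<Omega> H)"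
proof -
  have sq: "sq_integrable (zero_ext \<Omega> F)" "sq_integrable (zero_ext \<Omega> H)"
    using F H L2_iff_zero_ext[OF lebesgue_dom] by blast+
  note meas = cell_coeff_measurable[OF a]
  let ?l = "\<lambda>x. inner (zero_ext \<Omega> (\<lambda>x. a x *\<^sub>R F x) x) (zero_ext \<Omega> H x)"
  let ?r = "\<lambda>x. cell_coeff a x * inner (zero_ext \<Omega> F x) (zero_ext \<Omega> H x)"
  have r: "?r \<in> borel_measurable lebesgue"
    using meas sq[THEN sq_integrable_measurable] by (intro borel_measurable_times borel_measurable_inner)
  have eq: "AE x in lebesgue. ?r x = ?l x"
    using AE_cells by eventually_elim (auto simp: zero_ext_def cell_coeff_def)
  have "ip \<Omega> (\<lambda>x. a x *\<^sub>R F x) H = integral\<^sup>L lebesgue ?l" by (rule ip_zero_ext[OF lebesgue_dom])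
  also have "\<dots> = integral\<^sup>L lebesgue ?r"
    using borel_measurable_AE[OF r eq] r eq by (intro integral_cong_AE) (auto elim: eventually_mono)
  also have "\<dots> = weighted_inner (cell_coeff a) (emb \<Omega> F) (emb \<Omega> H)"
    unfolding emb_def by (rule weighted_inner_abs[OF meas sq, symmetric])
  finally show ?thesis .
qed

end

section \<open>Nestedness of the discrete sets under refinement\<close>

lemma refines_cell:
  assumes "refines \<T>' \<T>" "T' \<in> \<T>'"
  obtains T where "T \<in> \<T>" "interior (convex hull T') \<subseteq> interior (convex hull T)"
  using assms interior_mono unfolding refines_def by meson

lemma Vh_refines:
  assumes "refines \<T>' \<T>"
  shows "Vh G \<T> \<subseteq> Vh G \<T>'"
proof
  fix v assume v: "v \<in> Vh G \<T>"
  have "\<exists>a b. \<forall>x\<in>interior (convex hull T'). v x = cross3 a x + b" if "T' \<in> \<T>'" for T'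
  proof -
    obtain T where T: "T \<in> \<T>" "interior (convex hull T') \<subseteq> interior (convex hull T)"
      using refines_cell[OF assms \<open>T' \<in> \<T>'\<close>] .
    then obtain a b where "\<forall>x\<in>interior (convex hull T). v x = cross3 a x + b"
      using v unfolding Vh_def by blast
    then show ?thesis using T(2) by blast
  qed
  then show "v \<in> Vh G \<T>'" using v by (simp add: Vh_def)
qed

lemma Uhad_refines:
  assumes "refines \<T>' \<T>"
  shows "Uhad G \<T> \<subseteq> Uhad G \<T>'"
proof
  fix u assume u: "u \<in> Uhad G \<T>"
  have "\<exists>c. \<forall>x\<in>interior (convex hull T'). u x = c" if "T' \<in> \<T>'" for T'
  proof -
    obtain T where T: "T \<in> \<T>" "interior (convex hull T') \<subseteq> interior (convex hull T)"
      using refines_cell[OF assms \<open>T' \<in> \<T>'\<close>] .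
    then obtain c where "\<forall>x\<in>interior (convex hull T). u x = c"
      using u unfolding Uhad_def Uh_def by blast
    then show ?thesis using T(2) by blast
  qed
  then show "u \<in> Uhad G \<T>'" using u by (simp add: Uhad_def Uh_def)
qed

section \<open>Convergence of the adaptive approximations\<close>

theorem theorem4p4:
  fixes \<Omega> :: "(real^3) set" and m :: nat and Om :: "nat \<Rightarrow> (real^3) set"
    and \<mu> \<sigma> :: "real^3 \<Rightarrow> real" and \<mu>0 \<sigma>0 \<alpha> :: real
    and f yd ud :: vfield
    and \<T> :: "nat \<Rightarrow> (real^3) set set"
    and y p u :: "nat \<Rightarrow> vfield"
  assumes dom: "lipschitz_domain \<Omega>"
    and sub_dom: "\<forall>i<m. lipschitz_domain (Om i)"
    and sub_disj: "\<forall>i<m. \<forall>j<m. i \<noteq> j \<longrightarrow> Om i \<inter> Om j = {}"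
    and sub_cover: "closure \<Omega> = (\<Union>i<m. closure (Om i))"
    and mu_poly: "piecewise_poly m Om \<mu>" and sigma_poly: "piecewise_poly m Om \<sigma>"
    and mu0: "\<mu>0 > 0" and mu_lb: "\<forall>x \<in> \<Omega>. \<mu> x \<ge> \<mu>0"
    and sigma0: "\<sigma>0 > 0" and sigma_lb: "\<forall>x \<in> \<Omega>. \<sigma> x \<ge> \<sigma>0"
    and alpha: "\<alpha> > 0"
    and f_L2: "L2 \<Omega> f" and f_div: "\<forall>i<m. f \<in> Hdiv (Om i)"
    and yd: "yd \<in> Hcurl0 \<Omega>" and ud: "L2 \<Omega> ud"
    and mesh: "\<forall>k. conforming_mesh \<Omega> (\<T> k) \<and> subdomain_compatible m Om (\<T> k)"
    and nested: "\<forall>k. refines (\<T> (Suc k)) (\<T> k)"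
    and shape_reg: "\<exists>C. \<forall>k. \<forall>T \<in> \<T> k. (diameter (convex hull T)) ^ 3 \<le> C * measure lebesgue (convex hull T)"
    and discrete: "\<forall>k. discrete_opt \<Omega> \<mu> \<sigma> \<alpha> f yd ud (\<T> k) (y k) (p k) (u k)"
  shows "\<exists>yinf uinf.
           lim_solution \<Omega> \<mu> \<sigma> \<alpha> f yd ud \<T> yinf uinf \<and>
           (\<forall>Y U. lim_solution \<Omega> \<mu> \<sigma> \<alpha> f yd ud \<T> Y U \<longrightarrow>
                  nrm_curl \<Omega> (\<lambda>x. Y x - yinf x) = 0 \<and> nrm \<Omega> (\<lambda>x. U x - uinf x) = 0) \<and>
           weak_L2 \<Omega> u uinf \<and> weak_Hcurl0 \<Omega> y yinf"
proof -
  have mesh_domain: "mesh_domain \<Omega> (\<T> k)" for k using dom mesh by unfold_locales auto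
  \<comment> \<open>The modified coefficients are built once, from the initial mesh, so that a
    single bilinear form serves all levels.\<close>
  interpret M0: mesh_domain \<Omega> "\<T> 0" by (rule mesh_domain)
  note op = M0.open_dom and leb = M0.lebesgue_dom
  let ?E = "graph_emb \<Omega>" and ?e = "emb \<Omega>" and ?D = "\<Union>T\<in>\<T> 0. M0.cell T"
  have compat: "subdomain_compatible m Om (\<T> 0)" using mesh by blast
  have sub_D: "?D \<subseteq> \<Omega>" using M0.cell_subset by blast
  obtain C\<mu> C\<sigma> where C: "\<And>x. x \<in> ?D \<Longrightarrow> \<bar>\<mu> x\<bar> \<le> C\<mu>" "\<And>x. x \<in> ?D \<Longrightarrow> \<bar>\<sigma> x\<bar> \<le> C\<sigma>"
    using M0.piecewise_poly_coefficient(2)[OF compat mu_poly] M0.piecewise_poly_coefficient(2)[OF compat sigma_poly]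
    by blast
  have lb: "\<mu>0 \<le> \<mu> x" "\<sigma>0 \<le> \<sigma> x" if "x \<in> ?D" for x using that sub_D mu_lb sigma_lb by blast+
  let ?a = "M0.cell_coeff (\<lambda>x. 1 / \<mu> x)" and ?s = "M0.cell_coeff \<sigma>"
  have s_cont: "continuous_on ?D \<sigma>" by (rule M0.piecewise_poly_coefficient(1)[OF compat sigma_poly])
  have a_cont: "continuous_on ?D (\<lambda>x. 1 / \<mu> x)"
    using lb(1) mu0 by (intro continuous_on_divide continuous_on_const M0.piecewise_poly_coefficient(1)[OF compat mu_poly]) force
  note meas = M0.cell_coeff_measurable[OF a_cont] M0.cell_coeff_measurable[OF s_cont]
  have bound: "\<bar>?a x\<bar> \<le> max 1 (1 / \<mu>0)" "\<bar>?s x\<bar> \<le> max 1 C\<sigma>" for x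
  proof -
    have "\<bar>1 / \<mu> x\<bar> \<le> 1 / \<mu>0" if "x \<in> ?D" using lb(1)[OF that] mu0 by (simp add: frac_le)
    then show "\<bar>?a x\<bar> \<le> max 1 (1 / \<mu>0)"
      by (cases "x \<in> ?D") (simp_all only: M0.cell_coeff_def if_True if_False le_max_iff_disj, simp_all)
    show "\<bar>?s x\<bar> \<le> max 1 C\<sigma>"
      using C(2)[of x] by (cases "x \<in> ?D") (simp_all only: M0.cell_coeff_def if_True if_False le_max_iff_disj, simp_all)
  qed
  \<comment> \<open>The three terms bound the weights below: 1 is their value off the cells,
    \<sigma>0 the bound for \<sigma>, and the reciprocal of max 1 C\<mu> the bound for 1/\<mu>; the
    maximum keeps the denominator positive.\<close>
  define c where "c = min (min 1 \<sigma>0) (1 / max 1 C\<mu>)"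
  have c_pos: "0 < c" using sigma0 by (simp add: c_def)
  have lower: "c \<le> ?a x" "c \<le> ?s x" for x
  proof -
    have "1 / max 1 C\<mu> \<le> 1 / \<mu> x" if "x \<in> ?D"
      using lb(1)[OF that] C(1)[OF that] mu0 by (intro divide_left_mono mult_pos_pos) auto
    then show "c \<le> ?a x"
      by (cases "x \<in> ?D") (simp_all only: M0.cell_coeff_def c_def if_True if_False min_le_iff_disj, simp_all)
    show "c \<le> ?s x"
      using lb(2)[of x] by (cases "x \<in> ?D") (simp_all only: M0.cell_coeff_def c_def if_True if_False min_le_iff_disj, simp_all)
  qed
  define B where "B = (\<lambda>X Z :: (real^3, real^3) l2 \<times> (real^3, real^3) l2.
    weighted_inner ?a (snd X) (snd Z) + weighted_inner ?s (fst X) (fst Z))"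
  have Bf: "Bf \<Omega> \<mu> \<sigma> Y \<phi> = B (?E Y) (?E \<phi>)" if "Y \<in> Hcurl \<Omega>" "\<phi> \<in> Hcurl \<Omega>" for Y \<phi>
    unfolding Bf_def B_def graph_emb_def
    using wcurl_L2[OF that(1)] wcurl_L2[OF that(2)] M0.ip_weighted[OF a_cont] M0.ip_weighted[OF s_cont] by simp
  have yd_L2: "L2 \<Omega> yd" using yd wcurl_L2(1) by (auto simp: Hcurl0_def)
  have state: "ip \<Omega> (\<lambda>x. f x + U x) \<phi> = inner (?e f + ?e U) (fst (?E \<phi>))" if "L2 \<Omega> U" "\<phi> \<in> Hcurl \<Omega>" for U \<phi>
    using that wcurl_L2[OF that(2)] f_L2
    by (simp add: ip_emb[OF leb] L2_add[OF leb] emb_add[OF leb] graph_emb_def)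
  have adj: "ip \<Omega> (\<lambda>x. wcurl \<Omega> Y x - yd x) (wcurl \<Omega> \<phi>) = inner (snd (?E Y) - ?e yd) (snd (?E \<phi>))"
    if "Y \<in> Hcurl \<Omega>" "\<phi> \<in> Hcurl \<Omega>" for Y \<phi>
    using wcurl_L2[OF that(1)] wcurl_L2[OF that(2)] yd_L2
    by (simp add: ip_emb[OF leb] L2_diff[OF leb] emb_diff[OF leb] graph_emb_def)
  have disc: "y k \<in> Vh \<Omega> (\<T> k)" "p k \<in> Vh \<Omega> (\<T> k)" "u k \<in> Uhad \<Omega> (\<T> k)"
    "\<And>\<phi>. \<phi> \<in> Vh \<Omega> (\<T> k) \<Longrightarrow> Bf \<Omega> \<mu> \<sigma> (y k) \<phi> = ip \<Omega> (\<lambda>x. f x + u k x) \<phi>"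
    "\<And>\<phi>. \<phi> \<in> Vh \<Omega> (\<T> k) \<Longrightarrow> Bf \<Omega> \<mu> \<sigma> (p k) \<phi> = ip \<Omega> (\<lambda>x. wcurl \<Omega> (y k) x - yd x) (wcurl \<Omega> \<phi>)"
    "\<And>W. W \<in> Uhad \<Omega> (\<T> k) \<Longrightarrow>
      0 \<le> ip \<Omega> (\<lambda>x. Ph (\<T> k) (p k) x + \<alpha> *\<^sub>R (u k x - Ph (\<T> k) ud x)) (\<lambda>x. W x - u k x)" for k
    using discrete unfolding discrete_opt_def by auto
  have Hc: "v \<in> Hcurl \<Omega>" if "v \<in> Vh \<Omega> (\<T> k)" for v k using Vh_Hcurl[OF op that] .
  have Uh_L2: "L2 \<Omega> W" if "W \<in> Uhad \<Omega> (\<T> k)" for W k using that by (simp add: Uhad_def Uh_def)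
  interpret N: nested_control B c "\<lambda>k. ?E ` Vh \<Omega> (\<T> k)" "\<lambda>k. ?e ` Uhad \<Omega> (\<T> k)"
    "?e f" "?e yd" "?e ud" \<alpha> "\<lambda>k. ?E (y k)" "\<lambda>k. ?E (p k)" "\<lambda>k. ?e (u k)"
  proof (intro nested_control.intro symmetric_coercive.intro nested_control_axioms.intro)
    interpret a: bounded_bilinear "weighted_inner ?a :: (real^3, real^3) l2 \<Rightarrow> _"
      by (rule bounded_bilinear_weighted_inner[OF meas(1) bound(1)])
    interpret s: bounded_bilinear "weighted_inner ?s :: (real^3, real^3) l2 \<Rightarrow> _"
      by (rule bounded_bilinear_weighted_inner[OF meas(2) bound(2)])
    show "bounded_bilinear B" unfolding B_def
      by (intro bounded_bilinear_add
          a.comp[OF bounded_linear_snd bounded_linear_snd] s.comp[OF bounded_linear_fst bounded_linear_fst])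
    show "B X Z = B Z X" for X Z unfolding B_def using weighted_inner_commute by metis
    show "c * (norm X)\<^sup>2 \<le> B X X" for X
    proof -
      have "(norm X)\<^sup>2 = (norm (snd X))\<^sup>2 + (norm (fst X))\<^sup>2" by (simp add: norm_prod_def)
      then show ?thesis unfolding B_def
        using weighted_inner_coercive[OF meas(1) bound(1) lower(1), of "snd X"]
          weighted_inner_coercive[OF meas(2) bound(2) lower(2), of "fst X"] by (simp add: distrib_left)
    qed
    show "subspace (?E ` Vh \<Omega> (\<T> k))" for k by (rule subspace_graph_emb_Vh[OF op])
    show "?E ` Vh \<Omega> (\<T> k) \<subseteq> ?E ` Vh \<Omega> (\<T> (Suc k))" for k using Vh_refines nested by (intro image_mono) blast
    show "convex (?e ` Uhad \<Omega> (\<T> k))" for k by (rule convex_emb_Uhad[OF leb])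
    show "0 \<in> ?e ` Uhad \<Omega> (\<T> k)" for k by (rule zero_in_emb_Uhad[OF leb])
    show "?e ` Uhad \<Omega> (\<T> k) \<subseteq> ?e ` Uhad \<Omega> (\<T> (Suc k))" for k using Uhad_refines nested by (intro image_mono) blast
    show "?E (y k) \<in> ?E ` Vh \<Omega> (\<T> k)" "?E (p k) \<in> ?E ` Vh \<Omega> (\<T> k)" "?e (u k) \<in> ?e ` Uhad \<Omega> (\<T> k)" for k
      using disc by auto
    show "B (?E (y k)) \<phi> = inner (?e f + ?e (u k)) (fst \<phi>)" if "\<phi> \<in> ?E ` Vh \<Omega> (\<T> k)" for k \<phi>
      using that disc(4)[of _ k] Bf[OF Hc[OF disc(1)] Hc] state[OF Uh_L2[OF disc(3)] Hc] by auto
    show "B (?E (p k)) \<phi> = inner (snd (?E (y k)) - ?e yd) (snd \<phi>)" if "\<phi> \<in> ?E ` Vh \<Omega> (\<T> k)" for k \<phi>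
      using that disc(5)[of _ k] Bf[OF Hc[OF disc(2)] Hc] adj[OF Hc[OF disc(1)] Hc] by auto
    show "0 \<le> inner (fst (?E (p k)) + \<alpha> *\<^sub>R (?e (u k) - ?e ud)) (w - ?e (u k))" if w: "w \<in> ?e ` Uhad \<Omega> (\<T> k)" for k w
    proof -
      interpret Mk: mesh_domain \<Omega> "\<T> k" by (rule mesh_domain)
      obtain W where W: "w = ?e W" "W \<in> Uhad \<Omega> (\<T> k)" using w by blast
      note L2s = Mk.L2_Ph[of "p k"] Mk.L2_Ph[of ud] Uh_L2[OF disc(3), of k] Uh_L2[OF W(2)] ud wcurl_L2(1)[OF Hc[OF disc(2)], of k]
      have uW: "W \<in> Uh \<Omega> (\<T> k)" "u k \<in> Uh \<Omega> (\<T> k)" using W(2) disc(3)[of k] by (auto simp: Uhad_def)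
      have "0 \<le> inner (?e (Ph (\<T> k) (p k)) + \<alpha> *\<^sub>R (?e (u k) - ?e (Ph (\<T> k) ud))) (?e W - ?e (u k))"
        using disc(6)[OF W(2)] L2s
        by (simp add: ip_emb[OF leb] L2_add[OF leb] L2_diff[OF leb] L2_scaleR[OF leb]
            emb_add[OF leb] emb_diff[OF leb] emb_scaleR[OF leb])
      \<comment> \<open>W - u_k is elementwise constant, so orthogonality replaces the projections
        of the adjoint and of the desired control by the fields themselves.\<close>
      also have "\<dots> = inner (?e (p k) + \<alpha> *\<^sub>R (?e (u k) - ?e ud)) (?e W - ?e (u k))"
        using Mk.inner_Ph[OF L2s(6)] Mk.inner_Ph[OF ud] uW by (simp add: inner_simps)
      finally show ?thesis by (simp add: W(1) graph_emb_def)
    qed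
  qed (use alpha c_pos in auto)
  have Vlim: "N.Vlim = ?E ` Vinf \<Omega> \<T>" unfolding N.Vlim_def by (rule closure_graph_emb_Vh[OF op])
  have Klim: "N.Klim = ?e ` Uinfad \<Omega> \<T>" unfolding N.Klim_def by (rule closure_emb_Uhad[OF leb])
  have Vinf_H: "v \<in> Hcurl \<Omega>" if "v \<in> Vinf \<Omega> \<T>" for v using that by (simp add: Vinf_def)
  have Uinf_L2: "L2 \<Omega> v" if "v \<in> Uinfad \<Omega> \<T>" for v using that by (simp add: Uinfad_def)
  have feas: "lim_feasible \<Omega> \<mu> \<sigma> f \<T> Y U \<longleftrightarrow> N.feasible (?E Y) (?e U)"
    if "Y \<in> Vinf \<Omega> \<T>" "U \<in> Uinfad \<Omega> \<T>" for Y U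
    unfolding lim_feasible_def N.feasible_def Vlim Klim using that
    by (auto simp: Bf Vinf_H state[OF Uinf_L2])
  have cost: "Jcost \<Omega> \<alpha> yd ud Y U = N.cost (?E Y) (?e U)" if "Y \<in> Vinf \<Omega> \<T>" "U \<in> Uinfad \<Omega> \<T>" for Y U
    unfolding Jcost_def N.cost_def
    using wcurl_L2[OF Vinf_H[OF that(1)]] Uinf_L2[OF that(2)] yd_L2 ud
    by (simp add: nrm_emb[OF leb] L2_diff[OF leb] emb_diff[OF leb] graph_emb_def)
  have sol: "lim_solution \<Omega> \<mu> \<sigma> \<alpha> f yd ud \<T> Y U \<longleftrightarrow> N.solution (?E Y) (?e U)"
    if YU: "Y \<in> Vinf \<Omega> \<T>" "U \<in> Uinfad \<Omega> \<T>" for Y U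
  proof -
    have "(\<forall>Y' U'. lim_feasible \<Omega> \<mu> \<sigma> f \<T> Y' U' \<longrightarrow> Jcost \<Omega> \<alpha> yd ud Y U \<le> Jcost \<Omega> \<alpha> yd ud Y' U')
        \<longleftrightarrow> (\<forall>Y'\<in>Vinf \<Omega> \<T>. \<forall>U'\<in>Uinfad \<Omega> \<T>. N.feasible (?E Y') (?e U') \<longrightarrow> N.cost (?E Y) (?e U) \<le> N.cost (?E Y') (?e U'))"
    proof (intro iffI ballI allI impI)
      fix Y' U'
      assume "\<forall>Y' U'. lim_feasible \<Omega> \<mu> \<sigma> f \<T> Y' U' \<longrightarrow> Jcost \<Omega> \<alpha> yd ud Y U \<le> Jcost \<Omega> \<alpha> yd ud Y' U'"
        "Y' \<in> Vinf \<Omega> \<T>" "U' \<in> Uinfad \<Omega> \<T>" "N.feasible (?E Y') (?e U')"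
      then show "N.cost (?E Y) (?e U) \<le> N.cost (?E Y') (?e U')"
        using feas[of Y' U'] cost[of Y' U'] cost[OF YU] by metis
    next
      fix Y' U'
      assume *: "\<forall>Y'\<in>Vinf \<Omega> \<T>. \<forall>U'\<in>Uinfad \<Omega> \<T>. N.feasible (?E Y') (?e U') \<longrightarrow> N.cost (?E Y) (?e U) \<le> N.cost (?E Y') (?e U')"
        and feasible: "lim_feasible \<Omega> \<mu> \<sigma> f \<T> Y' U'"
      then have "Y' \<in> Vinf \<Omega> \<T>" "U' \<in> Uinfad \<Omega> \<T>" by (auto simp: lim_feasible_def)
      then show "Jcost \<Omega> \<alpha> yd ud Y U \<le> Jcost \<Omega> \<alpha> yd ud Y' U'"
        using feas[of Y' U'] cost[of Y' U'] cost[OF YU] feasible * by simp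
    qed
    \<comment> \<open>The limiting sets of classes are images of the function sets, so every
      abstract competitor comes from functions.\<close>
    also have "\<dots> \<longleftrightarrow> (\<forall>Y' U'. N.feasible Y' U' \<longrightarrow> N.cost (?E Y) (?e U) \<le> N.cost Y' U')"
      unfolding N.feasible_def Vlim Klim by blast
    finally show ?thesis unfolding lim_solution_def N.solution_def using feas[OF YU] by simp
  qed
  obtain Y0 U0 where "N.solution Y0 U0" using N.solution_exists by blast
  moreover then have "Y0 \<in> ?E ` Vinf \<Omega> \<T>" "U0 \<in> ?e ` Uinfad \<Omega> \<T>"
    by (auto simp: N.solution_def N.feasible_def Vlim Klim)
  ultimately obtain yinf uinf where inf: "yinf \<in> Vinf \<Omega> \<T>" "uinf \<in> Uinfad \<Omega> \<T>" and Nsol: "N.solution (?E yinf) (?e uinf)"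
    by blast
  have "lim_solution \<Omega> \<mu> \<sigma> \<alpha> f yd ud \<T> yinf uinf" using sol[OF inf] Nsol by blast
  moreover have "nrm_curl \<Omega> (\<lambda>x. Y x - yinf x) = 0 \<and> nrm \<Omega> (\<lambda>x. U x - uinf x) = 0"
    if S: "lim_solution \<Omega> \<mu> \<sigma> \<alpha> f yd ud \<T> Y U" for Y U
  proof -
    have YU: "Y \<in> Vinf \<Omega> \<T>" "U \<in> Uinfad \<Omega> \<T>" using S by (auto simp: lim_solution_def lim_feasible_def)
    then have "?E Y = ?E yinf" "?e U = ?e uinf" using N.solution_unique[OF _ Nsol] sol[OF YU] S by blast+
    then show ?thesis
      using Hcurl_diff[OF op Vinf_H[OF YU(1)] Vinf_H[OF inf(1)]] Uinf_L2[OF YU(2)] Uinf_L2[OF inf(2)]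
      by (simp add: nrm_curl_graph_emb[OF op] nrm_emb[OF leb] L2_diff[OF leb] emb_diff[OF leb])
  qed
  moreover have "weak_L2 \<Omega> u uinf"
    unfolding weak_L2_def
    using tendsto_inner[OF N.solution_limit(1)[OF Nsol] tendsto_const] Uh_L2[OF disc(3)] Uinf_L2[OF inf(2)]
    by (simp add: ip_emb[OF leb])
  moreover have "weak_Hcurl0 \<Omega> y yinf"
    unfolding weak_Hcurl0_def
  proof
    fix W assume "W \<in> Hcurl0 \<Omega>"
    then have W: "W \<in> Hcurl \<Omega>" by (simp add: Hcurl0_def)
    have eq: "ip \<Omega> v W + ip \<Omega> (wcurl \<Omega> v) (wcurl \<Omega> W) = inner (?E v) (?E W)" if "v \<in> Hcurl \<Omega>" for v
      using wcurl_L2[OF that] wcurl_L2[OF W] by (simp add: ip_emb[OF leb] graph_emb_def)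
    show "(\<lambda>k. ip \<Omega> (y k) W + ip \<Omega> (wcurl \<Omega> (y k)) (wcurl \<Omega> W))
        \<longlonglongrightarrow> ip \<Omega> yinf W + ip \<Omega> (wcurl \<Omega> yinf) (wcurl \<Omega> W)"
      unfolding eq[OF Hc[OF disc(1)]] eq[OF Vinf_H[OF inf(1)]]
      by (intro tendsto_inner tendsto_const N.solution_limit(2)[OF Nsol])
  qed
  ultimately show ?thesis by blast
qed

end
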